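(* Let $n\ge 2$ and $0\le l<k\le n$ be integers. Suppose $0\le\alpha<1$ is a real number, and $\phi:(0,\infty)\to(0,\infty)$ is a $C^1$ increasing function. Then any smooth strictly convex solution $M$ to $$\left(\frac{P_k(W)}{P_l(W)}\right)^{\frac{1}{k-l}}=u^{\alpha}\phi(r)\quad\text{on }\mathbb{S}^n$$ must be a sphere. Moreover, if in addition $\phi'(t)>0$ for any $t>0$, then $M$ is an origin-centred sphere.
   Context: $(\mathbb{S}^n,g_0,\nabla)$ is the unit sphere in $\mathbb{R}^{n+1}$ with its standard metric and Levi-Civita connection. A smooth strictly convex solution $M$ means a smooth closed hypersurface $M\subset\mathbb{R}^{n+1}$ with strictly positive Gauss curvature that bounds a convex body $K$ containing the origin in its interior, and such that the equation holds with the following notation. $u:\mathbb{S}^n\to(0,\infty)$ is the support function of $K$; $X(z)=u(z)z+\nabla u(z)$ is the point of $M$ with unit outer normal $z$; $r(z)=|X(z)|=\sqrt{u^2+|\nabla u|^2}$ is the radial function viewed on $\mathbb{S}^n$ via the Gauss map; $W=\nabla^2u+u g_0$. $P_i(W)$ is the normalized $i$-th elementary symmetric function of the eigenvalues $\lambda_1,\dots,\lambda_n$ of $W$ with respect to $g_0$, $P_i(W)=\binom{n}{i}^{-1}\sum_{j_1<\cdots<j_i}\lambda_{j_1}\cdots\lambda_{j_i}$, with $P_0=1$. "Increasing" is understood in the weak sense ($\phi'\ge 0$). *)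

theory Defs
  imports "HOL-Analysis.Analysis" "HOL-Library.Multiset"
begin

section \<open>Smooth hypersurfaces bounding convex bodies\<close>

text \<open>Intended for open \<open>S\<close>: continuity of all iterated directional derivatives up to order \<open>k\<close>,
  together with total differentiability at each lower order.\<close>

primrec Ck_on :: "nat \<Rightarrow> 'a::real_normed_vector set \<Rightarrow> ('a \<Rightarrow> 'b::real_normed_vector) \<Rightarrow> bool" where
  "Ck_on 0 S f \<longleftrightarrow> continuous_on S f"
| "Ck_on (Suc k) S f \<longleftrightarrow>
     (\<forall>x\<in>S. f differentiable (at x)) \<and> (\<forall>v. Ck_on k S (\<lambda>x. frechet_derivative f (at x) v))"

definition smooth_on :: "'a::real_normed_vector set \<Rightarrow> ('a \<Rightarrow> 'b::real_normed_vector) \<Rightarrow> bool" where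
  "smooth_on S f \<longleftrightarrow> (\<forall>k. Ck_on k S f)"

text \<open>A hypersurface is embedded and without boundary: locally a regular level set.\<close>

definition smooth_hypersurface :: "'a::euclidean_space set \<Rightarrow> bool" where
  "smooth_hypersurface M \<longleftrightarrow>
     (\<forall>p\<in>M. \<exists>U (F :: 'a \<Rightarrow> real). open U \<and> p \<in> U \<and> smooth_on U F \<and>
        (\<forall>x\<in>U. frechet_derivative F (at x) \<noteq> (\<lambda>v. 0)) \<and> M \<inter> U = {x\<in>U. F x = 0})"

text \<open>Unique at boundary points \<open>p\<close> of a convex body \<open>K\<close> with smooth boundary.\<close>

definition outer_normal :: "'a::euclidean_space set \<Rightarrow> 'a \<Rightarrow> 'a" where
  "outer_normal K p = (THE z. norm z = 1 \<and> (\<forall>x\<in>K. x \<bullet> z \<le> p \<bullet> z))"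

text \<open>The tangent hyperplane (as a linear subspace) at a point with unit normal \<open>z\<close>.
  The tangent space of the unit sphere at \<open>z\<close> is \<open>tangent z\<close>.\<close>

definition tangent :: "'a::euclidean_space \<Rightarrow> 'a set" where
  "tangent z = {v. v \<bullet> z = 0}"

text \<open>Eigenvalues, with multiplicity, of an endomorphism \<open>A\<close> of the subspace \<open>V\<close>; only the
  values of \<open>A\<close> on \<open>V\<close> matter. Multiplicity is geometric multiplicity, which is appropriate
  because the operators below (shape operator, Hessian) are self-adjoint.\<close>

definition eigenvalues :: "'a::euclidean_space set \<Rightarrow> ('a \<Rightarrow> 'a) \<Rightarrow> real multiset" where
  "eigenvalues V A = Abs_multiset (\<lambda>c. dim {v\<in>V. A v = c *\<^sub>R v})"

text \<open>The shape operator is the differential of the Gauss map. A derivative \<open>at p within M\<close> is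
  determined only on vectors tangent to \<open>M\<close>, and only these are used.
  With the outer normal, convex hypersurfaces have nonnegative principal curvatures.\<close>

definition Gauss_curvature :: "'a::euclidean_space set \<Rightarrow> 'a set \<Rightarrow> 'a \<Rightarrow> real" where
  "Gauss_curvature M K p =
     prod_mset (eigenvalues (tangent (outer_normal K p))
       (frechet_derivative (outer_normal K) (at p within M)))"

definition bounds_convex_body :: "'a::euclidean_space set \<Rightarrow> 'a set \<Rightarrow> bool" where
  "bounds_convex_body M K \<longleftrightarrow> compact K \<and> convex K \<and> 0 \<in> interior K \<and> M = frontier K"

definition smooth_strictly_convex :: "'a::euclidean_space set \<Rightarrow> 'a set \<Rightarrow> bool" where
  "smooth_strictly_convex M K \<longleftrightarrow>
     compact M \<and> smooth_hypersurface M \<and> bounds_convex_body M K \<and>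
     (\<forall>p\<in>M. Gauss_curvature M K p > 0)"

definition support_fun :: "'a::euclidean_space set \<Rightarrow> 'a \<Rightarrow> real" where
  "support_fun K z = (SUP x\<in>K. x \<bullet> z)"


section \<open>Calculus on the unit sphere\<close>

text \<open>The differential at \<open>z\<close> of a map on the unit sphere, to be applied to tangent vectors only
  (see the remark on the shape operator).\<close>

definition sphere_diff :: "('a::euclidean_space \<Rightarrow> 'b::real_normed_vector) \<Rightarrow> 'a \<Rightarrow> 'a \<Rightarrow> 'b" where
  "sphere_diff f z = frechet_derivative f (at z within sphere 0 1)"

definition sphere_grad :: "('a::euclidean_space \<Rightarrow> real) \<Rightarrow> 'a \<Rightarrow> 'a" where
  "sphere_grad u z = (THE g. g \<in> tangent z \<and> (\<forall>v\<in>tangent z. g \<bullet> v = sphere_diff u z v))"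

text \<open>The Levi-Civita connection of a submanifold of Euclidean space is the tangential
  projection of the ambient derivative; \<open>Y\<close> is a tangent vector field.\<close>

definition sphere_cov :: "('a::euclidean_space \<Rightarrow> 'a) \<Rightarrow> 'a \<Rightarrow> 'a \<Rightarrow> 'a" where
  "sphere_cov Y z v = (let w = sphere_diff Y z v in w - (w \<bullet> z) *\<^sub>R z)"

text \<open>The tensor \<open>\<nabla>\<^sup>2u + u g\<^sub>0\<close>, viewed through the metric as an endomorphism of the tangent space:
  the Hessian is \<open>v \<mapsto> \<nabla>\<^sub>v (\<nabla>u)\<close>.\<close>

definition W_op :: "('a::euclidean_space \<Rightarrow> real) \<Rightarrow> 'a \<Rightarrow> 'a \<Rightarrow> 'a" where
  "W_op u z v = sphere_cov (sphere_grad u) z v + u z *\<^sub>R v"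

definition X_map :: "('a::euclidean_space \<Rightarrow> real) \<Rightarrow> 'a \<Rightarrow> 'a" where
  "X_map u z = u z *\<^sub>R z + sphere_grad u z"

definition radial_fun :: "('a::euclidean_space \<Rightarrow> real) \<Rightarrow> 'a \<Rightarrow> real" where
  "radial_fun u z = norm (X_map u z)"


section \<open>Normalized elementary symmetric functions\<close>

definition elem_sym :: "nat \<Rightarrow> real list \<Rightarrow> real" where
  "elem_sym i xs = (\<Sum>J | J \<subseteq> {..<length xs} \<and> card J = i. \<Prod>j\<in>J. xs ! j)"

text \<open>The listing order of the eigenvalues is immaterial.\<close>

definition P_sym :: "nat \<Rightarrow> ('a::euclidean_space \<Rightarrow> real) \<Rightarrow> 'a \<Rightarrow> real" where
  "P_sym i u z =
     elem_sym i (sorted_list_of_multiset (eigenvalues (tangent z) (W_op u z)))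
       / real (dim (tangent z) choose i)"

end

theory Submission
  imports Defs "HOL-Combinatorics.Permutations"
begin

text \<open>Extend the support function \<open>h\<close> of \<open>K\<close> to the whole space; its Hessian \<open>A\<close> restricts to \<open>W\<close> on
  the sphere. The Newton tensors \<open>T\<close> of \<open>A\<close> are divergence free and positive semidefinite, and
  \<open>\<nabla>r\<close> is \<open>W (\<nabla>u) / r\<close>, so integrating the divergence of \<open>g T (\<nabla>u)\<close> against a radial cutoff replaces
  integration over the sphere and gives
  \<open>\<integral> g (P\<^sub>j - u P\<^bsub>j-1\<^esub>) \<ge> 0\<close> for every \<open>g\<close> decreasing in \<open>u\<close> and \<open>r\<close>, with equality for \<open>g = 1\<close>.
  Let \<open>F\<close> be the right hand side of the equation. If \<open>l \<ge> 1\<close>, Newton's inequalities give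
  \<open>F\<^bsup>l-k\<^esup> (P\<^sub>k - u P\<^bsub>k-1\<^esub>) \<le> P\<^sub>l - u P\<^bsub>l-1\<^esub>\<close> pointwise; if \<open>l = 0\<close>, then
  \<open>F\<^bsup>1-j\<^esup> (P\<^sub>j - u P\<^bsub>j-1\<^esub>) \<le> P\<^sub>1 - u\<close> for \<open>j = max k 2\<close>. In both cases the left side has a
  nonnegative integral and the right side integral zero, so equality holds in Newton's inequality
  and \<open>M\<close> is umbilic, hence a sphere by the Codazzi equation. On a sphere \<open>F\<close> is constant, which
  for strictly increasing \<open>\<phi>\<close> excludes a centre other than the origin.\<close>

section \<open>Elementary symmetric functions and Newton's inequalities\<close>

text \<open>The sign of the integral inequality comes from commutation: a Newton tensor
  \<open>T\<close> is a polynomial in \<open>A\<close>, so \<open>T\<close> and \<open>T A\<close>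
  are both positive semidefinite on tangent vectors. A weight with gradient
  \<open>- (a * w + b * A w)\<close> and \<open>a\<close>, \<open>b\<close> nonnegative therefore
  contributes a term of one sign; for negative powers of \<open>F\<close> this is where \<alpha>
  \<ge> 0 and the monotonicity of \<phi> enter. In the whole space integration by parts follows from
  translation invariance of Lebesgue measure. The price is a singularity at the origin, removed by
  an annular cutoff, and a radial eigenvalue zero of \<open>A\<close>, which leaves the elementary
  symmetric functions unchanged. For \<open>l = 0\<close> there is no mean of order
  \<open>l - 1\<close> to compare with, so order 1 takes its place; for \<open>k = 1\<close> the
  comparison uses order 2, since order 1 would be compared with itself. The hypersurface is given
  only by local level sets, and derivatives within it or within the sphere are determined only on
  tangent vectors. Hence the smooth inverse Gauss map has to be constructed first, and uniqueness of
  derivatives is proved along limits of secants.\<close>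

definition esym :: "nat \<Rightarrow> ('b \<Rightarrow> real) \<Rightarrow> 'b set \<Rightarrow> real" where
  "esym j f B = (\<Sum>J | J \<subseteq> B \<and> card J = j. \<Prod>b\<in>J. f b)"

lemma esym_0 [simp]: "finite B \<Longrightarrow> esym 0 f B = 1"
proof -
  assume "finite B"
  then have "{J. J \<subseteq> B \<and> card J = 0} = {{}}"
    by (auto simp: finite_subset)
  then show ?thesis by (simp add: esym_def)
qed

lemma esym_eq_0: "finite B \<Longrightarrow> card B < j \<Longrightarrow> esym j f B = 0"
proof -
  assume "finite B" "card B < j"
  then have e: "{J. J \<subseteq> B \<and> card J = j} = {}"
    by (auto dest: card_mono)
  show ?thesis unfolding esym_def e by simp
qed

text \<open>Subsets of size \<open>Suc j\<close> either avoid \<open>b\<close> or arise by adding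
  \<open>b\<close> to a subset of \<open>B\<close> of size \<open>j\<close>.\<close>

lemma esym_insert:
  assumes "finite B" "b \<notin> B"
  shows "esym (Suc j) f (insert b B) = esym (Suc j) f B + f b * esym j f B"
proof -
  let ?S = "{J. J \<subseteq> B \<and> card J = Suc j}" and ?T = "{J. J \<subseteq> B \<and> card J = j}"
  have eq: "{J. J \<subseteq> insert b B \<and> card J = Suc j} = ?S \<union> insert b ` ?T" (is "?L = ?R")
  proof
    show "?L \<subseteq> ?R"
    proof
      fix J assume J: "J \<in> ?L"
      show "J \<in> ?R"
      proof (cases "b \<in> J")
        case True
        then have "J = insert b (J - {b})" by auto
        moreover have "J - {b} \<in> ?T"
          using J True finite_subset[of J "insert b B"] assms by auto
        ultimately show ?thesis by blast
      next
        case False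
        then show ?thesis using J by auto
      qed
    qed
    have "card (insert b J) = Suc (card J)" if "J \<subseteq> B" for J
      using that assms by (meson card_insert_disjoint finite_subset in_mono)
    then show "?R \<subseteq> ?L" by auto
  qed
  have fin: "finite ?S" "finite ?T" using assms by auto
  have inj: "inj_on (insert b) ?T"
    using assms by (auto simp: inj_on_def)
  have disj: "?S \<inter> insert b ` ?T = {}" using assms by auto
  have "esym (Suc j) f (insert b B) = esym (Suc j) f B + (\<Sum>J\<in>insert b ` ?T. \<Prod>b\<in>J. f b)"
    unfolding esym_def eq using fin disj by (simp add: sum.union_disjoint)
  also have "(\<Sum>J\<in>insert b ` ?T. \<Prod>b\<in>J. f b) = (\<Sum>J\<in>?T. \<Prod>b\<in>insert b J. f b)"
    by (simp add: sum.reindex[OF inj])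
  also have "\<dots> = (\<Sum>J\<in>?T. f b * (\<Prod>b\<in>J. f b))"
  proof (intro sum.cong refl)
    fix J assume "J \<in> ?T"
    then have "finite J" "b \<notin> J" using assms finite_subset by auto
    then show "(\<Prod>b\<in>insert b J. f b) = f b * (\<Prod>b\<in>J. f b)" by simp
  qed
  finally show ?thesis by (simp add: esym_def sum_distrib_left)
qed

text \<open>Newton's inequalities are proved by deleting one variable at a time; indexing by sets
  turns deletion into a set difference.\<close>

lemma esym_remove:
  assumes "finite B" "b \<in> B"
  shows "esym (Suc j) f B = esym (Suc j) f (B - {b}) + f b * esym j f (B - {b})"
  using esym_insert[of "B - {b}" b j f] assms by (simp add: insert_absorb)

lemma esym_nonneg: "(\<And>b. b \<in> B \<Longrightarrow> 0 \<le> f b) \<Longrightarrow> 0 \<le> esym j f B"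
  unfolding esym_def by (intro sum_nonneg prod_nonneg) auto

lemma esym_pos:
  assumes "finite B" "\<forall>b\<in>B. 0 < f b" "j \<le> card B"
  shows "0 < esym j f B"
proof -
  obtain J where J: "J \<subseteq> B" "card J = j"
    using assms(1,3) obtain_subset_with_card_n by metis
  have "finite {J. J \<subseteq> B \<and> card J = j}" using assms by auto
  then show ?thesis unfolding esym_def
    by (intro sum_pos) (use J assms in \<open>auto intro!: prod_pos\<close>)
qed

lemma esym_reindex:
  assumes "bij_betw p C B"
  shows "esym j (f \<circ> p) C = esym j f B"
proof -
  have inj: "inj_on p C" and B: "B = p ` C" using assms by (auto simp: bij_betw_def)
  have inj_im: "inj_on ((`) p) {J. J \<subseteq> C \<and> card J = j}"
    by (rule inj_on_subset[OF inj_on_image_Pow[OF inj]]) auto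
  have im: "{J. J \<subseteq> B \<and> card J = j} = (`) p ` {J. J \<subseteq> C \<and> card J = j}" (is "?L = ?R")
  proof
    show "?L \<subseteq> ?R"
    proof
      fix J assume "J \<in> ?L"
      then obtain I where I: "I \<subseteq> C" "J = p ` I" "card J = j"
        using B by (auto simp: subset_image_iff)
      then have "card I = j" using card_image inj inj_on_subset by metis
      then show "J \<in> ?R" using I by auto
    qed
    show "?R \<subseteq> ?L" using B inj card_image inj_on_subset by (auto simp: card_image[OF inj_on_subset])
  qed
  have "esym j f B = (\<Sum>J | J \<subseteq> C \<and> card J = j. \<Prod>b\<in>p ` J. f b)"
    unfolding esym_def im by (simp add: sum.reindex[OF inj_im])
  also have "\<dots> = esym j (f \<circ> p) C"
    unfolding esym_def by (intro sum.cong refl) (auto simp: prod.reindex[OF inj_on_subset[OF inj]])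
  finally show ?thesis by simp
qed

text \<open>Links the list-based \<open>elem_sym\<close> to \<open>esym\<close>: lists with equal
  multisets differ by a permutation of positions, and \<open>esym\<close> is invariant under
  reindexing.\<close>

lemma elem_sym_mset_eq:
  assumes "mset xs = image_mset f (mset_set B)" "finite B"
  shows "elem_sym j xs = esym j f B"
proof -
  obtain bs where bs: "set bs = B" "distinct bs" using assms(2) finite_distinct_list by blast
  have "mset xs = mset (map f bs)"
    using assms bs by (simp add: mset_set_set[symmetric])
  then obtain p where p: "p permutes {..<length (map f bs)}" "permute_list p (map f bs) = xs"
    by (rule mset_eq_permutation)
  have len: "length xs = length bs" using p by auto
  have "elem_sym j xs = esym j (\<lambda>i. xs ! i) {..<length xs}"
    by (simp add: elem_sym_def esym_def)
  also have "\<dots> = esym j (f \<circ> (\<lambda>i. bs ! p i)) {..<length bs}"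
    unfolding len esym_def
  proof (intro sum.cong prod.cong refl)
    fix J i assume "J \<in> {J. J \<subseteq> {..<length bs} \<and> card J = j}" "i \<in> J"
    then have i: "i < length bs" by auto
    then have "p i < length bs" using permutes_in_image[OF p(1), of i] by auto
    moreover have "xs ! i = map f bs ! p i" using permute_list_nth[OF p(1)] p(2) i by auto
    ultimately show "xs ! i = (f \<circ> (\<lambda>i. bs ! p i)) i" by simp
  qed
  also have "\<dots> = esym j f B"
  proof (rule esym_reindex)
    have "bij_betw p {..<length bs} {..<length bs}"
      using permutes_imp_bij[OF p(1)] by simp
    moreover have "bij_betw ((!) bs) {..<length bs} B"
      by (rule bij_betw_nth) (use bs in auto)
    ultimately have "bij_betw ((!) bs \<circ> p) {..<length bs} B"
      by (rule bij_betw_trans)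
    then show "bij_betw (\<lambda>i. bs ! p i) {..<length bs} B"
      by (simp add: o_def)
  qed
  finally show ?thesis .
qed

text \<open>The eigenvalues of the Newton tensors.\<close>

lemma esym_alternating_sum:
  assumes "finite B" "b \<in> B"
  shows "(\<Sum>i\<le>m. (-1) ^ i * esym (m - i) f B * f b ^ i) = esym m f (B - {b})"
proof (induction m)
  case 0
  then show ?case using assms by simp
next
  case (Suc m)
  have "(\<Sum>i\<le>Suc m. (-1) ^ i * esym (Suc m - i) f B * f b ^ i)
      = esym (Suc m) f B - f b * (\<Sum>i\<le>m. (-1) ^ i * esym (m - i) f B * f b ^ i)"
    unfolding sum.atMost_Suc_shift by (simp add: sum_distrib_left sum_negf mult_ac)
  also have "\<dots> = esym (Suc m) f (B - {b})"
    unfolding Suc.IH using esym_remove[OF assms] by simp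
  finally show ?case .
qed

text \<open>Induction on the variables with \<open>m\<close> arbitrary: the powers of the new
  variable are summed by \<open>esym_alternating_sum\<close>, while the old power sums use the
  induction hypothesis at \<open>m\<close> and \<open>m - 1\<close> through
  \<open>esym_insert\<close>.\<close>

lemma newton_identity:
  assumes "finite B"
  shows "(\<Sum>i\<le>m. (-1) ^ i * esym (m - i) f B * (\<Sum>b\<in>B. f b ^ Suc i)) = real (Suc m) * esym (Suc m) f B"
  using assms
proof (induction B arbitrary: m rule: finite_induct)
  case empty
  then show ?case by (simp add: esym_eq_0)
next
  case (insert x B)
  let ?E = "\<lambda>m. esym m f B" and ?E' = "\<lambda>m. esym m f (insert x B)" and ?p = "\<lambda>i. \<Sum>b\<in>B. f b ^ Suc i"
  have 1: "(\<Sum>i\<le>m. (-1) ^ i * ?E' (m - i) * f x ^ i) = ?E m"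
    using esym_alternating_sum[of "insert x B" x m f] insert by simp
  have 2: "(\<Sum>i\<le>m. (-1) ^ i * ?E' (m - i) * ?p i) = real (Suc m) * ?E (Suc m) + f x * real m * ?E m"
  proof (cases m)
    case 0
    then show ?thesis using insert insert.IH[of 0] by simp
  next
    case (Suc k)
    have "(\<Sum>i\<le>m. (-1) ^ i * ?E' (m - i) * ?p i)
      = (\<Sum>i\<le>k. (-1) ^ i * (?E (m - i) + f x * ?E (k - i)) * ?p i) + (-1) ^ m * ?E 0 * ?p m"
      unfolding Suc using insert by (auto intro!: sum.cong simp: Suc_diff_le esym_insert)
    also have "\<dots> = (\<Sum>i\<le>m. (-1) ^ i * ?E (m - i) * ?p i) + f x * (\<Sum>i\<le>k. (-1) ^ i * ?E (k - i) * ?p i)"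
      unfolding Suc by (simp add: algebra_simps sum.distrib sum_distrib_left del: power_Suc)
    finally have "(\<Sum>i\<le>m. (-1) ^ i * ?E' (m - i) * ?p i)
      = real (Suc m) * ?E (Suc m) + f x * (real (Suc k) * ?E (Suc k))"
      by (simp only: insert.IH)
    then show ?thesis using Suc by simp
  qed
  have "(\<Sum>i\<le>m. (-1) ^ i * ?E' (m - i) * (\<Sum>b\<in>insert x B. f b ^ Suc i))
    = (\<Sum>i\<le>m. (-1) ^ i * ?E' (m - i) * ?p i) + f x * (\<Sum>i\<le>m. (-1) ^ i * ?E' (m - i) * f x ^ i)"
    using insert by (simp add: algebra_simps sum.distrib sum_distrib_left)
  also have "\<dots> = real (Suc m) * ?E' (Suc m)"
    unfolding 1 2 using insert by (simp add: esym_insert algebra_simps)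
  finally show ?case .
qed

section \<open>Normalized means, Newton's inequalities and their equality case\<close>

definition Pmean :: "nat \<Rightarrow> ('b \<Rightarrow> real) \<Rightarrow> 'b set \<Rightarrow> real" where
  "Pmean j f B = esym j f B / real (card B choose j)"

lemma Pmean_pos:
  assumes "finite B" "\<forall>b\<in>B. 0 < f b" "j \<le> card B"
  shows "0 < Pmean j f B"
  unfolding Pmean_def using esym_pos[OF assms] assms by simp

lemma Pmean_0 [simp]: "finite B \<Longrightarrow> Pmean 0 f B = 1"
  by (simp add: Pmean_def)

lemma Pmean_eq_0: "finite B \<Longrightarrow> card B < j \<Longrightarrow> Pmean j f B = 0"
  by (simp add: Pmean_def esym_eq_0)

text \<open>The weights \<open>card B - j\<close> and \<open>j\<close> are ratios of binomial
  coefficients for \<open>card B\<close> and \<open>card B - 1\<close>. At \<open>j = 0\<close> the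
  truncated index \<open>j - 1\<close> is harmless because its factor vanishes.\<close>

lemma Pmean_remove:
  assumes "finite B" "b \<in> B"
  shows "real (card B) * Pmean j f B =
    (real (card B) - real j) * Pmean j f (B - {b}) + real j * f b * Pmean (j - 1) f (B - {b})"
proof (cases j)
  case 0
  then show ?thesis using assms by simp
next
  case (Suc i)
  obtain m where m: "card B = Suc m" using assms by (metis card_Suc_Diff1)
  then have c: "card (B - {b}) = m" using assms by simp
  show ?thesis
  proof (cases "i < m")
    case True
    have p1: "Suc m * (m choose i) = Suc i * (Suc m choose Suc i)"
      by (metis Suc_times_binomial)
    have p2: "Suc m * (m choose Suc i) = (m - i) * (Suc m choose Suc i)"
      using Suc_times_binomial_add[of "Suc i" "m - Suc i"] True
        binomial_symmetric[of "Suc i" m] binomial_symmetric[of "Suc i" "Suc m"]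
      by (metis Suc_leI Suc_times_binomial diff_Suc_Suc Suc_diff_Suc binomial_symmetric less_imp_le_nat Suc_le_mono)
    have q1: "real (Suc m) * real (m choose i) = real (Suc i) * real (Suc m choose Suc i)"
      using p1 by (metis of_nat_mult)
    have q2: "real (Suc m) * real (m choose Suc i) = (real m - real i) * real (Suc m choose Suc i)"
      using p2 True by (metis of_nat_mult of_nat_diff less_imp_le)
    have pos: "real (m choose i) > 0" "real (m choose Suc i) > 0" "real (Suc m choose Suc i) > 0"
      using True by (auto simp del: binomial_Suc_Suc)
    have r1: "real (Suc i) / real (m choose i) = real (Suc m) / real (Suc m choose Suc i)"
      using q1 pos by (simp add: frac_eq_eq mult.commute del: of_nat_Suc binomial_Suc_Suc)
    have r2: "(real m - real i) / real (m choose Suc i) = real (Suc m) / real (Suc m choose Suc i)"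
      using q2 pos by (simp add: frac_eq_eq mult.commute del: of_nat_Suc binomial_Suc_Suc)
    have "(real (card B) - real j) * Pmean j f (B - {b}) + real j * f b * Pmean (j - 1) f (B - {b})
       = ((real m - real i) / real (m choose Suc i)) * esym j f (B - {b})
        + (real (Suc i) / real (m choose i)) * f b * esym i f (B - {b})"
      unfolding Pmean_def m Suc c by simp
    also have "\<dots> = real (card B) * Pmean j f B"
      unfolding r1 r2 Pmean_def m Suc
      using esym_remove[OF assms, of i f]
      by (simp add: algebra_simps add_divide_distrib del: of_nat_Suc binomial_Suc_Suc)
    finally show ?thesis by simp
  next
    case False
    show ?thesis
    proof (cases "i = m")
      case True
      have "esym (Suc m) f (B - {b}) = 0" using assms c by (intro esym_eq_0) auto
      then show ?thesis using esym_remove[OF assms, of i f] Suc m c True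
        by (simp add: Pmean_def)
    next
      case f: False
      then show ?thesis using False assms Suc m c by (simp add: Pmean_def esym_eq_0)
    qed
  qed
qed

text \<open>The coefficients of the quadratic polynomial in \<open>x\<close> below are bounded by means of
  Newton's inequalities for one variable less.\<close>

lemma newton_step_aux:
  fixes n j x E0 E1 E2 E3 :: real
  assumes 1: "E1 * E3 \<le> E2\<^sup>2" and 2: "j \<ge> 2 \<Longrightarrow> E0 * E2 \<le> E1\<^sup>2" and 3: "j \<ge> 2 \<Longrightarrow> E0 * E3 \<le> E1 * E2"
    and j: "j = 1 \<or> j \<ge> 2" "j + 1 \<le> n" and x: "x > 0"
  shows "(E2 - x * E1)\<^sup>2 \<le> ((n - j) * E2 + j * x * E1)\<^sup>2
     - ((n - (j - 1)) * E1 + (j - 1) * x * E0) * ((n - (j + 1)) * E3 + (j + 1) * x * E2)"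
proof -
  have "1 \<le> (n - j)\<^sup>2" using j by (intro one_le_power) auto
  then have a: "((n - j)\<^sup>2 - 1) * (E2\<^sup>2 - E1 * E3) \<ge> 0"
    using 1 by (intro mult_nonneg_nonneg) auto
  \<comment> \<open>\<open>E0\<close> stands for the mean of order \<open>j - 2\<close>; for
    \<open>j = 1\<close> its coefficients vanish.\<close>
  have b: "x * ((n - j - 1) * (j - 1) * (E1 * E2 - E0 * E3)) \<ge> 0"
    using 3 j x by (cases "j = 1") (auto intro!: mult_nonneg_nonneg)
  have c: "x\<^sup>2 * ((j\<^sup>2 - 1) * (E1\<^sup>2 - E0 * E2)) \<ge> 0"
    using 2 j x by (cases "j = 1") (auto intro!: mult_nonneg_nonneg)
  \<comment> \<open>Once the square is split off, the coefficients of 1, \<open>x\<close> and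
    \<open>x\<^sup>2\<close> are nonnegative multiples of the defects in the three assumed
    inequalities.\<close>
  have "((n - j) * E2 + j * x * E1)\<^sup>2
     - ((n - (j - 1)) * E1 + (j - 1) * x * E0) * ((n - (j + 1)) * E3 + (j + 1) * x * E2)
     = (E2 - x * E1)\<^sup>2 + ((n - j)\<^sup>2 - 1) * (E2\<^sup>2 - E1 * E3)
      + x * ((n - j - 1) * (j - 1) * (E1 * E2 - E0 * E3)) + x\<^sup>2 * ((j\<^sup>2 - 1) * (E1\<^sup>2 - E0 * E2))"
    by (simp add: power2_eq_square algebra_simps)
  then show ?thesis using a b c by linarith
qed

text \<open>The Newton defect for \<open>B\<close> dominates a square that measures how far
  \<open>f b\<close> is from the quotient of two consecutive means of the other variables.
  Positivity of the square gives the inequality, its vanishing the equality case.\<close>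

lemma newton_inequality_step:
  assumes fin: "finite B" and pos: "\<forall>b\<in>B. 0 < f b" and j: "1 \<le> j" "j < card B" and b: "b \<in> B"
    and IH: "\<And>i. 1 \<le> i \<Longrightarrow> Pmean (i - 1) f (B - {b}) * Pmean (Suc i) f (B - {b}) \<le> (Pmean i f (B - {b}))\<^sup>2"
  shows "(Pmean j f (B - {b}) - f b * Pmean (j - 1) f (B - {b}))\<^sup>2
    \<le> (real (card B))\<^sup>2 * ((Pmean j f B)\<^sup>2 - Pmean (j - 1) f B * Pmean (Suc j) f B)"
proof -
  let ?E = "\<lambda>i. Pmean i f (B - {b})"
  have p: "?E i > 0" if "i < card B" for i
    using that fin pos b by (intro Pmean_pos) auto
  \<comment> \<open>The product of Newton's inequalities at \<open>j - 1\<close> and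
    \<open>j\<close>, divided by the positive middle factors.\<close>
  have 3: "?E (j - 2) * ?E (Suc j) \<le> ?E (j - 1) * ?E j" if "real j \<ge> 2"
  proof -
    have "(?E (j - 1 - 1) * ?E (Suc (j - 1))) * (?E (j - 1) * ?E (Suc j)) \<le> (?E (j - 1))\<^sup>2 * (?E j)\<^sup>2"
    proof (intro mult_mono)
      show "?E (j - 1 - 1) * ?E (Suc (j - 1)) \<le> (?E (j - 1))\<^sup>2" using that by (intro IH) auto
      show "?E (j - 1) * ?E (Suc j) \<le> (?E j)\<^sup>2" using j by (intro IH) auto
      show "0 \<le> ?E (j - 1) * ?E (Suc j)"
        using pos by (intro mult_nonneg_nonneg) (auto simp: Pmean_def less_imp_le intro!: divide_nonneg_nonneg esym_nonneg)
    qed auto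
    then have "(?E j * ?E (j - 1)) * (?E (j - 2) * ?E (Suc j)) \<le> (?E j * ?E (j - 1)) * (?E (j - 1) * ?E j)"
      using that j by (simp add: power2_eq_square algebra_simps numeral_2_eq_2)
    then show ?thesis
      using p[of j] p[of "j - 1"] j by (subst (asm) mult_le_cancel_left_pos) auto
  qed
  have "(?E j - f b * ?E (j - 1))\<^sup>2 \<le> ((real (card B) - real j) * ?E j + real j * f b * ?E (j - 1))\<^sup>2
     - ((real (card B) - (real j - 1)) * ?E (j - 1) + (real j - 1) * f b * ?E (j - 2))
       * ((real (card B) - (real j + 1)) * ?E (Suc j) + (real j + 1) * f b * ?E j)"
    by (rule newton_step_aux) (use IH[of j] IH[of "j - 1"] 3 j pos b in \<open>auto simp: numeral_2_eq_2\<close>)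
  also have "\<dots> = (real (card B) * Pmean j f B)\<^sup>2 - (real (card B) * Pmean (j - 1) f B) * (real (card B) * Pmean (Suc j) f B)"
    unfolding Pmean_remove[OF fin b] using j by (simp add: of_nat_diff numeral_2_eq_2 algebra_simps)
  finally show ?thesis by (simp add: power2_eq_square algebra_simps)
qed

lemma newton_inequality:
  assumes "finite B" "\<forall>b\<in>B. 0 < f b" "1 \<le> j"
  shows "Pmean (j - 1) f B * Pmean (Suc j) f B \<le> (Pmean j f B)\<^sup>2"
  using assms
proof (induction "card B" arbitrary: B j)
  case 0
  then show ?case by (simp add: Pmean_eq_0)
next
  case (Suc m)
  show ?case
  proof (cases "j < card B")
    case True
    obtain b where b: "b \<in> B" using Suc by fastforce
    have "0 \<le> (real (card B))\<^sup>2 * ((Pmean j f B)\<^sup>2 - Pmean (j - 1) f B * Pmean (Suc j) f B)"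
    proof (rule order_trans[OF _ newton_inequality_step[OF Suc.prems(1,2,3) True b]])
      show "Pmean (i - 1) f (B - {b}) * Pmean (Suc i) f (B - {b}) \<le> (Pmean i f (B - {b}))\<^sup>2" if "1 \<le> i" for i
        using Suc.hyps(2) Suc.prems b that by (intro Suc.hyps(1)) auto
    qed simp
    then show ?thesis using Suc(2) by (simp add: zero_le_mult_iff)
  next
    case False
    then show ?thesis using Suc by (simp add: Pmean_eq_0)
  qed
qed

text \<open>Equality kills the square in \<open>newton_inequality_step\<close> for every deleted
  variable, so each variable is the quotient of two means of the others. Subtracting these relations
  for two variables leaves \<open>f c - f b\<close> times a positive number.\<close>

lemma newton_equality:
  assumes fin: "finite B" and pos: "\<forall>b\<in>B. 0 < f b" and j: "1 \<le> j" "j < card B"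
    and eq: "Pmean (j - 1) f B * Pmean (Suc j) f B = (Pmean j f B)\<^sup>2"
    and bc: "b \<in> B" "c \<in> B"
  shows "f b = f c"
proof (rule ccontr)
  assume ne: "f b \<noteq> f c"
  have eq': "Pmean j f (B - {b}) = f b * Pmean (j - 1) f (B - {b})" if "b \<in> B" for b
  proof -
    have "(Pmean j f (B - {b}) - f b * Pmean (j - 1) f (B - {b}))\<^sup>2
      \<le> (real (card B))\<^sup>2 * ((Pmean j f B)\<^sup>2 - Pmean (j - 1) f B * Pmean (Suc j) f B)"
      by (rule newton_inequality_step[OF fin pos j that]) (intro newton_inequality; use fin pos in simp)
    then show ?thesis using eq by simp
  qed
  define C where "C = B - {b} - {c}"
  have C: "B - {b} - {c} = C" "B - {c} - {b} = C" by (auto simp: C_def)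
  obtain i where i: "j = Suc i" using j by (cases j) auto
  define s where "s = esym i f C"
  define a where "a = real (card B - 1 choose i)"
  define d where "d = real (card B - 1 choose j)"
  \<comment> \<open>The value 0 for \<open>i = 0\<close> plays the symmetric function of order -1,
    so that the expansions of order \<open>i\<close> hold in both cases.\<close>
  define t where "t = (if i = 0 then 0 else esym (i - 1) f C)"
  have fC: "finite C" and sp: "s > 0"
    unfolding s_def using fin pos bc ne j i by (auto simp: C_def card_Diff_singleton_if intro!: esym_pos)
  have ad: "a > 0" "d > 0" unfolding a_def d_def using j i by auto
  have e1: "esym j f (B - {b}) = esym j f C + f c * s" "esym j f (B - {c}) = esym j f C + f b * s"
    using esym_remove[of "B - {b}" c i f] esym_remove[of "B - {c}" b i f] fin bc ne C i s_def by auto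
  have e2: "esym i f (B - {b}) = s + f c * t" "esym i f (B - {c}) = s + f b * t"
  proof -
    have "esym i f (B - {b}) = s + f c * t \<and> esym i f (B - {c}) = s + f b * t"
    proof (cases i)
      case 0
      then show ?thesis using fin fC by (simp add: s_def t_def)
    next
      case (Suc i')
      have "c \<in> B - {b}" "b \<in> B - {c}" using bc ne by auto
      then show ?thesis
        using esym_remove[of "B - {b}" c i' f] esym_remove[of "B - {c}" b i' f] fin
        unfolding C s_def t_def Suc by simp
    qed
    then show "esym i f (B - {b}) = s + f c * t" "esym i f (B - {c}) = s + f b * t" by auto
  qed
  have "(esym j f C + f c * s) / d = f b * ((s + f c * t) / a)"
    using eq'[OF bc(1)] fin bc e1 e2 i by (simp add: Pmean_def a_def d_def)
  moreover have "(esym j f C + f b * s) / d = f c * ((s + f b * t) / a)"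
    using eq'[OF bc(2)] fin bc e1 e2 i by (simp add: Pmean_def a_def d_def)
  ultimately have "(esym j f C + f c * s) / d - (esym j f C + f b * s) / d
     = f b * ((s + f c * t) / a) - f c * ((s + f b * t) / a)" by simp
  then have "(f c - f b) * (s / d + s / a) = 0"
    by (simp add: field_simps diff_divide_distrib add_divide_distrib)
  moreover have "s / d + s / a > 0" using sp ad by (simp add: add_pos_pos)
  ultimately show False using ne by auto
qed

section \<open>Quotients of consecutive means and the pointwise inequalities\<close>

context
  fixes B :: "'b set" and f :: "'b \<Rightarrow> real"
  assumes fin: "finite B" and pos: "\<forall>b\<in>B. 0 < f b"
begin

text \<open>Newton's inequalities say that these quotients decrease in \<open>j\<close>, and every
  mean is a product of them.\<close>

definition quot :: "nat \<Rightarrow> real" where "quot j = Pmean j f B / Pmean (j - 1) f B"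

lemma quot_antimono:
  assumes "1 \<le> i" "i \<le> j" "j \<le> card B"
  shows "quot j \<le> quot i"
  using assms(2,3)
proof (induction j rule: dec_induct)
  case base
  then show ?case by simp
next
  case (step m)
  have "Pmean m f B > 0" "Pmean (m - 1) f B > 0" using step by (auto intro!: Pmean_pos fin pos)
  moreover have "Pmean (m - 1) f B * Pmean (Suc m) f B \<le> (Pmean m f B)\<^sup>2"
    using newton_inequality[OF fin pos, of m] assms(1) step by auto
  ultimately have "quot (Suc m) \<le> quot m"
    unfolding quot_def by (simp add: divide_simps power2_eq_square mult_ac)
  then show ?case using step by simp
qed

text \<open>By monotonicity, equality of two distant quotients forces equality of
  \<open>quot i\<close> and \<open>quot (Suc i)\<close>, which is the equality case of Newton's
  inequality at \<open>i\<close>.\<close>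

lemma quot_eq_imp:
  assumes "1 \<le> i" "i < j" "j \<le> card B" "quot j = quot i" "b \<in> B" "c \<in> B"
  shows "f b = f c"
proof (rule newton_equality[OF fin pos, of i])
  have "quot (Suc i) = quot i"
    using quot_antimono[of i "Suc i"] quot_antimono[of "Suc i" j] assms by simp
  moreover have "Pmean i f B > 0" "Pmean (i - 1) f B > 0" using assms by (auto intro!: Pmean_pos fin pos)
  ultimately show "Pmean (i - 1) f B * Pmean (Suc i) f B = (Pmean i f B)\<^sup>2"
    unfolding quot_def by (simp add: field_simps power2_eq_square)
qed (use assms in auto)

lemma Pmean_Suc_quot: "j < card B \<Longrightarrow> Pmean (Suc j) f B = quot (Suc j) * Pmean j f B"
  using Pmean_pos[OF fin pos, of j] by (simp add: quot_def)

lemma quot_pos: "j \<le> card B \<Longrightarrow> 0 < quot j"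
  unfolding quot_def using Pmean_pos[OF fin pos] by simp

text \<open>The mean of order \<open>j\<close> is the product of the first \<open>j\<close>
  quotients, each at most the first one; the next lemma bounds each of them below by the last
  one.\<close>

lemma Pmean_le_quot_power: "j \<le> card B \<Longrightarrow> Pmean j f B \<le> quot 1 ^ j"
proof (induction j)
  case 0
  then show ?case by (simp add: fin)
next
  case (Suc j)
  then show ?case
    using quot_antimono[of 1 "Suc j"] quot_pos[of 1] Pmean_pos[OF fin pos, of j]
    by (simp add: Pmean_Suc_quot mult_mono)
qed

lemma quot_power_le_Pmean: "j \<le> card B \<Longrightarrow> quot j ^ j \<le> Pmean j f B"
proof (induction j)
  case 0
  then show ?case by (simp add: fin)
next
  case (Suc j)
  have "quot (Suc j) ^ j \<le> quot j ^ j"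
    using quot_antimono[of j "Suc j"] quot_pos[of "Suc j"] Suc by (cases "j = 0") (auto intro!: power_mono)
  also have "\<dots> \<le> Pmean j f B" using Suc by simp
  finally show ?case using quot_pos[of "Suc j"] Suc by (simp add: Pmean_Suc_quot)
qed

text \<open>Dividing by \<open>F ^ (k - l)\<close> replaces the mean of order \<open>k\<close> by
  that of order \<open>l\<close>. Both sides then differ only in the term with \<open>u\<close>,
  divided by \<open>quot k\<close> on the left and by the larger \<open>quot l\<close> on the
  right.\<close>

lemma pointwise_inequality:
  assumes l: "1 \<le> l" "l < k" "k \<le> card B" and F: "F > 0" "F ^ (k - l) = Pmean k f B / Pmean l f B" and u: "u > 0"
  shows "(Pmean k f B - u * Pmean (k - 1) f B) / F ^ (k - l) \<le> Pmean l f B - u * Pmean (l - 1) f B"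
    and "(Pmean k f B - u * Pmean (k - 1) f B) / F ^ (k - l) = Pmean l f B - u * Pmean (l - 1) f B
      \<Longrightarrow> b \<in> B \<Longrightarrow> c \<in> B \<Longrightarrow> f b = f c"
proof -
  have P: "Pmean k f B > 0" "Pmean l f B > 0" "Pmean (k - 1) f B > 0" "Pmean (l - 1) f B > 0"
    using l by (auto intro!: Pmean_pos fin pos)
  have e1: "Pmean (k - 1) f B = Pmean k f B / quot k" "Pmean (l - 1) f B = Pmean l f B / quot l"
    using P by (auto simp: quot_def)
  have q: "quot k > 0" "quot l > 0" using l by (auto intro!: quot_pos)
  have e2: "(Pmean k f B - u * Pmean (k - 1) f B) / F ^ (k - l) = Pmean l f B - u * Pmean l f B / quot k"
    unfolding F(2) e1 using P q by (simp add: field_simps)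
  have e3: "Pmean l f B - u * Pmean (l - 1) f B = Pmean l f B - u * Pmean l f B / quot l"
    unfolding e1 by simp
  have "u * Pmean l f B / quot l \<le> u * Pmean l f B / quot k"
    using quot_antimono[of l k] l q u P by (intro divide_left_mono) auto
  then show "(Pmean k f B - u * Pmean (k - 1) f B) / F ^ (k - l) \<le> Pmean l f B - u * Pmean (l - 1) f B"
    unfolding e2 e3 by simp
  assume eq: "(Pmean k f B - u * Pmean (k - 1) f B) / F ^ (k - l) = Pmean l f B - u * Pmean (l - 1) f B"
    and bc: "b \<in> B" "c \<in> B"
  have "quot k = quot l" using eq q u P unfolding e2 e3 by (simp add: field_simps)
  then show "f b = f c" by (rule quot_eq_imp[OF l _ bc])
qed

text \<open>\<open>F\<close> is the geometric mean of the first \<open>k\<close> quotients, hence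
  lies between \<open>quot k\<close> and \<open>quot 1\<close>; the left side is at most
  \<open>F - u\<close> and the right side is \<open>quot 1 - u\<close>. For \<open>k = 1\<close> the
  choice \<open>j = 1\<close> would turn the inequality into an identity without information on
  \<open>f\<close>, hence \<open>max k 2\<close>.\<close>

lemma pointwise_inequality_0:
  assumes k: "1 \<le> k" "k \<le> card B" "2 \<le> card B" and F: "F > 0" "F ^ k = Pmean k f B" and u: "u > 0"
    and j: "j = max k 2"
  shows "(Pmean j f B - u * Pmean (j - 1) f B) / F ^ (j - 1) \<le> Pmean 1 f B - u"
    and "(Pmean j f B - u * Pmean (j - 1) f B) / F ^ (j - 1) = Pmean 1 f B - u
      \<Longrightarrow> b \<in> B \<Longrightarrow> c \<in> B \<Longrightarrow> f b = f c"
proof -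
  have q1: "Pmean 1 f B = quot 1" by (simp add: quot_def fin)
  have Fq1: "F \<le> quot 1"
  proof -
    have "F ^ k \<le> quot 1 ^ k" using Pmean_le_quot_power[of k] k F by simp
    then show ?thesis using k F quot_pos[of 1] by (subst (asm) power_mono_iff) auto
  qed
  have qk: "quot k \<le> F"
  proof -
    have "quot k ^ k \<le> F ^ k" using quot_power_le_Pmean[of k] k F by simp
    then show ?thesis using k F quot_pos[of k] by (subst (asm) power_mono_iff) auto
  qed
  have jB: "2 \<le> j" "j \<le> card B" using j k by auto
  have F': "Pmean j f B \<le> F ^ j \<and> F ^ (j - 1) \<le> Pmean (j - 1) f B"
  proof (cases "k = 1")
    case True
    then have "j = 2" "F = quot 1" using j F q1 by auto
    then show ?thesis using Pmean_le_quot_power[of 2] k q1 by simp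
  next
    case False
    then have jk: "j = k" using j k by simp
    obtain i where i: "k = Suc i" using k by (cases k) auto
    have "F * F ^ i = quot k * Pmean i f B" using Pmean_Suc_quot[of i] F i k by simp
    also have "\<dots> \<le> F * Pmean i f B" using qk Pmean_pos[OF fin pos, of i] k i
      by (intro mult_right_mono) auto
    finally have "F ^ i \<le> Pmean i f B" using F by simp
    then show ?thesis using jk F i by simp
  qed
  have jS: "F ^ j = F * F ^ (j - 1)" using jB by (cases j) auto
  have le: "(Pmean j f B - u * Pmean (j - 1) f B) / F ^ (j - 1) \<le> (F ^ j - u * F ^ (j - 1)) / F ^ (j - 1)"
    using F' F u by (intro divide_right_mono diff_mono mult_left_mono) auto
  have eq2: "(F ^ j - u * F ^ (j - 1)) / F ^ (j - 1) = F - u"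
    using F unfolding jS by (simp add: field_simps)
  show "(Pmean j f B - u * Pmean (j - 1) f B) / F ^ (j - 1) \<le> Pmean 1 f B - u"
    using le eq2 Fq1 q1 by simp
  assume eq: "(Pmean j f B - u * Pmean (j - 1) f B) / F ^ (j - 1) = Pmean 1 f B - u"
    and bc: "b \<in> B" "c \<in> B"
  have Fe: "F = quot 1" using le eq2 Fq1 q1 eq by simp
  have "Pmean j f B - u * Pmean (j - 1) f B = F ^ j - u * F ^ (j - 1)"
    using eq eq2 Fe q1 F by (simp add: field_simps)
  moreover have "u * F ^ (j - 1) \<le> u * Pmean (j - 1) f B" using F' u by simp
  ultimately have "Pmean j f B = F ^ j" "u * Pmean (j - 1) f B = u * F ^ (j - 1)" using F' by linarith+
  then have q: "quot j = quot 1" unfolding quot_def[of j] using F u Fe jS by (simp add: field_simps)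
  show "f b = f c" by (rule quot_eq_imp[OF _ _ jB(2) q bc]) (use jB in auto)
qed

end


section \<open>Self-adjoint operators\<close>

definition orthonormal :: "'a::real_inner set \<Rightarrow> bool" where
  "orthonormal B \<longleftrightarrow> (\<forall>b\<in>B. \<forall>c\<in>B. b \<bullet> c = (if b = c then 1 else 0))"

lemma orthonormal_independent:
  assumes "orthonormal B"
  shows "independent B"
proof (rule pairwise_orthogonal_independent)
  show "pairwise orthogonal B" "0 \<notin> B"
    using assms by (auto simp: orthonormal_def pairwise_def orthogonal_def split: if_splits)
       (metis inner_zero_left zero_neq_one)
qed

lemma orthonormal_finite: "orthonormal B \<Longrightarrow> finite (B::'a::euclidean_space set)"
  using orthonormal_independent independent_bound by blast

lemma orthonormal_expand:
  assumes "orthonormal B" "finite B" "v \<in> span B"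
  shows "(\<Sum>b\<in>B. (v \<bullet> b) *\<^sub>R b) = v"
proof -
  obtain u where u: "v = (\<Sum>b\<in>B. u b *\<^sub>R b)"
    using assms span_finite[OF assms(2)] by auto
  have "v \<bullet> b = u b" if "b \<in> B" for b
  proof -
    have "v \<bullet> b = (\<Sum>c\<in>B. u c * (c \<bullet> b))" by (simp add: u inner_sum_left)
    also have "\<dots> = (\<Sum>c\<in>B. if c = b then u c else 0)"
      using assms that by (intro sum.cong) (auto simp: orthonormal_def)
    finally show ?thesis using assms that by simp
  qed
  then show ?thesis by (simp add: u)
qed

lemma quadratic_max_imp_linear_zero:
  fixes a b :: real
  assumes "\<And>t. t * a + t\<^sup>2 * b \<le> 0"
  shows "a = 0"
proof (rule ccontr)
  assume a: "a \<noteq> 0"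
  \<comment> \<open>For this \<open>t\<close> the linear term is at least twice the quadratic one in
    absolute value, so the sum is strictly positive.\<close>
  define t where "t = a / (2 * (\<bar>b\<bar> + 1))"
  have at: "a = t * (2 * (\<bar>b\<bar> + 1))" unfolding t_def by simp
  then have "t \<noteq> 0" using a by auto
  moreover have "2 * (\<bar>b\<bar> + 1) + b > 0" by (auto simp: abs_if)
  ultimately have "t\<^sup>2 * (2 * (\<bar>b\<bar> + 1) + b) > 0" by simp
  also have "t\<^sup>2 * (2 * (\<bar>b\<bar> + 1) + b) = t * a + t\<^sup>2 * b"
    by (subst at) (simp add: power2_eq_square algebra_simps)
  finally show False using assms[of t] by simp
qed

text \<open>A maximiser of the quadratic form on the unit sphere is an eigenvector.\<close>

lemma spectral_theorem:
  fixes A :: "'a::euclidean_space \<Rightarrow> 'a"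
  assumes "linear A" "subspace V" "\<And>v. v \<in> V \<Longrightarrow> A v \<in> V"
    and "\<And>v w. v \<in> V \<Longrightarrow> w \<in> V \<Longrightarrow> A v \<bullet> w = v \<bullet> A w"
  shows "\<exists>B f. orthonormal B \<and> B \<subseteq> V \<and> span B = V \<and> card B = dim V \<and> (\<forall>b\<in>B. A b = f b *\<^sub>R b)"
  using assms(2-4)
proof (induction "dim V" arbitrary: V rule: less_induct)
  case less
  show ?case
  proof (cases "V = {0}")
    case True
    then show ?thesis by (intro exI[of _ "{}"]) (auto simp: orthonormal_def)
  next
    case False
    then obtain v0 where v0: "v0 \<in> V" "v0 \<noteq> 0" using subspace_0[OF less.prems(1)] by auto
    let ?S = "sphere 0 1 \<inter> V"
    have "(1 / norm v0) *\<^sub>R v0 \<in> ?S" using v0 less.prems(1) by (auto simp: subspace_scale)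
    then have ne: "?S \<noteq> {}" by blast
    have comp: "compact ?S" using closed_subspace[OF less.prems(1)] by (simp add: compact_Int_closed)
    have "continuous_on ?S (\<lambda>v. A v \<bullet> v)"
      using assms(1) by (intro continuous_intros linear_continuous_on) (simp add: linear_conv_bounded_linear)
    then obtain e where e: "e \<in> ?S" and max: "\<And>v. v \<in> ?S \<Longrightarrow> A v \<bullet> v \<le> A e \<bullet> e"
      using continuous_attains_sup[OF comp ne] by blast
    define m where "m = A e \<bullet> e"
    have ee: "e \<in> V" "norm e = 1" "e \<bullet> e = 1" using e by (auto simp: norm_eq_1)
    have max': "A v \<bullet> v \<le> m * (v \<bullet> v)" if "v \<in> V" for v
    proof (cases "v = 0")
      case True then show ?thesis using linear_0[OF assms(1)] by simp
    next
      case False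
      have "A ((1 / norm v) *\<^sub>R v) \<bullet> ((1 / norm v) *\<^sub>R v) \<le> m"
        unfolding m_def by (rule max) (use that False less.prems(1) in \<open>auto simp: subspace_scale\<close>)
      then have "A v \<bullet> v / (norm v)\<^sup>2 \<le> m"
        by (simp add: linear_scale[OF assms(1)] power2_eq_square)
      then show ?thesis using False by (simp add: field_simps power2_norm_eq_inner)
    qed
    \<comment> \<open>The form \<open>A v \<bullet> v - m * (v \<bullet> v)\<close> is nonpositive
      along the line \<open>e + t *\<^sub>R w\<close> and zero at \<open>t = 0\<close>, so its
      linear coefficient vanishes.\<close>
    have orth: "A e \<bullet> w = 0" if w: "w \<in> V" "w \<bullet> e = 0" for w
    proof -
      have "t * (2 * (A e \<bullet> w)) + t\<^sup>2 * (A w \<bullet> w - m * (w \<bullet> w)) \<le> 0" for t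
      proof -
        have "A (e + t *\<^sub>R w) \<bullet> (e + t *\<^sub>R w) \<le> m * ((e + t *\<^sub>R w) \<bullet> (e + t *\<^sub>R w))"
          using w ee less.prems(1) by (intro max') (auto simp: subspace_add subspace_scale)
        moreover have "A w \<bullet> e = A e \<bullet> w" using less.prems(3)[of w e] w ee by (simp add: inner_commute)
        ultimately show ?thesis using w ee
          by (simp add: linear_add[OF assms(1)] linear_scale[OF assms(1)] inner_simps m_def
            inner_commute power2_eq_square algebra_simps)
      qed
      then show ?thesis using quadratic_max_imp_linear_zero by fastforce
    qed
    have Ae: "A e = m *\<^sub>R e"
    proof -
      let ?w = "A e - m *\<^sub>R e"
      have w: "?w \<in> V" "?w \<bullet> e = 0" 
        using less.prems ee by (auto simp: subspace_diff subspace_scale inner_diff_left m_def)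
      then have "?w \<bullet> ?w = 0" using orth[OF w] by (simp add: inner_diff_left inner_commute)
      then show ?thesis by simp
    qed
    let ?V' = "{v\<in>V. v \<bullet> e = 0}"
    have sub: "subspace ?V'" using less.prems(1)
      by (auto simp: subspace_def inner_simps)
    have "e \<notin> ?V'" using ee by simp
    then have "?V' \<subset> V" using ee by blast
    then have "dim ?V' < dim V"
      using sub less.prems(1) by (metis dim_psubset span_eq_iff)
    moreover have "A v \<in> ?V'" if "v \<in> ?V'" for v
      using that less.prems ee Ae by (auto simp: less.prems(3)[of v e])
    ultimately obtain B f where B: "orthonormal B" "B \<subseteq> ?V'" "span B = ?V'" "\<forall>b\<in>B. A b = f b *\<^sub>R b"
      using less.hyps[of ?V'] sub less.prems(3) by blast
    have eB: "e \<notin> B" using B ee by auto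
    have on: "orthonormal (insert e B)" using B ee eB by (auto simp: orthonormal_def inner_commute)
    have "insert e B \<subseteq> V" using B ee by auto
    moreover have "V \<subseteq> span (insert e B)"
    proof
      fix v assume v: "v \<in> V"
      have "v - (v \<bullet> e) *\<^sub>R e \<in> span B"
        unfolding B using v ee less.prems(1) by (auto simp: subspace_diff subspace_scale inner_diff_left)
      then show "v \<in> span (insert e B)" by (auto simp: span_breakdown_eq)
    qed
    ultimately have sp: "span (insert e B) = V"
      using less.prems(1) by (metis span_minimal subset_antisym)
    have "card (insert e B) = dim V"
      using dim_span_eq_card_independent[OF orthonormal_independent[OF on]] sp by simp
    then show ?thesis
      using on sp \<open>insert e B \<subseteq> V\<close> B(4) Ae eB
      by (intro exI[of _ "insert e B"] exI[of _ "f(e := m)"]) auto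
  qed
qed

text \<open>\<open>A\<close> is compared with the linear \<open>A'\<close> on \<open>V\<close> only,
  because derivatives within the sphere or within a hypersurface are determined only on tangent
  vectors. The eigenspace of \<open>c\<close> is spanned by the members of \<open>B\<close> with
  eigenvalue \<open>c\<close>, so geometric multiplicities count them.\<close>

lemma eigenvalues_orthonormal:
  fixes A :: "'a::euclidean_space \<Rightarrow> 'a"
  assumes lin: "linear A'" and eq: "\<And>v. v \<in> V \<Longrightarrow> A v = A' v"
    and B: "orthonormal B" "span B = V" and f: "\<And>b. b \<in> B \<Longrightarrow> A' b = f b *\<^sub>R b"
  shows "eigenvalues V A = image_mset f (mset_set B)"
proof -
  have fin: "finite B" using B orthonormal_finite by blast
  have "dim {v\<in>V. A v = c *\<^sub>R v} = count (image_mset f (mset_set B)) c" for c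
  proof -
    let ?C = "{b\<in>B. f b = c}"
    have "{v\<in>V. A v = c *\<^sub>R v} = span ?C"
    proof
      show "{v\<in>V. A v = c *\<^sub>R v} \<subseteq> span ?C"
      proof
        fix v assume "v \<in> {v\<in>V. A v = c *\<^sub>R v}"
        then have v: "v \<in> span B" "A' v = c *\<^sub>R v" using eq B by auto
        have ex: "(\<Sum>b\<in>B. (v \<bullet> b) *\<^sub>R b) = v" using orthonormal_expand[OF B(1) fin v(1)] .
        have "A' v = (\<Sum>b\<in>B. ((v \<bullet> b) * f b) *\<^sub>R b)"
          by (subst ex[symmetric]) (simp add: linear_sum[OF lin] linear_scale[OF lin] f)
        moreover have "c *\<^sub>R v = (\<Sum>b\<in>B. ((v \<bullet> b) * c) *\<^sub>R b)"
          by (subst (1) ex[symmetric]) (simp add: scaleR_sum_right mult.commute)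
        ultimately have "(\<Sum>b\<in>B. ((v \<bullet> b) * (f b - c)) *\<^sub>R b) = 0"
          using v by (simp add: algebra_simps sum_subtractf)
        then have z: "\<forall>b\<in>B. (v \<bullet> b) * (f b - c) = 0"
          using orthonormal_independent[OF B(1)] fin
          by (auto simp: independent_explicit dest!: spec[of _ "\<lambda>b. (v \<bullet> b) * (f b - c)"])
        have "v = (\<Sum>b\<in>?C. (v \<bullet> b) *\<^sub>R b)"
          by (subst (1) ex[symmetric], rule sum.mono_neutral_right) (use fin z in auto)
        then show "v \<in> span ?C" by (metis (no_types, lifting) span_base span_scale span_sum)
      qed
      show "span ?C \<subseteq> {v\<in>V. A v = c *\<^sub>R v}"
      proof (rule span_minimal)
        show "?C \<subseteq> {v\<in>V. A v = c *\<^sub>R v}" using B f eq span_base by fastforce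
        have "{v\<in>V. A v = c *\<^sub>R v} = {v\<in>V. A' v = c *\<^sub>R v}" using eq by auto
        moreover have "subspace V" using B(2) by auto
        ultimately show "subspace {v\<in>V. A v = c *\<^sub>R v}"
          by (auto simp: subspace_def linear_add[OF lin] linear_scale[OF lin] linear_0[OF lin] algebra_simps)
      qed
    qed
    moreover have "independent ?C"
      using orthonormal_independent[OF B(1)] independent_mono by fastforce
    ultimately have "dim {v\<in>V. A v = c *\<^sub>R v} = card ?C"
      using dim_span_eq_card_independent by metis
    also have "\<dots> = count (image_mset f (mset_set B)) c"
      using fin by (auto simp: count_image_mset Int_def vimage_def intro!: arg_cong[of _ _ card])
    finally show ?thesis .
  qed
  then have "(\<lambda>c. dim {v\<in>V. A v = c *\<^sub>R v}) = count (image_mset f (mset_set B))" by auto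
  then show ?thesis unfolding eigenvalues_def by (simp add: count_inverse)
qed


section \<open>Calculus of continuously differentiable maps\<close>

lemma Ck_on_cong:
  assumes "open S" "\<And>x. x \<in> S \<Longrightarrow> f x = g x"
  shows "Ck_on k S f \<longleftrightarrow> Ck_on k S g"
  using assms(2)
proof (induction k arbitrary: f g)
  case 0
  then show ?case by (auto cong: continuous_on_cong)
next
  case (Suc k)
  have der: "(f has_derivative D) (at x) \<longleftrightarrow> (g has_derivative D) (at x)" if "x \<in> S" for x D
    using has_derivative_transform_within_open[OF _ assms(1) that] Suc.prems that by metis
  then have "frechet_derivative f (at x) = frechet_derivative g (at x)" if "x \<in> S" for x
    using that by (simp add: frechet_derivative_def)
  then have "Ck_on k S (\<lambda>x. frechet_derivative f (at x) v) \<longleftrightarrow> Ck_on k S (\<lambda>x. frechet_derivative g (at x) v)" for v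
    by (intro Suc.IH) auto
  then show ?case using der by (simp add: differentiable_def)
qed

lemma frechet_derivative_eqI:
  "(f has_derivative f') (at x) \<Longrightarrow> frechet_derivative f (at x) v = f' v"
  using frechet_derivative_at by metis

lemma Ck_on_SucI:
  assumes "open S" "\<And>x. x \<in> S \<Longrightarrow> (f has_derivative f' x) (at x)" "\<And>v. Ck_on k S (\<lambda>x. f' x v)"
  shows "Ck_on (Suc k) S f"
proof -
  have "Ck_on k S (\<lambda>x. frechet_derivative f (at x) v)" for v
    using Ck_on_cong[OF assms(1), of "\<lambda>x. frechet_derivative f (at x) v" "\<lambda>x. f' x v" k]
      frechet_derivative_at[OF assms(2)] assms(3) by metis
  then show ?thesis using assms(2) by (auto simp: differentiable_def)
qed

lemma Ck_on_SucD:
  assumes "Ck_on (Suc k) S f"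
  shows "\<And>x. x \<in> S \<Longrightarrow> (f has_derivative frechet_derivative f (at x)) (at x)"
    and "\<And>v. Ck_on k S (\<lambda>x. frechet_derivative f (at x) v)"
  using assms by (auto simp: frechet_derivative_works)

lemma Ck_on_imp_continuous_on: "Ck_on k S f \<Longrightarrow> continuous_on S f"
  by (cases k) (auto intro!: continuous_at_imp_continuous_on differentiable_imp_continuous_within)

lemma Ck_on_Suc_imp: "Ck_on (Suc k) S f \<Longrightarrow> Ck_on k S f"
proof (induction k arbitrary: f)
  case 0
  then show ?case using Ck_on_imp_continuous_on[of "Suc 0" S f] by simp
next
  case (Suc k)
  have "Ck_on k S (\<lambda>x. frechet_derivative f (at x) v)" for v
    by (rule Suc.IH) (use Suc.prems in auto)
  then show ?case using Suc.prems by simp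
qed

lemma Ck_on_le: "Ck_on k S f \<Longrightarrow> j \<le> k \<Longrightarrow> Ck_on j S f"
  by (induction k) (auto simp: le_Suc_eq dest: Ck_on_Suc_imp simp del: Ck_on.simps(2))

lemma Ck_on_subset: "Ck_on k S f \<Longrightarrow> T \<subseteq> S \<Longrightarrow> Ck_on k T f"
  by (induction k arbitrary: f) (auto intro: continuous_on_subset)

lemma Ck_on_local:
  assumes "\<And>x. x \<in> S \<Longrightarrow> \<exists>U. open U \<and> x \<in> U \<and> Ck_on k U f"
  shows "Ck_on k S f"
  using assms
proof (induction k arbitrary: f)
  case 0
  have "continuous (at x) f" if x: "x \<in> S" for x
  proof -
    obtain U where "open U" "x \<in> U" "continuous_on U f" using 0[OF x] by auto
    then show ?thesis by (simp add: continuous_on_eq_continuous_at)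
  qed
  then show ?case by (simp add: continuous_at_imp_continuous_on)
next
  case (Suc k)
  have "f differentiable (at x)" if "x \<in> S" for x using Suc.prems[OF that] by auto
  moreover have "Ck_on k S (\<lambda>x. frechet_derivative f (at x) v)" for v
    by (rule Suc.IH) (use Suc.prems in fastforce)
  ultimately show ?case by simp
qed

lemma Ck_on_const: "open S \<Longrightarrow> Ck_on k S (\<lambda>x. c)"
  by (induction k arbitrary: c) (auto intro: Ck_on_SucI[where f' = "\<lambda>_ _. 0"] simp del: Ck_on.simps(2))

lemma Ck_on_bounded_linear: "open S \<Longrightarrow> bounded_linear f \<Longrightarrow> Ck_on k S f"
  by (cases k) (auto intro!: Ck_on_SucI[where f' = "\<lambda>_. f"] Ck_on_const bounded_linear_imp_has_derivative
      simp: linear_continuous_on simp del: Ck_on.simps(2))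

lemma Ck_on_id: "open S \<Longrightarrow> Ck_on k S (\<lambda>x. x)"
  by (intro Ck_on_bounded_linear bounded_linear_ident)

lemma Ck_on_linear_comp:
  "open S \<Longrightarrow> bounded_linear L \<Longrightarrow> Ck_on k S f \<Longrightarrow> Ck_on k S (\<lambda>x. L (f x))"
proof (induction k arbitrary: f)
  case 0
  then show ?case by (auto intro: bounded_linear.continuous_on)
next
  case (Suc k)
  show ?case
    by (rule Ck_on_SucI[OF Suc.prems(1) bounded_linear.has_derivative[OF Suc.prems(2) Ck_on_SucD(1)[OF Suc.prems(3)]]])
      (auto intro!: Suc.IH Suc.prems Ck_on_SucD(2)[OF Suc.prems(3)])
qed

lemma Ck_on_add:
  "open S \<Longrightarrow> Ck_on k S f \<Longrightarrow> Ck_on k S g \<Longrightarrow> Ck_on k S (\<lambda>x. f x + g x)"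
proof (induction k arbitrary: f g)
  case 0
  then show ?case by (auto intro: continuous_intros)
next
  case (Suc k)
  show ?case
    by (rule Ck_on_SucI[OF Suc.prems(1) has_derivative_add[OF Ck_on_SucD(1)[OF Suc.prems(2)] Ck_on_SucD(1)[OF Suc.prems(3)]]])
      (auto intro!: Suc.IH Suc.prems Ck_on_SucD(2)[OF Suc.prems(2)] Ck_on_SucD(2)[OF Suc.prems(3)])
qed

lemma Ck_on_sum:
  "open S \<Longrightarrow> (\<And>i. i \<in> I \<Longrightarrow> Ck_on k S (f i)) \<Longrightarrow> Ck_on k S (\<lambda>x. \<Sum>i\<in>I. f i x)"
  by (induction I rule: infinite_finite_induct) (auto intro!: Ck_on_const Ck_on_add)

lemma Ck_on_bilinear:
  assumes "open S" "bounded_bilinear pr"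
  shows "Ck_on k S f \<Longrightarrow> Ck_on k S g \<Longrightarrow> Ck_on k S (\<lambda>x. pr (f x) (g x))"
proof (induction k arbitrary: f g)
  case 0
  then show ?case using assms by (auto intro: bounded_bilinear.continuous_on)
next
  case (Suc k)
  show ?case
    by (rule Ck_on_SucI[OF assms(1) bounded_bilinear.FDERIV[OF assms(2) Ck_on_SucD(1)[OF Suc.prems(1)] Ck_on_SucD(1)[OF Suc.prems(2)]]])
     (auto intro!: Ck_on_add assms Suc.IH intro: Ck_on_Suc_imp Suc.prems Ck_on_SucD(2)[OF Suc.prems(1)] Ck_on_SucD(2)[OF Suc.prems(2)] simp del: Ck_on.simps)
qed

lemmas Ck_on_scaleR = Ck_on_bilinear[OF _ bounded_bilinear_scaleR]
lemmas Ck_on_mult = Ck_on_bilinear[OF _ bounded_bilinear_mult]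
lemmas Ck_on_inner = Ck_on_bilinear[OF _ bounded_bilinear_inner]

lemma Ck_on_minus: "open S \<Longrightarrow> Ck_on k S f \<Longrightarrow> Ck_on k S (\<lambda>x. - f x)"
  by (rule Ck_on_linear_comp[OF _ bounded_linear_minus[OF bounded_linear_ident]])

lemma Ck_on_diff:
  "open S \<Longrightarrow> Ck_on k S f \<Longrightarrow> Ck_on k S g \<Longrightarrow> Ck_on k S (\<lambda>x. f x - g x)"
  using Ck_on_add[of S k f "\<lambda>x. - g x"] Ck_on_minus[of S k g] by simp

lemma linear_Basis_expand:
  fixes L :: "'a::euclidean_space \<Rightarrow> 'b::real_vector"
  assumes "linear L"
  shows "L v = (\<Sum>b\<in>Basis. (v \<bullet> b) *\<^sub>R L b)"
  by (subst euclidean_representation[of v, symmetric])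
    (simp add: linear_sum[OF assms] linear_scale[OF assms])

text \<open>\<open>Ck_on\<close> tests derivatives in fixed directions, whereas the chain rule feeds
  the moving direction \<open>Dg v\<close> into the derivative of \<open>f\<close>; expanding it in
  \<open>Basis\<close> makes the induction hypothesis applicable.\<close>

lemma Ck_on_compose:
  fixes f :: "'b::euclidean_space \<Rightarrow> 'c::real_normed_vector"
  assumes "open S" "open T" "\<And>x. x \<in> S \<Longrightarrow> g x \<in> T"
  shows "Ck_on k T f \<Longrightarrow> Ck_on k S g \<Longrightarrow> Ck_on k S (\<lambda>x. f (g x))"
proof (induction k arbitrary: f)
  case 0
  then show ?case using assms by (auto intro: continuous_on_compose2)
next
  case (Suc k)
  have d: "((\<lambda>x. f (g x)) has_derivative
      (\<lambda>v. \<Sum>b\<in>Basis. (frechet_derivative g (at x) v \<bullet> b) *\<^sub>R frechet_derivative f (at (g x)) b)) (at x)"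
    if x: "x \<in> S" for x
  proof -
    have df: "(f has_derivative frechet_derivative f (at (g x))) (at (g x))"
      by (rule Ck_on_SucD(1)[OF Suc.prems(1) assms(3)[OF x]])
    have "((\<lambda>x. f (g x)) has_derivative
      (\<lambda>v. frechet_derivative f (at (g x)) (frechet_derivative g (at x) v))) (at x)"
      using diff_chain_at[OF Ck_on_SucD(1)[OF Suc.prems(2) x] df] by (simp add: o_def)
    then show ?thesis
      by (subst linear_Basis_expand[OF has_derivative_linear[OF df], symmetric])
  qed
  show ?case
    by (rule Ck_on_SucI[OF assms(1) d])
      (auto intro!: Ck_on_sum Ck_on_scaleR Ck_on_inner Ck_on_const assms(1)
        Ck_on_SucD(2)[OF Suc.prems(2)]
        Suc.IH[OF Ck_on_SucD(2)[OF Suc.prems(1)] Ck_on_Suc_imp[OF Suc.prems(2)]] simp del: Ck_on.simps)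
qed

lemma Ck_on_inverse_real: "Ck_on k {0<..} (inverse :: real \<Rightarrow> real)"
proof (induction k)
  case 0
  then show ?case by (auto intro!: continuous_intros)
next
  case (Suc k)
  show ?case
    by (rule Ck_on_SucI[where f' = "\<lambda>x v. - (inverse x * v * inverse x)"])
      (auto intro!: has_derivative_inverse' Ck_on_minus Ck_on_mult Ck_on_const Suc)
qed

lemma Ck_on_powr: "Ck_on k {0<..} (\<lambda>x::real. x powr a)"
proof (induction k arbitrary: a)
  case 0
  then show ?case by (auto intro!: continuous_intros)
next
  case (Suc k)
  show ?case
    by (rule Ck_on_SucI[where f' = "\<lambda>x v. a * x powr (a - 1) * v"])
      (auto intro!: Ck_on_mult Ck_on_const Suc
        has_real_derivative_powr[THEN has_field_derivative_imp_has_derivative, THEN has_derivative_eq_rhs])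
qed


lemma Ck_on_norm:
  assumes "open S" "Ck_on k S f" "\<And>x. x \<in> S \<Longrightarrow> f x \<noteq> 0"
  shows "Ck_on k S (\<lambda>x. norm (f x :: 'b::real_inner))"
proof -
  have "Ck_on k S (\<lambda>x. (f x \<bullet> f x) powr (1/2))"
    by (rule Ck_on_compose[OF assms(1) open_greaterThan _ Ck_on_powr])
      (use assms in \<open>auto intro!: Ck_on_inner\<close>)
  then show ?thesis
    by (subst Ck_on_cong[OF assms(1)]) (auto simp: norm_eq_sqrt_inner powr_half_sqrt)
qed

lemma Ck_on_inverse:
  assumes "open S" "Ck_on k S f" "\<And>x. x \<in> S \<Longrightarrow> 0 < f x"
  shows "Ck_on k S (\<lambda>x. inverse (f x :: real))"
  by (rule Ck_on_compose[OF assms(1) open_greaterThan _ Ck_on_inverse_real]) (use assms in auto)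

text \<open>The derivative of \<open>L = M\<inverse>\<close> is \<open>- L (dM) L\<close>; the regularity of \<open>L\<close> follows by bootstrapping.\<close>

lemma inverse_operator_has_derivative:
  fixes L M :: "'a::real_normed_vector \<Rightarrow> 'b::euclidean_space \<Rightarrow> 'b"
  assumes S: "open S" "x \<in> S"
    and lin: "\<And>y. y \<in> S \<Longrightarrow> linear (L y)" "\<And>y. y \<in> S \<Longrightarrow> linear (M y)"
    and inv: "\<And>y v. y \<in> S \<Longrightarrow> L y (M y v) = v" "\<And>y v. y \<in> S \<Longrightarrow> M y (L y v) = v"
    and cont: "\<And>v. continuous_on S (\<lambda>y. L y v)"
    and der: "\<And>v. ((\<lambda>y. M y v) has_derivative D v) (at x)"
  shows "((\<lambda>y. L y v) has_derivative (\<lambda>h. - L x (D (L x v) h))) (at x)"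
proof -
  define w where "w = L x v"

  \<comment> \<open>The resolvent identity for \<open>L y - L x\<close>, applied to
    \<open>v\<close>.\<close>
  have eq: "L y v - w = L y (- (M y w - M x w))" if "y \<in> S" for y
    using that S inv lin by (simp add: w_def linear_diff linear_neg)
  have Dl: "bounded_linear (D w)" using der has_derivative_bounded_linear by blast
  have Lxb: "bounded_linear (L x)" using lin(1)[OF S(2)] linear_conv_bounded_linear by blast
  have ex: "L y u = (\<Sum>b\<in>Basis. (u \<bullet> b) *\<^sub>R L y b)" if "y \<in> S" for y u
    using linear_Basis_expand[OF lin(1)[OF that]] .
  \<comment> \<open>Only continuity of \<open>L\<close> is available here. It suffices: the other
    factor is differentiable and vanishes at \<open>x\<close>, and such a product with a continuous
    factor is differentiable at \<open>x\<close>.\<close>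
  have hd: "((\<lambda>y. \<Sum>b\<in>Basis. ((- (M y w - M x w)) \<bullet> b) *\<^sub>R L y b) has_derivative
      (\<lambda>h. \<Sum>b\<in>Basis. ((- D w h) \<bullet> b) *\<^sub>R L x b)) (at x)"
  proof (intro has_derivative_sum)
    fix b :: 'b assume b: "b \<in> Basis"
    let ?g = "\<lambda>y. (- (M y w - M x w)) \<bullet> b"
    have g: "(?g has_derivative (\<lambda>h. (- D w h) \<bullet> b)) (at x)"
      by (auto intro!: derivative_eq_intros der)
    have Lc: "((\<lambda>y. L y b) \<longlongrightarrow> L x b) (at x)"
      using cont[of b] S by (simp add: continuous_on_eq_continuous_at isCont_def)
    have lim: "((\<lambda>y. (?g y - ?g x - (- D w (y - x)) \<bullet> b) /\<^sub>R norm (y - x)) \<longlongrightarrow> 0) (at x)"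
      using g unfolding has_derivative_at_within by blast
    obtain C where C: "\<And>h. norm (D w h) \<le> C * norm h"
      using bounded_linear.bounded[OF Dl] by (metis mult.commute)
    have lim2: "((\<lambda>y. (((- D w (y - x)) \<bullet> b) / norm (y - x)) *\<^sub>R (L y b - L x b)) \<longlongrightarrow> 0) (at x)"
    proof (rule Lim_null_comparison)
      show "((\<lambda>y. \<bar>C\<bar> * norm (L y b - L x b)) \<longlongrightarrow> 0) (at x)"
        using Lc by (auto intro!: tendsto_eq_intros simp: LIM_zero_iff)
      have "norm ((((- D w (y - x)) \<bullet> b) / norm (y - x)) *\<^sub>R (L y b - L x b)) \<le> \<bar>C\<bar> * norm (L y b - L x b)" for y
      proof -
        have "\<bar>(- D w (y - x)) \<bullet> b\<bar> \<le> norm (D w (y - x))"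
          using Cauchy_Schwarz_ineq2[of "- D w (y - x)" b] b by simp
        also have "\<dots> \<le> \<bar>C\<bar> * norm (y - x)"
          by (rule order_trans[OF C]) (simp add: mult_right_mono)
        finally have "\<bar>(- D w (y - x)) \<bullet> b\<bar> / norm (y - x) \<le> \<bar>C\<bar>"
          by (cases "y = x") (auto simp: field_simps)
        then have "\<bar>(- D w (y - x)) \<bullet> b\<bar> / norm (y - x) * norm (L y b - L x b) \<le> \<bar>C\<bar> * norm (L y b - L x b)"
          by (rule mult_right_mono) simp
        then show ?thesis by (simp only: norm_scaleR abs_divide abs_norm_cancel)
      qed
      then show "\<forall>\<^sub>F y in at x. norm ((((- D w (y - x)) \<bullet> b) / norm (y - x)) *\<^sub>R (L y b - L x b)) \<le> \<bar>C\<bar> * norm (L y b - L x b)"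
        by simp
    qed
    have "((\<lambda>y. ((?g y - ?g x - (- D w (y - x)) \<bullet> b) /\<^sub>R norm (y - x)) *\<^sub>R L y b
        + (((- D w (y - x)) \<bullet> b) / norm (y - x)) *\<^sub>R (L y b - L x b)) \<longlongrightarrow> 0 *\<^sub>R L x b + 0) (at x)"
      by (intro tendsto_add tendsto_scaleR lim lim2 Lc)
    moreover have "((?g y - ?g x - (- D w (y - x)) \<bullet> b) /\<^sub>R norm (y - x)) *\<^sub>R L y b
        + (((- D w (y - x)) \<bullet> b) / norm (y - x)) *\<^sub>R (L y b - L x b)
      = (?g y *\<^sub>R L y b - ?g x *\<^sub>R L x b - ((- D w (y - x)) \<bullet> b) *\<^sub>R L x b) /\<^sub>R norm (y - x)" for y
      by (simp add: divide_inverse scaleR_diff_right scaleR_diff_left scaleR_add_left scaleR_add_right algebra_simps)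
    ultimately have "((\<lambda>y. (?g y *\<^sub>R L y b - ?g x *\<^sub>R L x b - ((- D w (y - x)) \<bullet> b) *\<^sub>R L x b) /\<^sub>R norm (y - x)) \<longlongrightarrow> 0) (at x)"
      by (simp only: scaleR_zero_left add_0_left)
    moreover have "bounded_linear (\<lambda>h. ((- D w h) \<bullet> b) *\<^sub>R L x b)"
      using has_derivative_bounded_linear[OF g] bounded_linear_scaleR_const by blast
    ultimately show "((\<lambda>y. ?g y *\<^sub>R L y b) has_derivative (\<lambda>h. ((- D w h) \<bullet> b) *\<^sub>R L x b)) (at x)"
      unfolding has_derivative_at_within by simp
  qed
  have "((\<lambda>y. L y v - w) has_derivative (\<lambda>h. \<Sum>b\<in>Basis. ((- D w h) \<bullet> b) *\<^sub>R L x b)) (at x)"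
    by (rule has_derivative_transform_within_open[OF hd S]) (metis eq ex)
  then have "((\<lambda>y. (L y v - w) + w) has_derivative (\<lambda>h. L x (- D w h))) (at x)"
    unfolding ex[OF S(2), symmetric] by (intro has_derivative_add_const)
  then show ?thesis
    using lin(1)[OF S(2)] by (simp add: linear_neg w_def)
qed

text \<open>If \<open>C\<close> bounds the inverse at \<open>x\<close>, then \<open>2 * C\<close>
  bounds the inverse wherever \<open>M y\<close> is closer to \<open>M x\<close> than
  \<open>1 / (2 * C)\<close>; with this uniform bound the resolvent identity gives
  continuity.\<close>

lemma inverse_operator_continuous:
  fixes L M :: "'a::real_normed_vector \<Rightarrow> 'b::euclidean_space \<Rightarrow> 'b"
  assumes S: "open S"
    and lin: "\<And>y. y \<in> S \<Longrightarrow> linear (L y)" "\<And>y. y \<in> S \<Longrightarrow> linear (M y)"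
    and inv: "\<And>y v. y \<in> S \<Longrightarrow> L y (M y v) = v" "\<And>y v. y \<in> S \<Longrightarrow> M y (L y v) = v"
    and cont: "\<And>v. continuous_on S (\<lambda>y. M y v)"
  shows "continuous_on S (\<lambda>y. L y v)"
proof (rule continuous_at_imp_continuous_on, intro ballI)
  fix x assume x: "x \<in> S"
  have Mc: "((\<lambda>y. M y v) \<longlongrightarrow> M x v) (at x)" for v
    using cont[of v] S x by (simp add: continuous_on_eq_continuous_at isCont_def)
  obtain C where C: "C > 0" "\<And>v. norm (L x v) \<le> norm v * C"
    using bounded_linear.pos_bounded[of "L x"] lin(1)[OF x] linear_conv_bounded_linear by blast
  let ?d = "\<lambda>y. \<Sum>b\<in>Basis. norm (M y b - M x b)"
  have d: "norm (M y v - M x v) \<le> norm v * ?d y" if "y \<in> S" for y v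
  proof -
    have "M y v - M x v = (\<Sum>b\<in>Basis. (v \<bullet> b) *\<^sub>R (M y b - M x b))"
      by (subst linear_Basis_expand[OF lin(2)[OF that]], subst linear_Basis_expand[OF lin(2)[OF x]])
        (simp add: sum_subtractf scaleR_diff_right)
    also have "norm \<dots> \<le> (\<Sum>b\<in>Basis. norm v * norm (M y b - M x b))"
      by (rule sum_norm_le) (auto intro!: mult_right_mono Basis_le_norm)
    finally show ?thesis by (simp add: sum_distrib_left)
  qed
  have "(?d \<longlongrightarrow> 0) (at x)"
    by (rule tendsto_eq_rhs[OF tendsto_sum[OF tendsto_norm[OF tendsto_diff[OF Mc tendsto_const]]]]) simp
  then have ev: "eventually (\<lambda>y. ?d y < 1 / (2 * C)) (at x)"
    by (rule order_tendstoD) (use C in simp)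
  have evS: "eventually (\<lambda>y. y \<in> S) (at x)" using S x by (rule eventually_at_in_open')
  have bd: "norm (L y u) \<le> 2 * C * norm u" if y: "y \<in> S" "?d y < 1 / (2 * C)" for y u
  proof -
    let ?v = "L y u"
    have "norm ?v \<le> norm (M x ?v) * C" using C(2)[of "M x ?v"] inv(1)[OF x] by simp
    also have "norm (M x ?v) \<le> norm u + norm ?v * ?d y"
      using d[OF y(1), of ?v] inv(2)[OF y(1), of u] norm_triangle_ineq4[of u "M y ?v - M x ?v"] by simp
    also have "norm ?v * ?d y \<le> norm ?v * (1 / (2 * C))"
      using y by (intro mult_left_mono) auto
    finally have "norm ?v \<le> (norm u + norm ?v * (1 / (2 * C))) * C" using C by simp
    also have "\<dots> = C * norm u + norm ?v / 2" using C by (simp add: field_simps)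
    finally show ?thesis by linarith
  qed
  have "((\<lambda>y. L y v - L x v) \<longlongrightarrow> 0) (at x)"
  proof (rule Lim_null_comparison)
    show "\<forall>\<^sub>F y in at x. norm (L y v - L x v) \<le> 2 * C * norm (M x (L x v) - M y (L x v))"
      using ev evS
    proof eventually_elim
      case (elim y)
      have "L y v - L x v = L y (M x (L x v) - M y (L x v))"
        using elim x inv lin by (simp add: linear_diff)
      then show ?case using bd[OF elim(2,1)] by simp
    qed
    show "((\<lambda>y. 2 * C * norm (M x (L x v) - M y (L x v))) \<longlongrightarrow> 0) (at x)"
      using tendsto_mult_right_zero[OF tendsto_norm_zero[OF LIM_zero[OF Mc[of "L x v"]]], of "2 * C"]
      by (simp add: norm_minus_commute)
  qed
  then show "isCont (\<lambda>y. L y v) x" unfolding isCont_def by (rule LIM_zero_cancel)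
qed

lemma Ck_on_inverse_operator:
  fixes L M :: "'a::real_normed_vector \<Rightarrow> 'b::euclidean_space \<Rightarrow> 'b"
  assumes S: "open S"
    and lin: "\<And>y. y \<in> S \<Longrightarrow> linear (L y)" "\<And>y. y \<in> S \<Longrightarrow> linear (M y)"
    and inv: "\<And>y v. y \<in> S \<Longrightarrow> L y (M y v) = v" "\<And>y v. y \<in> S \<Longrightarrow> M y (L y v) = v"
  shows "(\<And>v. Ck_on k S (\<lambda>y. M y v)) \<Longrightarrow> Ck_on k S (\<lambda>y. L y v)"
proof (induction k arbitrary: v)
  case 0
  then show ?case using inverse_operator_continuous[OF S lin inv] by simp
next
  case (Suc k)
  have cont: "continuous_on S (\<lambda>y. L y v)" for v
    by (rule inverse_operator_continuous[OF S lin inv Ck_on_imp_continuous_on[OF Suc.prems]])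
  have IH: "Ck_on k S (\<lambda>y. L y v)" for v
    by (rule Suc.IH[OF Ck_on_Suc_imp[OF Suc.prems]])
  have app: "Ck_on k S (\<lambda>y. \<Sum>b\<in>Basis. (f y \<bullet> b) *\<^sub>R N y b)"
    if "Ck_on k S f" "\<And>b. Ck_on k S (\<lambda>y. N y b)" for f N
    using that S by (intro Ck_on_sum Ck_on_scaleR Ck_on_inner Ck_on_const)
  let ?D = "\<lambda>y v h. frechet_derivative (\<lambda>y. M y v) (at y) h"
  have M': "((\<lambda>y. M y v) has_derivative ?D y v) (at y)" if "y \<in> S" for y v
    using Ck_on_SucD(1)[OF Suc.prems that] .
  have lin': "linear (\<lambda>v. ?D y v h)" if "y \<in> S" for y h
  proof (rule linearI)
    fix a b :: 'b and r :: real
    have "((\<lambda>y. M y (a + b)) has_derivative (\<lambda>h. ?D y a h + ?D y b h)) (at y)"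
      by (rule has_derivative_transform_within_open[OF has_derivative_add[OF M'[OF that] M'[OF that]] S that])
        (simp add: lin linear_add)
    then show "?D y (a + b) h = ?D y a h + ?D y b h"
      by (simp add: frechet_derivative_eqI)
    have "((\<lambda>y. M y (r *\<^sub>R a)) has_derivative (\<lambda>h. r *\<^sub>R ?D y a h)) (at y)"
      by (rule has_derivative_transform_within_open[OF has_derivative_scaleR_right[OF M'[OF that]] S that])
        (simp add: lin linear_scale)
    then show "?D y (r *\<^sub>R a) h = r *\<^sub>R ?D y a h"
      by (simp add: frechet_derivative_eqI)
  qed
  show ?case
  proof (rule Ck_on_SucI[OF S inverse_operator_has_derivative[OF S _ lin inv cont M']])
    fix h
    have "Ck_on k S (\<lambda>y. \<Sum>b\<in>Basis. (L y v \<bullet> b) *\<^sub>R ?D y b h)"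
      by (intro app IH Ck_on_SucD(2)[OF Suc.prems])
    then have "Ck_on k S (\<lambda>y. ?D y (L y v) h)"
      by (subst Ck_on_cong[OF S]) (auto simp: linear_Basis_expand[OF lin', symmetric])
    then have "Ck_on k S (\<lambda>y. \<Sum>b\<in>Basis. (?D y (L y v) h \<bullet> b) *\<^sub>R L y b)"
      by (intro app IH)
    then have "Ck_on k S (\<lambda>y. L y (?D y (L y v) h))"
      by (subst Ck_on_cong[OF S]) (auto simp: linear_Basis_expand[OF lin(1), symmetric])
    then show "Ck_on k S (\<lambda>y. - L y (?D y (L y v) h))"
      by (rule Ck_on_minus[OF S])
  qed
qed

section \<open>Mean value arguments and the symmetry of second derivatives\<close>

lemma has_real_derivative_along_line:
  fixes f :: "'a::real_normed_vector \<Rightarrow> real"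
  assumes "(f has_derivative f') (at (a + s *\<^sub>R v))"
  shows "((\<lambda>s. f (a + s *\<^sub>R v)) has_real_derivative f' v) (at s)"
proof -
  have "((\<lambda>s. a + s *\<^sub>R v) has_derivative (\<lambda>h. h *\<^sub>R v)) (at s)"
    by (auto intro!: derivative_eq_intros)
  from has_derivative_compose[OF this assms]
  have "((\<lambda>s. f (a + s *\<^sub>R v)) has_derivative (\<lambda>h. f' (h *\<^sub>R v))) (at s)" .
  then show ?thesis
    by (simp add: has_field_derivative_def linear_scale[OF has_derivative_linear[OF assms]] mult.commute[of _ "f' _"])
qed


text \<open>The mixed difference is symmetric in \<open>v\<close> and \<open>w\<close>, which is the
  source of the symmetry of second derivatives. The mean value theorem is used in direction
  \<open>v\<close> on the difference over \<open>w\<close>, then in direction \<open>w\<close> on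
  the resulting derivative.\<close>

lemma mixed_difference_mvt:
  fixes f :: "'a::real_normed_vector \<Rightarrow> real"
  assumes f: "\<And>y. y \<in> ball x r \<Longrightarrow> (f has_derivative f' y) (at y)"
    and f': "\<And>y. y \<in> ball x r \<Longrightarrow> ((\<lambda>y. f' y v) has_derivative f'' y) (at y)"
    and t: "t > 0" "t * (norm v + norm w) < r"
  shows "\<exists>a b. 0 < a \<and> a < t \<and> 0 < b \<and> b < t \<and>
    f (x + t *\<^sub>R v + t *\<^sub>R w) - f (x + t *\<^sub>R v) - f (x + t *\<^sub>R w) + f x = t\<^sup>2 * f'' (x + a *\<^sub>R v + b *\<^sub>R w) w"
proof -
  have inb: "x + a *\<^sub>R v + b *\<^sub>R w \<in> ball x r" if "0 \<le> a" "a \<le> t" "0 \<le> b" "b \<le> t" for a b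
  proof -
    have "norm (a *\<^sub>R v + b *\<^sub>R w) \<le> a * norm v + b * norm w"
      using norm_triangle_ineq[of "a *\<^sub>R v" "b *\<^sub>R w"] that by simp
    also have "\<dots> \<le> t * norm v + t * norm w"
      using that by (intro add_mono mult_right_mono) auto
    finally have "norm (- (a *\<^sub>R v + b *\<^sub>R w)) < r"
      unfolding norm_minus_cancel using t by (simp add: algebra_simps)
    moreover have "- (a *\<^sub>R v + b *\<^sub>R w) = x - (x + a *\<^sub>R v + b *\<^sub>R w)" by simp
    ultimately show ?thesis by (simp only: mem_ball dist_norm)
  qed
  let ?g = "\<lambda>s. f (x + s *\<^sub>R v + t *\<^sub>R w) - f (x + s *\<^sub>R v)"
  have d1: "((\<lambda>s. f (x + s *\<^sub>R v + c *\<^sub>R w)) has_real_derivative f' (x + s *\<^sub>R v + c *\<^sub>R w) v) (at s)"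
    if "0 \<le> s" "s \<le> t" "0 \<le> c" "c \<le> t" for s c
    using has_real_derivative_along_line[of f "f' (x + s *\<^sub>R v + c *\<^sub>R w)" "x + c *\<^sub>R w" s v]
      f[OF inb[OF that]] by (simp add: add_ac)
  have "(?g has_real_derivative f' (x + s *\<^sub>R v + t *\<^sub>R w) v - f' (x + s *\<^sub>R v) v) (at s)" if "0 \<le> s" "s \<le> t" for s
    using DERIV_diff[OF d1[of s t] d1[of s 0]] that t by simp
  then obtain a where a: "0 < a" "a < t" "?g t - ?g 0 = t * (f' (x + a *\<^sub>R v + t *\<^sub>R w) v - f' (x + a *\<^sub>R v) v)"
    using MVT2[OF t(1), of ?g "\<lambda>s. f' (x + s *\<^sub>R v + t *\<^sub>R w) v - f' (x + s *\<^sub>R v) v"] by auto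
  let ?h = "\<lambda>s. f' (x + a *\<^sub>R v + s *\<^sub>R w) v"
  have "(?h has_real_derivative f'' (x + a *\<^sub>R v + s *\<^sub>R w) w) (at s)" if "0 \<le> s" "s \<le> t" for s
    by (rule has_real_derivative_along_line[OF f']) (use inb a that in simp)
  then obtain b where b: "0 < b" "b < t" "?h t - ?h 0 = t * f'' (x + a *\<^sub>R v + b *\<^sub>R w) w"
    using MVT2[OF t(1), of ?h "\<lambda>s. f'' (x + a *\<^sub>R v + s *\<^sub>R w) w"] by auto
  have "f (x + t *\<^sub>R v + t *\<^sub>R w) - f (x + t *\<^sub>R v) - f (x + t *\<^sub>R w) + f x = ?g t - ?g 0" by simp
  also have "\<dots> = t\<^sup>2 * f'' (x + a *\<^sub>R v + b *\<^sub>R w) w"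
    using a b by (simp add: power2_eq_square)
  finally show ?thesis using a b by blast
qed

lemma second_derivative_symmetric_real:
  fixes f :: "'a::real_normed_vector \<Rightarrow> real"
  assumes S: "open S" "x \<in> S" and f: "Ck_on 2 S f"
  shows "frechet_derivative (\<lambda>y. frechet_derivative f (at y) v) (at x) w
       = frechet_derivative (\<lambda>y. frechet_derivative f (at y) w) (at x) v"
proof -
  let ?F = "\<lambda>y v w. frechet_derivative (\<lambda>y. frechet_derivative f (at y) v) (at y) w"
  have f2: "Ck_on (Suc (Suc 0)) S f" using f by (simp add: numeral_2_eq_2)
  have cont: "continuous_on S (\<lambda>y. ?F y v w)" for v w
    using Ck_on_SucD(2)[OF Ck_on_SucD(2)[OF f2]] by simp
  obtain r where r: "r > 0" "ball x r \<subseteq> S" using S openE by blast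
  let ?D = "\<lambda>t. f (x + t *\<^sub>R v + t *\<^sub>R w) - f (x + t *\<^sub>R v) - f (x + t *\<^sub>R w) + f x"
  have close: "\<exists>d>0. \<forall>t. 0 < t \<and> t < d \<longrightarrow> \<bar>D t / t\<^sup>2 - ?F x v w\<bar> < e"
    if e: "e > 0" and D: "\<And>t. D t = f (x + t *\<^sub>R v + t *\<^sub>R w) - f (x + t *\<^sub>R v) - f (x + t *\<^sub>R w) + f x" for e v w D
  proof -
    obtain d where d: "d > 0" "\<And>y. y \<in> S \<Longrightarrow> dist y x < d \<Longrightarrow> dist (?F y v w) (?F x v w) < e"
      using cont[of v w] S(2) e unfolding continuous_on_iff by blast
    define m where "m = min d r / (norm v + norm w + 1)"
    have nn: "norm v + norm w + 1 > 0" by (simp add: add_nonneg_pos)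
    have m: "m > 0" unfolding m_def using d r nn by simp
    have "\<bar>D t / t\<^sup>2 - ?F x v w\<bar> < e" if t: "0 < t" "t < m" for t
    proof -
      have tm: "t * (norm v + norm w + 1) < min d r"
        using t nn unfolding m_def by (simp add: pos_less_divide_eq del: min_less_iff_conj)
      then have tr: "t * (norm v + norm w) < r" "t * (norm v + norm w) < d" using t by (auto simp: algebra_simps)
      have "\<exists>a b. 0 < a \<and> a < t \<and> 0 < b \<and> b < t \<and>
        f (x + t *\<^sub>R v + t *\<^sub>R w) - f (x + t *\<^sub>R v) - f (x + t *\<^sub>R w) + f x = t\<^sup>2 * ?F (x + a *\<^sub>R v + b *\<^sub>R w) v w"
        by (rule mixed_difference_mvt[OF Ck_on_SucD(1)[OF f2] Ck_on_SucD(1)[OF Ck_on_SucD(2)[OF f2]]])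
          (use r t tr in auto)
      then obtain a b where ab: "0 < a" "a < t" "0 < b" "b < t" "D t = t\<^sup>2 * ?F (x + a *\<^sub>R v + b *\<^sub>R w) v w"
        unfolding D by blast
      have "dist (x + a *\<^sub>R v + b *\<^sub>R w) x \<le> a * norm v + b * norm w"
        using norm_triangle_ineq[of "a *\<^sub>R v" "b *\<^sub>R w"] ab by (simp add: dist_norm algebra_simps)
      also have "\<dots> \<le> t * norm v + t * norm w" using ab by (intro add_mono mult_right_mono) auto
      finally have "dist (x + a *\<^sub>R v + b *\<^sub>R w) x < min d r" using tr by (simp add: algebra_simps)
      then have "dist (?F (x + a *\<^sub>R v + b *\<^sub>R w) v w) (?F x v w) < e"
        using r by (intro d) (auto simp: dist_commute)
      then show ?thesis using ab t by (simp add: dist_real_def)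
    qed
    then show ?thesis using m by blast
  qed
  show ?thesis
  proof (rule ccontr)
    assume ne: "?F x v w \<noteq> ?F x w v"
    \<comment> \<open>Both mixed derivatives are limits of the same difference quotient; half their
      distance is a tolerance that no single value can meet for both.\<close>
    define e where "e = \<bar>?F x v w - ?F x w v\<bar> / 2"
    have e: "e > 0" using ne by (simp add: e_def)
    obtain d1 where d1: "d1 > 0" "\<And>t. 0 < t \<Longrightarrow> t < d1 \<Longrightarrow> \<bar>?D t / t\<^sup>2 - ?F x v w\<bar> < e"
      using close[OF e, of ?D v w] by auto
    obtain d2 where d2: "d2 > 0" "\<And>t. 0 < t \<Longrightarrow> t < d2 \<Longrightarrow> \<bar>?D t / t\<^sup>2 - ?F x w v\<bar> < e"
      using close[OF e, of ?D w v] by (auto simp: algebra_simps)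
    define t where "t = min d1 d2 / 2"
    have "\<bar>?D t / t\<^sup>2 - ?F x v w\<bar> < e" "\<bar>?D t / t\<^sup>2 - ?F x w v\<bar> < e"
      using d1(1) d2(1) by (auto intro!: d1(2) d2(2) simp: t_def)
    moreover have "False" if "\<bar>p - q\<bar> < \<bar>q - r\<bar> / 2" "\<bar>p - r\<bar> < \<bar>q - r\<bar> / 2" for p q r :: real
    proof -
      have "\<bar>q - r\<bar> \<le> \<bar>p - q\<bar> + \<bar>p - r\<bar>" by linarith
      then show False using that by simp
    qed
    ultimately show False unfolding e_def by blast
  qed
qed

lemma frechet_derivative_inner_const:
  assumes "f differentiable (at x)"
  shows "frechet_derivative (\<lambda>y. f y \<bullet> c) (at x) v = frechet_derivative f (at x) v \<bullet> c"
proof -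
  have "((\<lambda>y. f y \<bullet> c) has_derivative (\<lambda>v. frechet_derivative f (at x) v \<bullet> c)) (at x)"
    using assms by (intro has_derivative_inner_left) (simp add: frechet_derivative_works)
  then show ?thesis by (simp add: frechet_derivative_eqI)
qed

lemma second_derivative_symmetric:
  fixes f :: "'a::real_normed_vector \<Rightarrow> 'b::euclidean_space"
  assumes S: "open S" "x \<in> S" and f: "Ck_on 2 S f"
  shows "frechet_derivative (\<lambda>y. frechet_derivative f (at y) v) (at x) w
       = frechet_derivative (\<lambda>y. frechet_derivative f (at y) w) (at x) v"
proof (rule euclidean_eqI)
  fix c :: 'b
  have f2: "Ck_on (Suc (Suc 0)) S f" using f by (simp add: numeral_2_eq_2)
  have fd: "f differentiable (at y)" if "y \<in> S" for y using f2 that by simp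
  have eq: "frechet_derivative (\<lambda>y. frechet_derivative (\<lambda>y. f y \<bullet> c) (at y) v) (at x) w
    = frechet_derivative (\<lambda>y. frechet_derivative f (at y) v) (at x) w \<bullet> c" for v w
  proof -
    have "((\<lambda>y. frechet_derivative f (at y) v \<bullet> c) has_derivative
      (\<lambda>w. frechet_derivative (\<lambda>y. frechet_derivative f (at y) v) (at x) w \<bullet> c)) (at x)"
      by (intro has_derivative_inner_left Ck_on_SucD(1)[OF Ck_on_SucD(2)[OF f2] S(2)])
    then have "((\<lambda>y. frechet_derivative (\<lambda>y. f y \<bullet> c) (at y) v) has_derivative
      (\<lambda>w. frechet_derivative (\<lambda>y. frechet_derivative f (at y) v) (at x) w \<bullet> c)) (at x)"
      by (rule has_derivative_transform_within_open[OF _ S]) (simp add: frechet_derivative_inner_const fd)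
    then show ?thesis by (simp add: frechet_derivative_eqI)
  qed
  have "Ck_on 2 S (\<lambda>y. f y \<bullet> c)" using f S by (intro Ck_on_inner Ck_on_const)
  then show "frechet_derivative (\<lambda>y. frechet_derivative f (at y) v) (at x) w \<bullet> c
       = frechet_derivative (\<lambda>y. frechet_derivative f (at y) w) (at x) v \<bullet> c"
    using second_derivative_symmetric_real[OF S, of "\<lambda>y. f y \<bullet> c" v w] eq by simp
qed


section \<open>Integration by parts\<close>

text \<open>Removes the singularity of homogeneous functions at the origin after multiplication by a
  cutoff: every point lies in \<open>S\<close> or in the open complement of \<open>C\<close>, where
  \<open>f\<close> is zero.\<close>

lemma Ck_on_extend_zero:
  assumes "open S" "closed C" "C \<subseteq> S" "Ck_on k S f" "\<And>x. x \<notin> C \<Longrightarrow> f x = 0"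
  shows "Ck_on k UNIV f"
proof (rule Ck_on_local)
  fix x :: 'a
  have "Ck_on k (- C) f"
    using Ck_on_cong[of "- C" f "\<lambda>_. 0" k] Ck_on_const[of "- C" k 0] assms by auto
  moreover have "open (- C)" using assms by auto
  ultimately show "\<exists>U. open U \<and> x \<in> U \<and> Ck_on k U f"
    using assms by (cases "x \<in> S") auto
qed

lemma integrable_compact_support:
  fixes f :: "'a::euclidean_space \<Rightarrow> real"
  assumes "continuous_on UNIV f" "compact C" "\<And>x. x \<notin> C \<Longrightarrow> f x = 0"
  shows "integrable lborel f"
proof -
  have "integrable lborel (\<lambda>x. indicator C x *\<^sub>R f x)"
    by (rule borel_integrable_compact[OF assms(2) continuous_on_subset[OF assms(1)]]) auto
  moreover have "(\<lambda>x. indicator C x *\<^sub>R f x) = f"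
  proof
    show "indicator C x *\<^sub>R f x = f x" for x using assms(3) by (cases "x \<in> C") auto
  qed
  ultimately show ?thesis by simp
qed

lemma integral_translate:
  fixes f :: "'a::euclidean_space \<Rightarrow> real"
  assumes "integrable lborel f"
  shows "integrable lborel (\<lambda>x. f (c + x))" "(\<integral>x. f (c + x) \<partial>lborel) = (\<integral>x. f x \<partial>lborel)"
proof -
  have f: "f \<in> borel_measurable borel" using assms by auto
  have m: "(+) c \<in> measurable lborel borel" by simp
  show "integrable lborel (\<lambda>x. f (c + x))"
    using integrable_distr_eq[OF m f] assms lborel_distr_plus[of c] by simp
  show "(\<integral>x. f (c + x) \<partial>lborel) = (\<integral>x. f x \<partial>lborel)"
    using integral_distr[OF m f] lborel_distr_plus[of c] by simp
qed

text \<open>Translation invariance makes the integrals of the difference quotients vanish.\<close>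

lemma integral_derivative_compact_support:
  fixes f :: "'a::euclidean_space \<Rightarrow> real"
  assumes f: "Ck_on 1 UNIV f" and C: "compact C" and z: "\<And>x. x \<notin> C \<Longrightarrow> f x = 0"
  shows "integrable lborel (\<lambda>x. frechet_derivative f (at x) c)"
    and "(\<integral>x. frechet_derivative f (at x) c \<partial>lborel) = 0"
proof -
  let ?g = "\<lambda>x. frechet_derivative f (at x) c"
  have f1: "Ck_on (Suc 0) UNIV f" using f by simp
  have contf: "continuous_on UNIV f" using Ck_on_imp_continuous_on[OF f] .
  have contg: "continuous_on UNIV ?g" using Ck_on_SucD(2)[OF f1] by simp
  have der: "(f has_derivative frechet_derivative f (at x)) (at x)" for x
    using Ck_on_SucD(1)[OF f1] by simp
  have gz: "?g x = 0" if "x \<notin> C" for x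
  proof -
    have "(f has_derivative (\<lambda>_. 0)) (at x)"
      by (rule has_derivative_transform_within_open[of "\<lambda>_. 0" _ _ _ "- C"])
        (use that z C in \<open>auto simp: compact_imp_closed\<close>)
    then show ?thesis by (simp add: frechet_derivative_eqI)
  qed
  show "integrable lborel ?g" by (rule integrable_compact_support[OF contg C gz])
  have intf: "integrable lborel f" by (rule integrable_compact_support[OF contf C z])
  \<comment> \<open>Collects all points from which a step of at most \<open>c\<close> in direction
    \<open>c\<close> reaches \<open>C\<close>; this compact set contains the supports of all the
    difference quotients and yields an integrable dominating function.\<close>
  define C' where "C' = (\<lambda>(x, s). x - s *\<^sub>R c) ` (C \<times> {0..1::real})"
  have C': "compact C'"
    unfolding C'_def by (intro compact_continuous_image compact_Times C compact_Icc)
      (auto simp: case_prod_beta intro!: continuous_intros)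
  obtain K where K: "\<And>x. \<bar>?g x\<bar> \<le> K"
  proof -
    have "compact (?g ` C)" by (intro compact_continuous_image continuous_on_subset[OF contg] C) auto
    then obtain K where "\<forall>y\<in>?g ` C. norm y \<le> K" using compact_imp_bounded bounded_iff by metis
    then have "\<bar>?g x\<bar> \<le> max K 0" for x using gz[of x] by (cases "x \<in> C") (auto simp: max_def)
    then show ?thesis using that by blast
  qed
  define q where "q n x = real (Suc n) * (f (inverse (real (Suc n)) *\<^sub>R c + x) - f x)" for n x
  have q0: "(\<integral>x. q n x \<partial>lborel) = 0" for n
    unfolding q_def by (simp add: integral_translate[OF intf] intf)
  have line: "((\<lambda>s. f (s *\<^sub>R c + x)) has_real_derivative ?g (s *\<^sub>R c + x)) (at s)" for s x
    using has_real_derivative_along_line[OF der, of x c s] by (simp add: add.commute)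
  have qb: "\<bar>q n x\<bar> \<le> indicator C' x * K" for n x
  proof -
    let ?t = "inverse (real (Suc n))"
    have t: "0 < ?t" "?t \<le> 1" by (auto simp: inverse_eq_divide)
    obtain s where s: "0 < s" "s < ?t" "f (?t *\<^sub>R c + x) - f (0 *\<^sub>R c + x) = (?t - 0) * ?g (s *\<^sub>R c + x)"
      using MVT2[OF t(1), of "\<lambda>s. f (s *\<^sub>R c + x)" "\<lambda>s. ?g (s *\<^sub>R c + x)"] line by blast
    then have "q n x = ?g (s *\<^sub>R c + x)" by (simp add: q_def)
    moreover have "x \<in> C'" if "s *\<^sub>R c + x \<in> C"
      unfolding C'_def by (rule image_eqI[of _ _ "(s *\<^sub>R c + x, s)"]) (use that s t in auto)
    ultimately show ?thesis using K[of "s *\<^sub>R c + x"] gz[of "s *\<^sub>R c + x"]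
      by (cases "x \<in> C'") auto
  qed
  have lim: "(\<lambda>n. q n x) \<longlonglongrightarrow> ?g x" for x
  proof -
    have "((\<lambda>s. (f (s *\<^sub>R c + x) - f x) / s) \<longlongrightarrow> ?g x) (at 0)"
      using line[of x 0] by (simp add: has_field_derivative_iff)
    moreover have "filterlim (\<lambda>n. inverse (real (Suc n))) (at 0) sequentially"
      unfolding filterlim_at using LIMSEQ_inverse_real_of_nat by auto
    ultimately have "(\<lambda>n. (f (inverse (real (Suc n)) *\<^sub>R c + x) - f x) / inverse (real (Suc n))) \<longlonglongrightarrow> ?g x"
      by (rule filterlim_compose)
    then show ?thesis by (simp add: q_def divide_inverse mult.commute)
  qed
  have "(\<lambda>n. \<integral>x. q n x \<partial>lborel) \<longlonglongrightarrow> (\<integral>x. ?g x \<partial>lborel)"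
  proof (rule integral_dominated_convergence[where w = "\<lambda>x. indicator C' x * K"])
    show "integrable lborel (\<lambda>x. indicator C' x * K)"
      using borel_integrable_compact[OF C', of "\<lambda>_. K"] by simp
    show "?g \<in> borel_measurable lborel" using contg by (simp add: borel_measurable_continuous_onI)
    show "q n \<in> borel_measurable lborel" for n
      unfolding q_def using integral_translate(1)[OF intf] intf by (intro borel_measurable_times borel_measurable_diff) auto
  qed (use lim qb in auto)
  then show "(\<integral>x. ?g x \<partial>lborel) = 0" by (simp add: q0 LIMSEQ_const_iff)
qed

definition divergence :: "('a::euclidean_space \<Rightarrow> 'a) \<Rightarrow> 'a \<Rightarrow> real" where
  "divergence V x = (\<Sum>c\<in>Basis. frechet_derivative V (at x) c \<bullet> c)"

lemma integral_divergence_compact_support: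
  fixes V :: "'a::euclidean_space \<Rightarrow> 'a"
  assumes V: "Ck_on 1 UNIV V" and C: "compact C" and z: "\<And>x. x \<notin> C \<Longrightarrow> V x = 0"
  shows "integrable lborel (divergence V)" and "(\<integral>x. divergence V x \<partial>lborel) = 0"
proof -
  have d: "V differentiable (at x)" for x using V by simp
  have e: "divergence V = (\<lambda>x. \<Sum>c\<in>Basis. frechet_derivative (\<lambda>y. V y \<bullet> c) (at x) c)"
    by (simp add: fun_eq_iff divergence_def frechet_derivative_inner_const d)
  have 1: "Ck_on 1 UNIV (\<lambda>y. V y \<bullet> c)" for c using V by (intro Ck_on_inner Ck_on_const) auto
  show "integrable lborel (divergence V)"
    unfolding e by (intro Bochner_Integration.integrable_sum integral_derivative_compact_support[OF 1 C]) (simp add: z)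
  show "(\<integral>x. divergence V x \<partial>lborel) = 0"
    unfolding e by (subst Bochner_Integration.integral_sum) (auto intro!: sum.neutral integral_derivative_compact_support[OF 1 C] simp: z)
qed

text \<open>The set where \<open>f\<close> is nonzero is open and Lebesgue null, hence
  empty.\<close>

lemma continuous_nonneg_integral_0:
  fixes f :: "'a::euclidean_space \<Rightarrow> real"
  assumes "continuous_on UNIV f" "\<And>x. 0 \<le> f x" "integrable lborel f" "(\<integral>x. f x \<partial>lborel) \<le> 0"
  shows "f x = 0"
proof (rule ccontr)
  assume "f x \<noteq> 0"
  have "(\<integral>x. f x \<partial>lborel) = 0"
    using assms by (intro antisym integral_nonneg_AE) auto
  then have "AE x in lborel. f x = 0"
    using integral_nonneg_eq_0_iff_AE[OF assms(3)] assms(2) by simp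
  moreover have o: "open {x. f x \<noteq> 0}"
    using assms(1) open_Collect_neq[OF assms(1) continuous_on_const] by simp
  ultimately have "{x. f x \<noteq> 0} \<in> null_sets lborel"
    using AE_iff_null[of lborel "\<lambda>x. f x = 0"] by simp
  then have "negligible {x. f x \<noteq> 0}"
    by (simp add: negligible_iff_null_sets null_sets_completionI)
  then show False using \<open>f x \<noteq> 0\<close> o open_not_negligible by blast
qed


section \<open>Newton tensors\<close>

definition optrace :: "('a::euclidean_space \<Rightarrow> 'a) \<Rightarrow> real" where
  "optrace A = (\<Sum>b\<in>Basis. A b \<bullet> b)"

lemma optrace_comm:
  fixes A B :: "'a::euclidean_space \<Rightarrow> 'a"
  assumes "linear A" "linear B"
  shows "optrace (\<lambda>v. A (B v)) = optrace (\<lambda>v. B (A v))"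
proof -
  have e: "optrace (\<lambda>v. A (B v)) = (\<Sum>b\<in>Basis. \<Sum>c\<in>Basis. (B b \<bullet> c) * (A c \<bullet> b))"
    if "linear A" "linear B" for A B :: "'a \<Rightarrow> 'a"
    unfolding optrace_def
    by (subst linear_Basis_expand[OF that(1)]) (simp add: inner_sum_left)
  show ?thesis
    unfolding e[OF assms] e[OF assms(2,1)] by (subst sum.swap) (simp add: mult.commute)
qed

lemma optrace_sum: "optrace (\<lambda>v. \<Sum>i\<in>I. c i *\<^sub>R F i v) = (\<Sum>i\<in>I. c i * optrace (F i))"
  unfolding optrace_def by (simp add: inner_sum_left sum_distrib_left) (rule sum.swap)

lemma linear_funpow: "linear A \<Longrightarrow> linear (A ^^ i)" for A :: "'a::real_vector \<Rightarrow> 'a"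
  by (induction i) (use linear_compose[of _ A] in \<open>auto simp: linear_id\<close>)

lemma funpow_symmetric:
  assumes "\<And>v w. A v \<bullet> w = v \<bullet> A w"
  shows "(A ^^ i) v \<bullet> w = v \<bullet> (A ^^ i) w"
  by (induction i arbitrary: v w) (auto simp: assms funpow_swap1)

text \<open>The elementary symmetric functions of the eigenvalues, by Newton's identities from the
  power sums; unlike the eigenvalues, they depend smoothly on the operator.\<close>

fun nsym :: "nat \<Rightarrow> ('a::euclidean_space \<Rightarrow> 'a) \<Rightarrow> real" where
  "nsym 0 A = 1"
| "nsym (Suc m) A = (\<Sum>i\<le>m. (-1) ^ i * nsym (m - i) A * optrace (A ^^ Suc i)) / real (Suc m)"

declare nsym.simps(2) [simp del]

text \<open>The gradient of \<open>nsym (Suc m)\<close> at \<open>A\<close> for the trace pairing,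
  by \<open>nsym_has_derivative\<close>.\<close>

definition newton_tensor :: "nat \<Rightarrow> ('a::euclidean_space \<Rightarrow> 'a) \<Rightarrow> 'a \<Rightarrow> 'a" where
  "newton_tensor m A v = (\<Sum>i\<le>m. ((-1) ^ i * nsym (m - i) A) *\<^sub>R (A ^^ i) v)"

lemma newton_tensor_0 [simp]: "newton_tensor 0 A v = v"
  by (simp add: newton_tensor_def)

lemma newton_tensor_Suc:
  assumes "linear A"
  shows "newton_tensor (Suc m) A v = nsym (Suc m) A *\<^sub>R v - A (newton_tensor m A v)"
  unfolding newton_tensor_def sum.atMost_Suc_shift
  by (simp add: linear_sum[OF assms] linear_scale[OF assms] sum_negf)

lemma linear_newton_tensor: "linear A \<Longrightarrow> linear (newton_tensor m A)"
  unfolding newton_tensor_def[abs_def]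
  by (intro linear_compose_sum ballI linear_compose_scale_right linear_funpow)

lemma newton_tensor_symmetric:
  assumes "\<And>v w. A v \<bullet> w = v \<bullet> A w"
  shows "newton_tensor m A v \<bullet> w = v \<bullet> newton_tensor m A w"
  unfolding newton_tensor_def inner_sum_left inner_sum_right
  by (simp add: funpow_symmetric[OF assms])

lemma newton_tensor_commute:
  assumes "linear A"
  shows "newton_tensor m A (A v) = A (newton_tensor m A v)"
  unfolding newton_tensor_def
  by (simp add: linear_sum[OF assms] linear_scale[OF assms] funpow_swap1)

text \<open>With \<open>nsym\<close> built from power sums, this trace identity is its defining
  recursion.\<close>

lemma optrace_newton_tensor_mult:
  assumes "linear A"
  shows "optrace (\<lambda>v. newton_tensor m A (A v)) = real (Suc m) * nsym (Suc m) A"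
proof -
  have "optrace (\<lambda>v. newton_tensor m A (A v)) = (\<Sum>i\<le>m. ((-1) ^ i * nsym (m - i) A) * optrace (A ^^ Suc i))"
    unfolding newton_tensor_def optrace_sum by (simp add: funpow_swap1 optrace_def)
  then show ?thesis by (simp add: nsym.simps(2))
qed

lemma optrace_newton_tensor:
  fixes A :: "'a::euclidean_space \<Rightarrow> 'a"
  assumes "linear A"
  shows "optrace (newton_tensor m A) = (real (DIM('a)) - real m) * nsym m A"
proof (cases m)
  case 0
  then show ?thesis by (simp add: optrace_def)
next
  case (Suc k)
  have "optrace (newton_tensor m A) = real (DIM('a)) * nsym m A - optrace (\<lambda>v. newton_tensor k A (A v))"
    unfolding Suc optrace_def newton_tensor_Suc[OF assms] newton_tensor_commute[OF assms]
    by (simp add: inner_diff_left sum_subtractf)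
  then show ?thesis
    unfolding optrace_newton_tensor_mult[OF assms] using Suc by (simp add: algebra_simps)
qed

text \<open>Applied to the radial direction, which the Hessian of the support function
  annihilates.\<close>

lemma newton_tensor_kernel:
  assumes "linear A" "A v = 0"
  shows "newton_tensor m A v = nsym m A *\<^sub>R v"
  by (cases m) (auto simp: newton_tensor_Suc[OF assms(1)] newton_tensor_commute[OF assms(1), symmetric]
      assms(2) linear_0[OF linear_newton_tensor[OF assms(1)]])

text \<open>A product rule for operator fields that are differentiated on fixed vectors only: the
  moving argument is expanded in \<open>Basis\<close>, and uniqueness of derivatives makes
  \<open>D c\<close> linear.\<close>

lemma has_derivative_operator_apply:
  fixes A :: "'p::real_normed_vector \<Rightarrow> 'a::euclidean_space \<Rightarrow> 'b::real_normed_vector"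
  assumes S: "open S" "x \<in> S" and lin: "\<And>y. y \<in> S \<Longrightarrow> linear (A y)"
    and A: "\<And>v. ((\<lambda>y. A y v) has_derivative (\<lambda>c. D c v)) (at x)"
    and f: "(f has_derivative f') (at x)"
  shows "((\<lambda>y. A y (f y)) has_derivative (\<lambda>c. D c (f x) + A x (f' c))) (at x)"
proof -
  have linD: "linear (D c)" for c
  proof (rule linearI)
    fix a b :: 'a and r :: real
    have "((\<lambda>y. A y (a + b)) has_derivative (\<lambda>c. D c a + D c b)) (at x)"
      by (rule has_derivative_transform_within_open[OF has_derivative_add[OF A A] S])
        (simp add: lin linear_add)
    then show "D c (a + b) = D c a + D c b"
      using has_derivative_unique[OF A] by metis
    have "((\<lambda>y. A y (r *\<^sub>R a)) has_derivative (\<lambda>c. r *\<^sub>R D c a)) (at x)"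
      by (rule has_derivative_transform_within_open[OF has_derivative_scaleR_right[OF A] S])
        (simp add: lin linear_scale)
    then show "D c (r *\<^sub>R a) = r *\<^sub>R D c a"
      using has_derivative_unique[OF A] by metis
  qed
  have "((\<lambda>y. \<Sum>b\<in>Basis. (f y \<bullet> b) *\<^sub>R A y b) has_derivative
     (\<lambda>c. \<Sum>b\<in>Basis. (f x \<bullet> b) *\<^sub>R D c b + (f' c \<bullet> b) *\<^sub>R A x b)) (at x)"
    by (intro has_derivative_sum has_derivative_scaleR has_derivative_inner_left f A)
  then have "((\<lambda>y. \<Sum>b\<in>Basis. (f y \<bullet> b) *\<^sub>R A y b) has_derivative (\<lambda>c. D c (f x) + A x (f' c))) (at x)"
    unfolding sum.distrib linear_Basis_expand[OF linD, symmetric]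
      linear_Basis_expand[OF lin[OF S(2)], symmetric] .
  then show ?thesis
    by (rule has_derivative_transform_within_open[OF _ S])
      (simp add: linear_Basis_expand[OF lin, symmetric])
qed

lemma sum_triangle_swap:
  fixes f :: "nat \<Rightarrow> nat \<Rightarrow> 'b::comm_monoid_add"
  shows "(\<Sum>i<m. \<Sum>j<m - i. f i j) = (\<Sum>j<m. \<Sum>i<m - j. f i j)"
proof -
  have "(\<Sum>i<m. \<Sum>j<m - i. f i j) = (\<Sum>i<m. \<Sum>j<m. if i + j < m then f i j else 0)"
    by (intro sum.cong refl sum.mono_neutral_cong_left) auto
  also have "\<dots> = (\<Sum>j<m. \<Sum>i<m. if i + j < m then f i j else 0)" by (rule sum.swap)
  also have "\<dots> = (\<Sum>j<m. \<Sum>i<m - j. f i j)"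
    by (intro sum.cong refl sum.mono_neutral_cong_right) auto
  finally show ?thesis .
qed

section \<open>Derivatives of powers, power sums and symmetric functions of an operator\<close>

context
  fixes A :: "'p::real_normed_vector \<Rightarrow> 'a::euclidean_space \<Rightarrow> 'a" and S x D
  assumes S: "open S" "x \<in> S" and lin: "\<And>y. y \<in> S \<Longrightarrow> linear (A y)"
    and A: "\<And>v. ((\<lambda>y. A y v) has_derivative (\<lambda>c. D c v)) (at x)"
    and linD: "\<And>c. linear (D c)"
begin

text \<open>The derivative of a power is a sum of noncommuting products. Under the trace against a
  power of \<open>A x\<close> cyclicity makes all its terms equal, so \<open>P\<close> is described
  through these traces. For \<open>i = 0\<close> the truncated exponent is multiplied by
  zero.\<close>

lemma funpow_has_derivative:
  "\<exists>P. (\<forall>v. ((\<lambda>y. (A y ^^ i) v) has_derivative (\<lambda>c. P c v)) (at x)) \<and> (\<forall>c. linear (P c)) \<and>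
    (\<forall>c s. optrace (\<lambda>v. (A x ^^ s) (P c v)) = real i * optrace (\<lambda>v. (A x ^^ (s + i - 1)) (D c v)))"
proof (induction i)
  case 0
  have "linear (\<lambda>v::'a. 0::'a)" by (simp add: linear_iff)
  then show ?case
    by (intro exI[of _ "\<lambda>_ _. 0"]) (auto simp: optrace_def linear_0[OF linear_funpow[OF lin[OF S(2)]]])
next
  case (Suc i)
  then obtain P where P: "\<And>v. ((\<lambda>y. (A y ^^ i) v) has_derivative (\<lambda>c. P c v)) (at x)" "\<And>c. linear (P c)"
    "\<And>c s. optrace (\<lambda>v. (A x ^^ s) (P c v)) = real i * optrace (\<lambda>v. (A x ^^ (s + i - 1)) (D c v))"
    by blast
  have lA: "linear (A x ^^ s)" for s using linear_funpow[OF lin[OF S(2)]] .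
  let ?P = "\<lambda>c v. D c ((A x ^^ i) v) + A x (P c v)"
  have "((\<lambda>y. (A y ^^ Suc i) v) has_derivative (\<lambda>c. ?P c v)) (at x)" for v
    using has_derivative_operator_apply[OF S lin A P(1)] by simp
  moreover have "linear (?P c)" for c
    using linear_compose[OF lA linD] linear_compose[OF P(2) lin[OF S(2)]]
    by (intro linear_compose_add) (auto simp: o_def)
  moreover have "optrace (\<lambda>v. (A x ^^ s) (?P c v)) = real (Suc i) * optrace (\<lambda>v. (A x ^^ (s + Suc i - 1)) (D c v))" for c s
  proof -
    have "optrace (\<lambda>v. (A x ^^ s) (?P c v))
      = optrace (\<lambda>v. (A x ^^ s) (D c ((A x ^^ i) v))) + optrace (\<lambda>v. (A x ^^ Suc s) (P c v))"
      unfolding optrace_def by (simp add: linear_add[OF lA] inner_add_left sum.distrib funpow_swap1)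
    also have "optrace (\<lambda>v. (A x ^^ s) (D c ((A x ^^ i) v))) = optrace (\<lambda>v. (A x ^^ i) ((A x ^^ s) (D c v)))"
      using optrace_comm[of "\<lambda>v. (A x ^^ s) (D c v)" "A x ^^ i"] linear_compose[OF linD lA] lA by (simp add: o_def)
    moreover have "(A x ^^ i) ((A x ^^ s) u) = (A x ^^ (s + i)) u" for u
      by (simp add: funpow_add add.commute[of s])
    ultimately show ?thesis unfolding P(3) by (simp add: distrib_right)
  qed
  ultimately show ?case by (intro exI[of _ ?P]) simp
qed

lemma psum_has_derivative:
  "((\<lambda>y. optrace (A y ^^ Suc i)) has_derivative
    (\<lambda>c. real (Suc i) * optrace (\<lambda>v. (A x ^^ i) (D c v)))) (at x)"
proof -
  obtain P where P: "\<And>v. ((\<lambda>y. (A y ^^ Suc i) v) has_derivative (\<lambda>c. P c v)) (at x)"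
    "\<And>c s. optrace (\<lambda>v. (A x ^^ s) (P c v)) = real (Suc i) * optrace (\<lambda>v. (A x ^^ (s + Suc i - 1)) (D c v))"
    using funpow_has_derivative[of "Suc i"] by blast
  have "((\<lambda>y. optrace (A y ^^ Suc i)) has_derivative (\<lambda>c. optrace (P c))) (at x)"
    unfolding optrace_def by (intro has_derivative_sum has_derivative_inner_left P)
  then show ?thesis using P(2)[of 0] by simp
qed

text \<open>Differentiates Newton's identity by strong induction. After the triangular double sum is
  swapped, its inner sum is a Newton identity of lower order, and the coefficients
  \<open>k - i\<close> and \<open>i + 1\<close> add up to \<open>k + 1\<close>.\<close>

lemma nsym_has_derivative:
  "((\<lambda>y. nsym m (A y)) has_derivative
    (\<lambda>c. case m of 0 \<Rightarrow> 0 | Suc k \<Rightarrow> optrace (\<lambda>v. newton_tensor k (A x) (D c v)))) (at x)"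
proof (induction m rule: less_induct)
  case (less m)
  show ?case
  proof (cases m)
    case 0
    then show ?thesis by simp
  next
    case (Suc k)
    let ?e = "\<lambda>i. nsym i (A x)" and ?p = "\<lambda>i. optrace (A x ^^ Suc i)"
    let ?q = "\<lambda>i c. optrace (\<lambda>v. (A x ^^ i) (D c v))"
    let ?G = "\<lambda>m c. \<Sum>i\<le>m. (-1) ^ i * ?e (m - i) * ?q i c"
    let ?d = "\<lambda>m c. case m of 0 \<Rightarrow> 0 | Suc k \<Rightarrow> ?G k c"
    have G: "optrace (\<lambda>v. newton_tensor m (A x) (D c v)) = ?G m c" for m c
      unfolding newton_tensor_def optrace_sum by simp
    have IH: "((\<lambda>y. nsym i (A y)) has_derivative ?d i) (at x)" if "i < m" for i
      using less.IH[OF that] unfolding G .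
    have newt: "(\<Sum>i\<le>m. (-1) ^ i * ?e (m - i) * ?p i) = real (Suc m) * ?e (Suc m)" for m
      by (simp add: nsym.simps(2))
    have eq: "(\<Sum>i\<le>k. (-1) ^ i * (?d (k - i) c * ?p i + ?e (k - i) * (real (Suc i) * ?q i c))) = real (Suc k) * ?G k c" for c
    proof -
      \<comment> \<open>The term \<open>i = k\<close> drops out because \<open>nsym 0\<close> is
        constant.\<close>
      have "(\<Sum>i\<le>k. (-1) ^ i * (?d (k - i) c * ?p i)) = (\<Sum>i<k. (-1) ^ i * (?G (k - Suc i) c * ?p i))"
        unfolding lessThan_Suc_atMost[symmetric] by (simp add: Suc_diff_Suc[symmetric] cong: sum.cong_simp)
      also have "\<dots> = (\<Sum>i<k. \<Sum>s<k - i. (-1) ^ s * ?q s c * ((-1) ^ i * ?e (k - Suc (i + s)) * ?p i))"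
      proof (intro sum.cong refl)
        fix i assume "i \<in> {..<k}"
        then have "{..k - Suc i} = {..<k - i}" by auto
        then show "(-1) ^ i * (?G (k - Suc i) c * ?p i) = (\<Sum>s<k - i. (-1) ^ s * ?q s c * ((-1) ^ i * ?e (k - Suc (i + s)) * ?p i))"
          by (simp add: sum_distrib_left sum_distrib_right mult_ac)
      qed
      also have "\<dots> = (\<Sum>s<k. \<Sum>i<k - s. (-1) ^ s * ?q s c * ((-1) ^ i * ?e (k - Suc (i + s)) * ?p i))"
        by (rule sum_triangle_swap)
      also have "\<dots> = (\<Sum>s<k. (-1) ^ s * ?q s c * (real (k - s) * ?e (k - s)))"
      proof (intro sum.cong refl)
        fix s assume s: "s \<in> {..<k}"
        then have "{..<k - s} = {..k - Suc s}" by auto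
        then have "(\<Sum>i<k - s. (-1) ^ i * ?e (k - Suc (i + s)) * ?p i) = (\<Sum>i\<le>k - Suc s. (-1) ^ i * ?e (k - Suc s - i) * ?p i)"
          by (simp add: add.commute)
        also have "\<dots> = real (Suc (k - Suc s)) * ?e (Suc (k - Suc s))" by (rule newt)
        also have "Suc (k - Suc s) = k - s" using s by auto
        finally show "(\<Sum>i<k - s. (-1) ^ s * ?q s c * ((-1) ^ i * ?e (k - Suc (i + s)) * ?p i))
          = (-1) ^ s * ?q s c * (real (k - s) * ?e (k - s))"
          by (simp only: sum_distrib_left[symmetric])
      qed
      \<comment> \<open>The added term \<open>s = k\<close> carries the factor
        \<open>k - s = 0\<close>.\<close>
      also have "\<dots> = (\<Sum>s\<le>k. (-1) ^ s * ?q s c * (real (k - s) * ?e (k - s)))"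
        unfolding lessThan_Suc_atMost[symmetric] by simp
      finally have 1: "(\<Sum>i\<le>k. (-1) ^ i * (?d (k - i) c * ?p i))
        = (\<Sum>s\<le>k. (-1) ^ s * ?q s c * (real (k - s) * ?e (k - s)))" .
      have "(\<Sum>i\<le>k. (-1) ^ i * (?d (k - i) c * ?p i + ?e (k - i) * (real (Suc i) * ?q i c)))
        = (\<Sum>i\<le>k. (-1) ^ i * (?d (k - i) c * ?p i)) + (\<Sum>i\<le>k. (-1) ^ i * (?e (k - i) * (real (Suc i) * ?q i c)))"
        by (simp add: distrib_left sum.distrib)
      also have "\<dots> = (\<Sum>i\<le>k. (-1) ^ i * ?q i c * (real (k - i) * ?e (k - i)) + (-1) ^ i * (?e (k - i) * (real (Suc i) * ?q i c)))"
        unfolding 1 by (simp add: sum.distrib)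
      also have "\<dots> = (\<Sum>i\<le>k. real (Suc k) * ((-1) ^ i * ?e (k - i) * ?q i c))"
        by (intro sum.cong refl) (auto simp: of_nat_diff algebra_simps)
      finally show ?thesis by (simp add: sum_distrib_left)
    qed
    have "((\<lambda>y. \<Sum>i\<le>k. (-1) ^ i * (nsym (k - i) (A y) * optrace (A y ^^ Suc i))) has_derivative
      (\<lambda>c. \<Sum>i\<le>k. (-1) ^ i * (?e (k - i) * (real (Suc i) * ?q i c) + ?d (k - i) c * ?p i))) (at x)"
      by (intro has_derivative_sum has_derivative_mult_right has_derivative_mult IH psum_has_derivative) (simp add: Suc)
    then have h: "((\<lambda>y. \<Sum>i\<le>k. (-1) ^ i * (nsym (k - i) (A y) * optrace (A y ^^ Suc i))) has_derivative
      (\<lambda>c. real (Suc k) * ?G k c)) (at x)"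
      unfolding eq[symmetric] by (simp only: add.commute)
    have "((\<lambda>y. inverse (real (Suc k)) * (\<Sum>i\<le>k. (-1) ^ i * (nsym (k - i) (A y) * optrace (A y ^^ Suc i)))) has_derivative ?G k) (at x)"
      by (rule has_derivative_eq_rhs[OF has_derivative_mult_right[OF h]]) (simp add: fun_eq_iff del: of_nat_Suc)
    then show ?thesis unfolding Suc nsym.simps(2) nat.case G
      by (simp only: divide_inverse mult.assoc mult.commute[of _ "inverse _"])
  qed
qed

end

text \<open>Induction along \<open>newton_tensor_Suc\<close>. Differentiating
  \<open>nsym (Suc m)\<close> gives the trace of \<open>T\<close> composed with the derivative of
  \<open>A\<close>; the Codazzi symmetry turns the term in which \<open>A\<close> itself is
  differentiated into the same trace. What remains is \<open>A x\<close> applied to the divergence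
  of order \<open>m\<close>.\<close>

lemma newton_tensor_divergence_free:
  fixes A :: "'a::euclidean_space \<Rightarrow> 'a \<Rightarrow> 'a"
  assumes S: "open S" "x \<in> S" and lin: "\<And>y. y \<in> S \<Longrightarrow> linear (A y)"
    and sym: "\<And>v w. A x v \<bullet> w = v \<bullet> A x w"
    and A: "\<And>v. ((\<lambda>y. A y v) has_derivative (\<lambda>c. D c v)) (at x)"
    and linD: "\<And>c. linear (D c)" and symD: "\<And>c v w. D c v \<bullet> w = v \<bullet> D c w"
    and codazzi: "\<And>c v. D c v = D v c"
  shows "\<exists>P. (\<forall>v. ((\<lambda>y. newton_tensor m (A y) v) has_derivative (\<lambda>c. P c v)) (at x)) \<and>
    (\<Sum>c\<in>Basis. P c c) = 0"
proof (induction m)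
  case 0
  then show ?case by (intro exI[of _ "\<lambda>_ _. 0"]) auto
next
  case (Suc m)
  then obtain P where P: "\<And>v. ((\<lambda>y. newton_tensor m (A y) v) has_derivative (\<lambda>c. P c v)) (at x)"
    "(\<Sum>c\<in>Basis. P c c) = 0" by blast
  let ?T = "newton_tensor m (A x)"
  let ?g = "\<lambda>c. optrace (\<lambda>v. ?T (D c v))"
  let ?P = "\<lambda>c v. ?g c *\<^sub>R v - (D c (?T v) + A x (P c v))"
  have linA: "linear (A x)" using lin S by blast
  have "((\<lambda>y. nsym (Suc m) (A y) *\<^sub>R v - A y (newton_tensor m (A y) v)) has_derivative (\<lambda>c. ?P c v)) (at x)" for v
    using nsym_has_derivative[OF S lin A linD, of "Suc m"]
    by (intro has_derivative_diff has_derivative_scaleR_left has_derivative_operator_apply[OF S lin A P(1)]) simp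
  then have "((\<lambda>y. newton_tensor (Suc m) (A y) v) has_derivative (\<lambda>c. ?P c v)) (at x)" for v
    by (rule has_derivative_transform_within_open[OF _ S]) (simp add: newton_tensor_Suc[OF lin])
  moreover have "(\<Sum>c\<in>Basis. ?P c c) = 0"
  proof (rule vector_eq_rdot[THEN iffD1], rule allI)
    fix w
    have "(\<Sum>c\<in>Basis. A x (P c c)) = 0"
      using P(2) linear_sum[OF linA, of "\<lambda>c. P c c" Basis] linear_0[OF linA] by simp
    moreover have "(\<Sum>c\<in>Basis. D c (?T c)) \<bullet> w = optrace (\<lambda>v. ?T (D w v))"
      unfolding inner_sum_left optrace_def
    proof (intro sum.cong refl)
      fix c :: 'a
      have "D c (?T c) \<bullet> w = ?T c \<bullet> D w c" using symD codazzi[of c w] by simp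
      then show "D c (?T c) \<bullet> w = ?T (D w c) \<bullet> c"
        using newton_tensor_symmetric[OF sym] by (metis inner_commute)
    qed
    moreover have "(\<Sum>c\<in>Basis. ?g c *\<^sub>R c) \<bullet> w = ?g w"
    proof -
      have linT: "linear ?T" using linear_newton_tensor[OF linA] .
      have lg: "linear ?g"
      proof (rule linearI)
        show "?g (a + b) = ?g a + ?g b" for a b
          unfolding optrace_def codazzi[of "a + b"] codazzi[of a] codazzi[of b]
          by (simp add: linear_add[OF linD] linear_add[OF linT] inner_add_left sum.distrib)
        show "?g (r *\<^sub>R a) = r *\<^sub>R ?g a" for a r
          unfolding optrace_def codazzi[of "r *\<^sub>R a"] codazzi[of a]
          by (simp add: linear_scale[OF linD] linear_scale[OF linT] sum_distrib_left)
      qed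
      show ?thesis
        using linear_Basis_expand[OF lg, of w]
        by (simp add: inner_sum_left inner_commute[of w] mult.commute)
    qed
    moreover have "(\<Sum>c\<in>Basis. ?P c c) = (\<Sum>c\<in>Basis. ?g c *\<^sub>R c) - ((\<Sum>c\<in>Basis. D c (?T c)) + (\<Sum>c\<in>Basis. A x (P c c)))"
      by (simp only: sum_subtractf sum.distrib)
    ultimately show "(\<Sum>c\<in>Basis. ?P c c) \<bullet> w = 0 \<bullet> w"
      by (simp only: inner_diff_left inner_add_left inner_zero_left)
  qed
  ultimately show ?case by (intro exI[of _ ?P]) blast
qed

text \<open>Symmetry moves the tensor from \<open>W\<close> onto a fixed test vector. The terms in
  which the tensor is differentiated then add up to the inner product of \<open>W x\<close> with its
  divergence, which vanishes.\<close>

lemma divergence_newton_tensor: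
  fixes A :: "'a::euclidean_space \<Rightarrow> 'a \<Rightarrow> 'a"
  assumes S: "open S" "x \<in> S" and lin: "\<And>y. y \<in> S \<Longrightarrow> linear (A y)"
    and sym: "\<And>y v w. y \<in> S \<Longrightarrow> A y v \<bullet> w = v \<bullet> A y w"
    and A: "\<And>v. ((\<lambda>y. A y v) has_derivative (\<lambda>c. D c v)) (at x)"
    and linD: "\<And>c. linear (D c)" and symD: "\<And>c v w. D c v \<bullet> w = v \<bullet> D c w"
    and codazzi: "\<And>c v. D c v = D v c"
    and W: "(W has_derivative W') (at x)"
    and V: "((\<lambda>y. newton_tensor m (A y) (W y)) has_derivative V') (at x)"
  shows "(\<Sum>c\<in>Basis. V' c \<bullet> c) = (\<Sum>c\<in>Basis. W' c \<bullet> newton_tensor m (A x) c)"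
proof -
  obtain P where P: "\<And>v. ((\<lambda>y. newton_tensor m (A y) v) has_derivative (\<lambda>c. P c v)) (at x)"
    "(\<Sum>c\<in>Basis. P c c) = 0"
    using newton_tensor_divergence_free[OF S lin sym[OF S(2)] A linD symD codazzi, of m] by blast
  have "V' c \<bullet> b = W' c \<bullet> newton_tensor m (A x) b + W x \<bullet> P c b" for c b
  proof -
    have "((\<lambda>y. W y \<bullet> newton_tensor m (A y) b) has_derivative
       (\<lambda>c. W x \<bullet> P c b + W' c \<bullet> newton_tensor m (A x) b)) (at x)"
      by (intro has_derivative_inner W P)
    then have "((\<lambda>y. newton_tensor m (A y) (W y) \<bullet> b) has_derivative
       (\<lambda>c. W x \<bullet> P c b + W' c \<bullet> newton_tensor m (A x) b)) (at x)"
      by (rule has_derivative_transform_within_open[OF _ S]) (simp add: newton_tensor_symmetric[OF sym])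
    moreover have "((\<lambda>y. newton_tensor m (A y) (W y) \<bullet> b) has_derivative (\<lambda>c. V' c \<bullet> b)) (at x)"
      by (intro has_derivative_inner_left V)
    ultimately have "(\<lambda>c. V' c \<bullet> b) = (\<lambda>c. W x \<bullet> P c b + W' c \<bullet> newton_tensor m (A x) b)"
      using has_derivative_unique by blast
    then show ?thesis by (metis add.commute)
  qed
  then have "(\<Sum>c\<in>Basis. V' c \<bullet> c) = (\<Sum>c\<in>Basis. W' c \<bullet> newton_tensor m (A x) c) + W x \<bullet> (\<Sum>c\<in>Basis. P c c)"
    by (simp add: sum.distrib inner_sum_right)
  then show ?thesis using P(2) by simp
qed


section \<open>Support functions on the whole space\<close>

declare Ck_on.simps [simp del]

lemma Ck_on_operator_apply:
  fixes A :: "'p::real_normed_vector \<Rightarrow> 'a::euclidean_space \<Rightarrow> 'b::real_normed_vector"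
  assumes "open S" "\<And>y. y \<in> S \<Longrightarrow> linear (A y)" "\<And>v. Ck_on k S (\<lambda>y. A y v)" "Ck_on k S f"
  shows "Ck_on k S (\<lambda>y. A y (f y))"
proof -
  have "Ck_on k S (\<lambda>y. \<Sum>b\<in>Basis. (f y \<bullet> b) *\<^sub>R A y b)"
    using assms by (intro Ck_on_sum Ck_on_scaleR Ck_on_inner Ck_on_const)
  then show ?thesis
    by (subst Ck_on_cong[OF assms(1)]) (auto simp: linear_Basis_expand[OF assms(2), symmetric])
qed

lemma Ck_on_funpow_apply:
  fixes A :: "'p::real_normed_vector \<Rightarrow> 'a::euclidean_space \<Rightarrow> 'a"
  assumes "open S" "\<And>y. y \<in> S \<Longrightarrow> linear (A y)" "\<And>v. Ck_on k S (\<lambda>y. A y v)"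
  shows "Ck_on k S (\<lambda>y. (A y ^^ i) v)"
proof (induction i)
  case 0
  then show ?case using Ck_on_const[OF assms(1)] by simp
next
  case (Suc i)
  then show ?case using Ck_on_operator_apply[OF assms] by simp
qed

lemma Ck_on_nsym:
  fixes A :: "'p::real_normed_vector \<Rightarrow> 'a::euclidean_space \<Rightarrow> 'a"
  assumes "open S" "\<And>y. y \<in> S \<Longrightarrow> linear (A y)" "\<And>v. Ck_on k S (\<lambda>y. A y v)"
  shows "Ck_on k S (\<lambda>y. nsym m (A y))"
proof (induction m rule: less_induct)
  case (less m)
  show ?case
  proof (cases m)
    case 0
    then show ?thesis by (simp add: Ck_on_const assms)
  next
    case (Suc n)
    have "Ck_on k S (\<lambda>y. optrace (A y ^^ Suc i))" for i
      unfolding optrace_def by (intro Ck_on_sum Ck_on_inner Ck_on_const Ck_on_funpow_apply assms)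
    then show ?thesis
      unfolding Suc nsym.simps(2) divide_inverse
      by (intro Ck_on_sum Ck_on_mult Ck_on_const less.IH assms) (auto simp: Suc)
  qed
qed

lemma Ck_on_newton_tensor:
  fixes A :: "'p::real_normed_vector \<Rightarrow> 'a::euclidean_space \<Rightarrow> 'a"
  assumes "open S" "\<And>y. y \<in> S \<Longrightarrow> linear (A y)" "\<And>v. Ck_on k S (\<lambda>y. A y v)" "Ck_on k S f"
  shows "Ck_on k S (\<lambda>y. newton_tensor m (A y) (f y))"
  unfolding newton_tensor_def
proof (intro Ck_on_sum Ck_on_scaleR Ck_on_mult Ck_on_const Ck_on_nsym assms)
  show "Ck_on k S (\<lambda>y. (A y ^^ i) (f y))" for i
    by (rule Ck_on_operator_apply[OF assms(1) linear_funpow[OF assms(2)] Ck_on_funpow_apply[OF assms(1-3)] assms(4)])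
qed

text \<open>The trace may be taken in the orthonormal basis \<open>insert z B\<close>; the
  eigenvalue zero at \<open>z\<close> contributes nothing to power sums of positive order, so
  Newton's identities see only the eigenvalues on \<open>B\<close>.\<close>

lemma nsym_eq_esym:
  fixes A :: "'a::euclidean_space \<Rightarrow> 'a"
  assumes lin: "linear A" and B: "orthonormal B" "span B = {v. v \<bullet> z = 0}" and z: "norm z = 1" "A z = 0"
    and f: "\<And>b. b \<in> B \<Longrightarrow> A b = f b *\<^sub>R b"
  shows "nsym m A = esym m f B"
proof -
  have fin: "finite B" using orthonormal_finite[OF B(1)] .
  have zz: "z \<bullet> z = 1" using z by (simp add: norm_eq_1)
  have Bz: "b \<bullet> z = 0" if "b \<in> B" for b using that B(2) span_base by blast
  have zB: "z \<notin> B" using Bz zz by auto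
  have on: "orthonormal (insert z B)" using B(1) Bz zz zB by (auto simp: orthonormal_def inner_commute)
  have sp: "span (insert z B) = UNIV"
  proof -
    have "v - (v \<bullet> z) *\<^sub>R z \<in> span B" for v
      unfolding B by (simp add: inner_diff_left zz)
    then show ?thesis unfolding span_insert by blast
  qed
  have tr: "optrace L = (\<Sum>b\<in>insert z B. L b \<bullet> b)" if L: "linear L" for L :: "'a \<Rightarrow> 'a"
  proof -
    have ex: "(\<Sum>b\<in>insert z B. (v \<bullet> b) *\<^sub>R b) = v" for v
      using orthonormal_expand[OF on] fin sp by simp
    have "optrace L = (\<Sum>c\<in>Basis. \<Sum>b\<in>insert z B. (c \<bullet> b) * (L b \<bullet> c))"
      unfolding optrace_def
    proof (intro sum.cong refl)
      fix c :: 'a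
      have "L c = (\<Sum>b\<in>insert z B. (c \<bullet> b) *\<^sub>R L b)"
        by (subst (1) ex[of c, symmetric]) (simp only: linear_sum[OF L] linear_scale[OF L])
      then show "L c \<bullet> c = (\<Sum>b\<in>insert z B. (c \<bullet> b) * (L b \<bullet> c))"
        by (simp only: inner_sum_left inner_scaleR_left)
    qed
    also have "\<dots> = (\<Sum>b\<in>insert z B. \<Sum>c\<in>Basis. (L b \<bullet> c) * (b \<bullet> c))"
      by (subst sum.swap) (simp add: inner_commute mult.commute)
    also have "\<dots> = (\<Sum>b\<in>insert z B. L b \<bullet> b)"
      by (simp only: euclidean_inner[symmetric])
    finally show ?thesis .
  qed
  have pw: "(A ^^ i) b = f b ^ i *\<^sub>R b" if "b \<in> B" for b i
    by (induction i) (auto simp: f[OF that] linear_scale[OF lin] mult.commute)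
  have pz: "(A ^^ Suc i) z = 0" for i
    by (simp add: funpow_swap1 z linear_0[OF linear_funpow[OF lin]])
  have ps: "optrace (A ^^ Suc i) = (\<Sum>b\<in>B. f b ^ Suc i)" for i
  proof -
    have "optrace (A ^^ Suc i) = (\<Sum>b\<in>B. (A ^^ Suc i) b \<bullet> b)"
      unfolding tr[OF linear_funpow[OF lin]] using fin zB pz[of i] by simp
    also have "\<dots> = (\<Sum>b\<in>B. f b ^ Suc i)"
    proof (intro sum.cong refl)
      fix b assume b: "b \<in> B"
      then have "b \<bullet> b = 1" using B(1) by (auto simp: orthonormal_def)
      then show "(A ^^ Suc i) b \<bullet> b = f b ^ Suc i"
        unfolding pw[OF b] by simp
    qed
    finally show ?thesis .
  qed
  show ?thesis
  proof (induction m rule: less_induct)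
    case (less m)
    show ?case
    proof (cases m)
      case 0
      then show ?thesis using fin by simp
    next
      case (Suc k)
      have "nsym m A = (\<Sum>i\<le>k. (-1) ^ i * esym (k - i) f B * (\<Sum>b\<in>B. f b ^ Suc i)) / real (Suc k)"
        unfolding Suc nsym.simps(2) ps by (intro arg_cong2[where f = "(/)"] sum.cong refl) (simp add: less.IH Suc)
      then show ?thesis unfolding newton_identity[OF fin] Suc by simp
    qed
  qed
qed

text \<open>On an eigenvector the alternating sum of powers collapses to the symmetric function of
  the remaining eigenvalues, which is the source of semidefiniteness.\<close>

lemma newton_tensor_eigenvector:
  assumes lin: "linear A" and B: "finite B" and f: "\<And>b. b \<in> B \<Longrightarrow> A b = f b *\<^sub>R b"
    and e: "\<And>m. nsym m A = esym m f B" and b: "b \<in> B"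
  shows "newton_tensor m A b = esym m f (B - {b}) *\<^sub>R b"
proof -
  have pw: "(A ^^ i) b = f b ^ i *\<^sub>R b" for i
    by (induction i) (auto simp: f[OF b] linear_scale[OF lin] mult.commute)
  show ?thesis
    unfolding newton_tensor_def pw scaleR_scaleR scaleR_sum_left[symmetric] e
    using esym_alternating_sum[OF B b, of m f] by simp
qed

lemma esym_scale: "esym m (\<lambda>b. c * f b) B = c ^ m * esym m f B"
  unfolding esym_def sum_distrib_left
  by (intro sum.cong refl) (auto simp: prod.distrib)

text \<open>Squaring makes the positive part continuously differentiable, the regularity that
  integration by parts asks of the cutoff.\<close>

lemma has_derivative_square_pos_part:
  "((\<lambda>s::real. (max 0 s)\<^sup>2) has_real_derivative 2 * max 0 s) (at s)"
proof (cases s "0::real" rule: linorder_cases)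
  case less
  have "((\<lambda>s::real. 0) has_real_derivative 0) (at s)" by simp
  then have "((\<lambda>s::real. (max 0 s)\<^sup>2) has_real_derivative 0) (at s)"
    by (rule has_field_derivative_transform_within_open[of _ _ _ "{..<0}"]) (use less in auto)
  then show ?thesis using less by simp
next
  case greater
  have "((\<lambda>s::real. s\<^sup>2) has_real_derivative 2 * s) (at s)"
    by (auto intro!: derivative_eq_intros)
  then have "((\<lambda>s::real. (max 0 s)\<^sup>2) has_real_derivative 2 * s) (at s)"
    by (rule has_field_derivative_transform_within_open[of _ _ _ "{0<..}"]) (use greater in auto)
  then show ?thesis using greater by simp
next
  case equal
  have "((\<lambda>h::real. ((max 0 h)\<^sup>2 - 0) / h) \<longlongrightarrow> 0) (at 0)"
  proof (rule Lim_null_comparison)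
    show "\<forall>\<^sub>F h in at (0::real). norm (((max 0 h)\<^sup>2 - 0) / h) \<le> \<bar>h\<bar>"
      by (intro always_eventually allI) (auto simp: max_def power2_eq_square)
    show "((\<lambda>h::real. \<bar>h\<bar>) \<longlongrightarrow> 0) (at 0)" by (intro tendsto_rabs_zero tendsto_ident_at)
  qed
  then show ?thesis using equal by (simp add: DERIV_def)
qed

text \<open>A cutoff in the variable \<open>x \<bullet> x\<close>, supported in the annulus \<open>1 \<le> norm x \<le> 2\<close>.\<close>

definition cutoff :: "real \<Rightarrow> real" where "cutoff s = (max 0 ((s - 1) * (4 - s)))\<^sup>2"

lemma Ck_on_cutoff: "Ck_on 1 UNIV cutoff"
proof -
  have "Ck_on (Suc 0) UNIV (\<lambda>s::real. (max 0 s)\<^sup>2)"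
  proof (rule Ck_on_SucI)
    show "((\<lambda>s::real. (max 0 s)\<^sup>2) has_derivative (\<lambda>h. (2 * max 0 s) * h)) (at s)" for s
      using has_derivative_square_pos_part[of s] by (simp add: has_field_derivative_def)
    show "Ck_on 0 UNIV (\<lambda>s::real. 2 * max 0 s * v)" for v
      by (auto intro!: continuous_intros simp: Ck_on.simps)
  qed auto
  then have q: "Ck_on 1 UNIV (\<lambda>s::real. (max 0 s)\<^sup>2)" by simp
  show ?thesis
    unfolding cutoff_def[abs_def]
    by (rule Ck_on_compose[OF _ _ _ q]) (auto intro!: Ck_on_mult Ck_on_diff Ck_on_const Ck_on_id)
qed

lemma cutoff_nonneg: "0 \<le> cutoff s" by (simp add: cutoff_def)

lemma cutoff_eq_0: "s \<le> 1 \<or> 4 \<le> s \<Longrightarrow> cutoff s = 0"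
proof -
  assume "s \<le> 1 \<or> 4 \<le> s"
  then have "(s - 1) * (4 - s) \<le> 0"
    by (intro mult_le_0_iff[THEN iffD2]) auto
  then show ?thesis unfolding cutoff_def by (simp add: max_absorb1)
qed

lemma cutoff_pos: "1 < s \<Longrightarrow> s < 4 \<Longrightarrow> 0 < cutoff s"
proof -
  assume s: "1 < s" "s < 4"
  then have "0 < (s - 1) * (4 - s)" by (intro mult_pos_pos) auto
  then show ?thesis unfolding cutoff_def using s by (simp add: max_absorb2)
qed

abbreviation punctured :: "'a::euclidean_space set" where "punctured \<equiv> - {0}"

lemma open_punctured: "open (punctured :: 'a::euclidean_space set)" by auto

text \<open>The data carried by a smooth strictly convex body: \<open>X x\<close> is its boundary point with outer
  normal direction \<open>x\<close>, and \<open>h\<close> is the support function on the whole space, with gradient \<open>X\<close>.\<close>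

locale gauss_inverse =
  fixes X :: "'a::euclidean_space \<Rightarrow> 'a" and h :: "'a \<Rightarrow> real"
  assumes X_C2: "Ck_on 2 punctured X"
    and h_eq: "\<And>x. x \<noteq> 0 \<Longrightarrow> h x = X x \<bullet> x"
    and h_deriv: "\<And>x. x \<noteq> 0 \<Longrightarrow> (h has_derivative (\<lambda>v. X x \<bullet> v)) (at x)"
    and X_scale: "\<And>c x. c > 0 \<Longrightarrow> X (c *\<^sub>R x) = X x"
    and h_pos: "\<And>x. x \<noteq> 0 \<Longrightarrow> 0 < h x"
    and hess_nonneg: "\<And>x v. x \<noteq> 0 \<Longrightarrow> 0 \<le> frechet_derivative X (at x) v \<bullet> v"
    and hess_inj: "\<And>x v. x \<noteq> 0 \<Longrightarrow> v \<bullet> x = 0 \<Longrightarrow> frechet_derivative X (at x) v = 0 \<Longrightarrow> v = 0"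
begin

definition A :: "'a \<Rightarrow> 'a \<Rightarrow> 'a" where "A x = frechet_derivative X (at x)"

text \<open>\<open>c\<close> is the direction of differentiation and \<open>v\<close> the argument
  of the operator, so \<open>D_codazzi\<close> is the symmetry of the second derivative of
  \<open>X\<close>.\<close>

definition D :: "'a \<Rightarrow> 'a \<Rightarrow> 'a \<Rightarrow> 'a" where "D x c v = frechet_derivative (\<lambda>y. A y v) (at x) c"

lemma X_C2': "Ck_on (Suc (Suc 0)) punctured X" using X_C2 by (simp only: numeral_2_eq_2)

lemma X_C1: "Ck_on 1 punctured X" by (rule Ck_on_le[OF X_C2]) simp

lemma A_C1: "Ck_on 1 punctured (\<lambda>x. A x v)"
  unfolding A_def using Ck_on_SucD(2)[OF X_C2'] by (simp only: One_nat_def)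

lemma X_deriv: "x \<noteq> 0 \<Longrightarrow> (X has_derivative A x) (at x)"
  unfolding A_def by (rule Ck_on_SucD(1)[OF X_C2']) simp

lemma A_linear: "x \<noteq> 0 \<Longrightarrow> linear (A x)"
  using has_derivative_linear[OF X_deriv] .

lemma A_deriv: "x \<noteq> 0 \<Longrightarrow> ((\<lambda>y. A y v) has_derivative (\<lambda>c. D x c v)) (at x)"
  unfolding D_def using Ck_on_SucD(1)[of 0 punctured "\<lambda>y. A y v" x] A_C1[of v] by simp

lemma h_C1: "Ck_on 1 punctured h"
  unfolding One_nat_def by (rule Ck_on_SucI[OF open_punctured h_deriv])
    (auto intro!: Ck_on_inner Ck_on_const intro: Ck_on_le[OF X_C2])

lemma h_C2: "Ck_on 2 punctured h"
  unfolding numeral_2_eq_2 One_nat_def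
  by (rule Ck_on_SucI[OF open_punctured h_deriv])
    (use X_C1 in \<open>auto intro!: Ck_on_inner Ck_on_const\<close>)

lemma A_symmetric:
  assumes "x \<noteq> 0"
  shows "A x v \<bullet> w = v \<bullet> A x w"
proof -
  have "frechet_derivative (\<lambda>y. frechet_derivative h (at y) v) (at x) w = A x w \<bullet> v" for v w
  proof -
    have "((\<lambda>y. X y \<bullet> v) has_derivative (\<lambda>w. A x w \<bullet> v)) (at x)"
      by (intro has_derivative_inner_left X_deriv assms)
    then have "((\<lambda>y. frechet_derivative h (at y) v) has_derivative (\<lambda>w. A x w \<bullet> v)) (at x)"
      by (rule has_derivative_transform_within_open[OF _ open_punctured])
        (use assms in \<open>auto simp: frechet_derivative_eqI[OF h_deriv]\<close>)
    then show ?thesis by (rule frechet_derivative_eqI)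
  qed
  then show ?thesis
    using second_derivative_symmetric_real[OF open_punctured _ h_C2, of x v w] assms
    by (simp add: inner_commute)
qed

lemma D_codazzi: "x \<noteq> 0 \<Longrightarrow> D x c v = D x v c"
  unfolding D_def A_def using second_derivative_symmetric[OF open_punctured _ X_C2, of x] by simp

lemma D_linear:
  assumes "x \<noteq> 0"
  shows "linear (D x c)"
proof -
  have "D x c = (\<lambda>v. D x v c)" using D_codazzi[OF assms] by blast
  then show ?thesis using has_derivative_linear[OF A_deriv[OF assms, of c]] by simp
qed

lemma D_symmetric:
  assumes "x \<noteq> 0"
  shows "D x c v \<bullet> w = v \<bullet> D x c w"
proof -
  have "((\<lambda>y. A y v \<bullet> w) has_derivative (\<lambda>c. D x c v \<bullet> w)) (at x)"
    by (intro has_derivative_inner_left A_deriv assms)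
  then have "((\<lambda>y. v \<bullet> A y w) has_derivative (\<lambda>c. D x c v \<bullet> w)) (at x)"
    by (rule has_derivative_transform_within_open[OF _ open_punctured]) (use assms A_symmetric in auto)
  moreover have "((\<lambda>y. v \<bullet> A y w) has_derivative (\<lambda>c. v \<bullet> D x c w)) (at x)"
    by (intro has_derivative_inner_right A_deriv assms)
  ultimately show ?thesis using has_derivative_unique by metis
qed

text \<open>Euler's relation in degree zero: \<open>f\<close> is constant along the ray through
  \<open>x\<close>.\<close>

lemma homogeneous_derivative_zero:
  fixes f :: "'a \<Rightarrow> real"
  assumes "(f has_derivative f') (at x)" "\<And>c. c > 0 \<Longrightarrow> f (c *\<^sub>R x) = f x"
  shows "f' x = 0"
proof -
  have "((\<lambda>s. f (x + s *\<^sub>R x)) has_real_derivative f' x) (at 0)"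
    by (rule has_real_derivative_along_line) (simp add: assms)
  moreover have "((\<lambda>s. f (x + s *\<^sub>R x)) has_real_derivative 0) (at 0)"
  proof (rule has_field_derivative_transform_within_open[of "\<lambda>_. f x" _ _ "{-1<..}"])
    fix s :: real assume "s \<in> {-1<..}"
    then show "f x = f (x + s *\<^sub>R x)" using assms(2)[of "1 + s"] by (simp add: scaleR_add_left)
  qed auto
  ultimately show ?thesis by (rule DERIV_unique)
qed

lemma A_radial: 
  assumes "x \<noteq> 0"
  shows "A x x = 0"
proof -
  have "A x x \<bullet> w = 0" for w
    by (rule homogeneous_derivative_zero[of "\<lambda>y. X y \<bullet> w" "\<lambda>v. A x v \<bullet> w"])
      (auto intro!: has_derivative_inner_left X_deriv assms simp: X_scale)
  then show ?thesis by (metis inner_eq_zero_iff)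
qed

lemma A_scale:
  assumes "x \<noteq> 0" "c > 0"
  shows "A (c *\<^sub>R x) v = (1 / c) *\<^sub>R A x v"
proof -
  have cx: "c *\<^sub>R x \<noteq> 0" using assms by simp
  have g: "((\<lambda>y. c *\<^sub>R y) has_derivative (\<lambda>v. c *\<^sub>R v)) (at x)" by (auto intro!: derivative_eq_intros)
  from has_derivative_compose[OF g X_deriv[OF cx]]
  have "((\<lambda>y. X (c *\<^sub>R y)) has_derivative (\<lambda>v. A (c *\<^sub>R x) (c *\<^sub>R v))) (at x)" .
  then have "(X has_derivative (\<lambda>v. A (c *\<^sub>R x) (c *\<^sub>R v))) (at x)"
    using assms by (simp add: X_scale)
  then have "A (c *\<^sub>R x) (c *\<^sub>R v) = A x v"
    using has_derivative_unique[OF X_deriv[OF assms(1)]] by metis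
  then have "c *\<^sub>R A (c *\<^sub>R x) v = A x v" by (simp add: linear_scale[OF A_linear[OF cx]])
  then have "(1 / c) *\<^sub>R (c *\<^sub>R A (c *\<^sub>R x) v) = (1 / c) *\<^sub>R A x v" by simp
  then show ?thesis using assms by simp
qed

lemma A_orthogonal: "x \<noteq> 0 \<Longrightarrow> A x v \<bullet> x = 0"
  using A_symmetric[of x v x] A_radial by simp

lemma X_nonzero: "x \<noteq> 0 \<Longrightarrow> X x \<noteq> 0"
  using h_pos[of x] h_eq[of x] by auto

text \<open>The spherical gradient of the support function, extended to the whole space.\<close>

definition w :: "'a \<Rightarrow> 'a" where "w x = X x - (h x / (x \<bullet> x)) *\<^sub>R x"

text \<open>While \<open>h\<close> has degree one, \<open>u\<close> is the extension of degree zero,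
  so its gradient is tangential to spheres about the origin.\<close>

definition u :: "'a \<Rightarrow> real" where "u x = h x / norm x"

lemma u_pos: "x \<noteq> 0 \<Longrightarrow> 0 < u x" using h_pos by (simp add: u_def)

lemma h_scale: "x \<noteq> 0 \<Longrightarrow> c > 0 \<Longrightarrow> h (c *\<^sub>R x) = c * h x"
  using h_eq[of x] h_eq[of "c *\<^sub>R x"] X_scale by simp

lemma u_scale: "x \<noteq> 0 \<Longrightarrow> c > 0 \<Longrightarrow> u (c *\<^sub>R x) = u x"
  unfolding u_def by (simp add: h_scale)

lemma w_orthogonal: "x \<noteq> 0 \<Longrightarrow> w x \<bullet> x = 0"
  unfolding w_def by (simp add: inner_diff_left h_eq)

lemma A_w: "x \<noteq> 0 \<Longrightarrow> A x (w x) = A x (X x)"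
  unfolding w_def using A_linear[of x] by (simp add: linear_diff linear_scale A_radial)

lemma w_C1: "Ck_on 1 punctured w"
proof -
  have "Ck_on 1 punctured (\<lambda>x. X x - (h x * inverse (x \<bullet> x)) *\<^sub>R x)"
    by (intro Ck_on_diff Ck_on_scaleR Ck_on_mult Ck_on_inverse Ck_on_inner Ck_on_id X_C1 h_C1 open_punctured) auto
  then show ?thesis unfolding w_def[abs_def] divide_inverse .
qed

lemma u_C1: "Ck_on 1 punctured u"
proof -
  have "Ck_on 1 punctured (\<lambda>x. h x * inverse (norm x))"
    by (intro Ck_on_mult Ck_on_inverse Ck_on_norm Ck_on_id h_C1 open_punctured) auto
  then show ?thesis unfolding u_def[abs_def] divide_inverse .
qed

lemma w_deriv:
  assumes x: "x \<noteq> 0"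
  shows "(w has_derivative (\<lambda>c. A x c - (((X x \<bullet> c) / (x \<bullet> x) - 2 * h x * (x \<bullet> c) / (x \<bullet> x)\<^sup>2) *\<^sub>R x + (h x / (x \<bullet> x)) *\<^sub>R c))) (at x)"
proof -
  have "((\<lambda>x. h x / (x \<bullet> x)) has_derivative (\<lambda>c. (X x \<bullet> c) / (x \<bullet> x) - 2 * h x * (x \<bullet> c) / (x \<bullet> x)\<^sup>2)) (at x)"
  proof (rule has_derivative_eq_rhs)
    show "((\<lambda>x. h x / (x \<bullet> x)) has_derivative (\<lambda>c. ((X x \<bullet> c) * (x \<bullet> x) - h x * (x \<bullet> c + c \<bullet> x)) / ((x \<bullet> x) * (x \<bullet> x)))) (at x)"
      by (rule has_derivative_divide'[OF h_deriv[OF x] has_derivative_inner[OF has_derivative_ident has_derivative_ident]])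
        (use x in simp)
    show "(\<lambda>c. ((X x \<bullet> c) * (x \<bullet> x) - h x * (x \<bullet> c + c \<bullet> x)) / ((x \<bullet> x) * (x \<bullet> x)))
      = (\<lambda>c. (X x \<bullet> c) / (x \<bullet> x) - 2 * h x * (x \<bullet> c) / (x \<bullet> x)\<^sup>2)"
    proof
      fix c
      have gen: "(a * p - b * (q + q)) / (p * p) = a / p - 2 * b * q / p\<^sup>2" if "p \<noteq> 0" for a b p q :: real
        using that by (simp add: field_simps power2_eq_square)
      have "x \<bullet> x \<noteq> 0" using x by simp
      then show "((X x \<bullet> c) * (x \<bullet> x) - h x * (x \<bullet> c + c \<bullet> x)) / ((x \<bullet> x) * (x \<bullet> x))
        = (X x \<bullet> c) / (x \<bullet> x) - 2 * h x * (x \<bullet> c) / (x \<bullet> x)\<^sup>2"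
        unfolding inner_commute[of c x] by (rule gen)
    qed
  qed
  from has_derivative_diff[OF X_deriv[OF x] has_derivative_scaleR[OF this has_derivative_ident]]
  show ?thesis unfolding w_def[abs_def] by (simp add: add.commute)
qed

lemma u_deriv:
  assumes x: "x \<noteq> 0"
  shows "(u has_derivative (\<lambda>c. (w x \<bullet> c) / norm x)) (at x)"
proof -
  have n: "norm x \<noteq> 0" "(norm x)\<^sup>2 = x \<bullet> x" using x by (auto simp: power2_norm_eq_inner)
  have "(u has_derivative (\<lambda>c. ((X x \<bullet> c) * norm x - h x * (sgn x \<bullet> c)) / (norm x * norm x))) (at x)"
    unfolding u_def[abs_def] by (rule has_derivative_divide'[OF h_deriv[OF x] has_derivative_norm[OF x, THEN has_derivative_eq_rhs] n(1)])
      (auto simp: inner_commute)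
  then show ?thesis
  proof (rule has_derivative_eq_rhs)
    show "(\<lambda>c. ((X x \<bullet> c) * norm x - h x * (sgn x \<bullet> c)) / (norm x * norm x)) = (\<lambda>c. (w x \<bullet> c) / norm x)"
      unfolding w_def n(2)[symmetric] using n(1)
      by (auto simp: fun_eq_iff sgn_div_norm inner_diff_left field_simps power2_eq_square)
  qed
qed

text \<open>The radial part of \<open>X x\<close> lies in the kernel of \<open>A x\<close>, so
  \<open>w x\<close> may replace \<open>X x\<close> in the gradient.\<close>

lemma r_deriv:
  assumes x: "x \<noteq> 0"
  shows "((\<lambda>y. norm (X y)) has_derivative (\<lambda>c. (A x (w x) \<bullet> c) / norm (X x))) (at x)"
proof (rule has_derivative_eq_rhs)
  show "((\<lambda>y. norm (X y)) has_derivative (\<lambda>c. A x c \<bullet> sgn (X x))) (at x)"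
    by (rule has_derivative_compose[OF X_deriv[OF x] has_derivative_norm[OF X_nonzero[OF x]]])
  show "(\<lambda>c. A x c \<bullet> sgn (X x)) = (\<lambda>c. (A x (w x) \<bullet> c) / norm (X x))"
    unfolding A_w[OF x] using A_symmetric[OF x, of _ "X x"]
    by (auto simp: fun_eq_iff sgn_div_norm inner_commute divide_inverse mult.commute)
qed

lemma r_C1: "Ck_on 1 punctured (\<lambda>x. norm (X x))"
  by (intro Ck_on_norm X_C1 open_punctured) (auto simp: X_nonzero)

text \<open>\<open>A\<close> has degree -1 by \<open>A_scale\<close>; the power of the norm makes
  \<open>E j\<close> homogeneous of degree zero.\<close>

definition E :: "nat \<Rightarrow> 'a \<Rightarrow> real" where "E j x = norm x ^ j * nsym j (A x)"

lemma E_C1: "Ck_on 1 punctured (E j)"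
proof -
  have "Ck_on 1 punctured (\<lambda>x::'a. norm x ^ j)"
    by (induction j) (auto intro!: Ck_on_mult Ck_on_norm Ck_on_const Ck_on_id simp del: Ck_on.simps)
  then show ?thesis unfolding E_def[abs_def]
    by (intro Ck_on_mult Ck_on_nsym open_punctured A_C1) (auto simp: A_linear)
qed

end


section \<open>The Minkowski inequality\<close>

context gauss_inverse
begin

lemma eigenbasis:
  assumes x: "x \<noteq> 0"
  obtains B f where "orthonormal B" "span B = {v. v \<bullet> x = 0}" "card B = DIM('a) - 1"
    "\<And>b. b \<in> B \<Longrightarrow> A x b = f b *\<^sub>R b" "\<forall>b\<in>B. 0 < f b" "\<And>m. nsym m (A x) = esym m f B"
proof -
  let ?V = "{v. v \<bullet> x = 0}"
  have sub: "subspace ?V" by (rule subspace_hyperplane2)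
  have dim: "dim ?V = DIM('a) - 1" using dim_hyperplane[OF x] by (simp add: inner_commute)
  obtain B f where B: "orthonormal B" "B \<subseteq> ?V" "span B = ?V" "card B = dim ?V" "\<forall>b\<in>B. A x b = f b *\<^sub>R b"
  proof -
    have "\<exists>B f. orthonormal B \<and> B \<subseteq> ?V \<and> span B = ?V \<and> card B = dim ?V \<and> (\<forall>b\<in>B. A x b = f b *\<^sub>R b)"
      by (rule spectral_theorem[OF A_linear[OF x] sub]) (auto simp: A_symmetric[OF x] A_radial[OF x])
    then show ?thesis using that by blast
  qed
  have fpos: "0 < f b" if b: "b \<in> B" for b
  proof -
    have bb: "b \<bullet> b = 1" using B b by (auto simp: orthonormal_def)
    have "A x b = f b *\<^sub>R b" using B(5) b by blast
    then have "0 \<le> f b" using hess_nonneg[OF x, of b] bb by (simp add: A_def)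
    moreover have "f b \<noteq> 0"
    proof
      assume "f b = 0"
      then have "frechet_derivative X (at x) b = 0" using \<open>A x b = f b *\<^sub>R b\<close> by (simp add: A_def)
      moreover have "b \<bullet> x = 0" using B(2) b by blast
      ultimately have "b = 0" using hess_inj[OF x] by blast
      then show False using bb by simp
    qed
    ultimately show ?thesis by simp
  qed
  have "nsym m (A x) = esym m f B" for m
  proof (rule nsym_eq_esym[OF A_linear[OF x] B(1), of "sgn x"])
    show "span B = {v. v \<bullet> sgn x = 0}" using B(3) x by (simp add: sgn_div_norm)
    show "norm (sgn x) = 1" using x by (simp add: norm_sgn)
    show "A x (sgn x) = 0" by (simp add: sgn_div_norm linear_scale[OF A_linear[OF x]] A_radial[OF x])
  qed (use B(5) in auto)
  then show ?thesis using that[of B f] B dim fpos by auto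
qed

text \<open>The tensor and \<open>A x\<close> are diagonal in one orthonormal basis with nonnegative
  eigenvalues, so their composition is semidefinite as well. The second claim handles weights that
  depend on the radial function.\<close>

lemma newton_tensor_nonneg:
  assumes x: "x \<noteq> 0" and v: "v \<bullet> x = 0"
  shows "0 \<le> newton_tensor m (A x) v \<bullet> v" "0 \<le> newton_tensor m (A x) v \<bullet> A x v"
proof -
  obtain B f where B: "orthonormal B" "span B = {v. v \<bullet> x = 0}" "card B = DIM('a) - 1"
    "\<And>b. b \<in> B \<Longrightarrow> A x b = f b *\<^sub>R b" "\<forall>b\<in>B. 0 < f b" "\<And>m. nsym m (A x) = esym m f B"
    by (rule eigenbasis[OF x], rule that)
  have fin: "finite B" using orthonormal_finite[OF B(1)] .
  have ex: "(\<Sum>b\<in>B. (v \<bullet> b) *\<^sub>R b) = v" using orthonormal_expand[OF B(1) fin] B(2) v by simp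
  let ?t = "\<lambda>b. esym m f (B - {b})"
  have t: "0 \<le> ?t b" for b using B(5) by (intro esym_nonneg) (auto simp: less_imp_le)
  have Tv: "newton_tensor m (A x) v = (\<Sum>b\<in>B. ((v \<bullet> b) * ?t b) *\<^sub>R b)"
    by (subst (1) ex[symmetric])
      (simp add: linear_sum[OF linear_newton_tensor[OF A_linear[OF x]]] linear_scale[OF linear_newton_tensor[OF A_linear[OF x]]]
        newton_tensor_eigenvector[OF A_linear[OF x] fin B(4) B(6)])
  have "newton_tensor m (A x) v \<bullet> v = (\<Sum>b\<in>B. ?t b * (v \<bullet> b)\<^sup>2)"
    unfolding Tv by (simp add: inner_sum_left power2_eq_square mult_ac inner_commute[of v])
  then show "0 \<le> newton_tensor m (A x) v \<bullet> v" using t by (simp add: sum_nonneg)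
  have "b \<bullet> A x v = f b * (v \<bullet> b)" if "b \<in> B" for b
    using A_symmetric[OF x, of b v] B(4)[OF that] by (simp add: inner_commute)
  then have "newton_tensor m (A x) v \<bullet> A x v = (\<Sum>b\<in>B. ?t b * f b * (v \<bullet> b)\<^sup>2)"
    unfolding Tv by (simp add: inner_sum_left power2_eq_square mult_ac)
  then show "0 \<le> newton_tensor m (A x) v \<bullet> A x v" using t B(5) by (simp add: sum_nonneg less_imp_le)
qed



text \<open>With \<open>DIM('a) = n + 1\<close> the coefficient of the \<open>u\<close> term is
  \<open>n - (j - 1)\<close>; \<open>minkowski_integrand_eq\<close> normalizes the bracket to a
  difference of means.\<close>

definition minkowski_integrand :: "nat \<Rightarrow> ('a \<Rightarrow> real) \<Rightarrow> 'a \<Rightarrow> real" where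
  "minkowski_integrand j g x = cutoff (x \<bullet> x) *
    (g x * (real j * E j x - (real (DIM('a)) - real j) * u x * E (j - 1) x))"

lemma minkowski_integrand_C1:
  assumes "Ck_on 1 punctured g"
  shows "Ck_on 1 UNIV (minkowski_integrand j g)"
proof (rule Ck_on_extend_zero[OF open_punctured, where C = "{x. 1 \<le> x \<bullet> x \<and> x \<bullet> x \<le> 4}"])
  show "closed {x::'a. 1 \<le> x \<bullet> x \<and> x \<bullet> x \<le> 4}"
    by (intro closed_Collect_conj closed_Collect_le continuous_intros)
  have "Ck_on 1 punctured (\<lambda>x::'a. cutoff (x \<bullet> x))"
    by (rule Ck_on_compose[OF open_punctured open_UNIV _ Ck_on_cutoff]) (auto intro!: Ck_on_inner Ck_on_id)
  then show "Ck_on 1 punctured (minkowski_integrand j g)"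
    unfolding minkowski_integrand_def[abs_def]
    by (intro Ck_on_mult Ck_on_diff Ck_on_const E_C1 u_C1 assms open_punctured)
qed (auto simp: minkowski_integrand_def cutoff_eq_0)

lemma compact_annulus: "compact {x::'a. 1 \<le> x \<bullet> x \<and> x \<bullet> x \<le> 4}"
proof -
  have "closed {x::'a. 1 \<le> x \<bullet> x \<and> x \<bullet> x \<le> 4}"
    by (intro closed_Collect_conj closed_Collect_le continuous_intros)
  moreover have "{x::'a. 1 \<le> x \<bullet> x \<and> x \<bullet> x \<le> 4} \<subseteq> cball 0 2"
  proof
    fix x :: 'a assume "x \<in> {x. 1 \<le> x \<bullet> x \<and> x \<bullet> x \<le> 4}"
    then have "(norm x)\<^sup>2 \<le> 2\<^sup>2" by (simp add: power2_norm_eq_inner)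
    then have "norm x \<le> 2" by (rule power2_le_imp_le) simp
    then show "x \<in> cball 0 2" by simp
  qed
  ultimately show ?thesis
    by (meson bounded_cball bounded_subset compact_eq_bounded_closed)
qed

lemma minkowski_integrand_integrable:
  assumes "Ck_on 1 punctured g"
  shows "integrable lborel (minkowski_integrand j g)"
  by (rule integrable_compact_support[OF Ck_on_imp_continuous_on[OF minkowski_integrand_C1[OF assms]] compact_annulus])
    (auto simp: minkowski_integrand_def cutoff_eq_0)

text \<open>The part \<open>A x\<close> of the derivative of \<open>w\<close> gives the first term.
  The identity part gives a full trace with factor \<open>DIM('a) - m\<close>, from which the
  rank-one parts along \<open>x\<close> remove the radial contribution once.\<close>

lemma tangential_trace:
  assumes x: "x \<noteq> 0" and w': "(w has_derivative w') (at x)"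
  shows "(\<Sum>c\<in>Basis. w' c \<bullet> newton_tensor m (A x) c)
    = real (Suc m) * nsym (Suc m) (A x) - (real (DIM('a)) - real (Suc m)) * nsym m (A x) * h x / (x \<bullet> x)"
proof -
  let ?T = "newton_tensor m (A x)"
  let ?q = "h x / (x \<bullet> x)"
  have lT: "linear ?T" using linear_newton_tensor[OF A_linear[OF x]] .
  have sT: "?T a \<bullet> b = a \<bullet> ?T b" for a b by (rule newton_tensor_symmetric[OF A_symmetric[OF x]])
  have Tx: "?T x = nsym m (A x) *\<^sub>R x" by (rule newton_tensor_kernel[OF A_linear[OF x] A_radial[OF x]])
  let ?a = "\<lambda>c. (X x \<bullet> c) / (x \<bullet> x) - 2 * h x * (x \<bullet> c) / (x \<bullet> x)\<^sup>2"
  have w'_eq: "w' = (\<lambda>c. A x c - (?a c *\<^sub>R x + ?q *\<^sub>R c))"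
    using has_derivative_unique[OF w' w_deriv[OF x]] .
  have 1: "(\<Sum>c\<in>Basis. A x c \<bullet> ?T c) = real (Suc m) * nsym (Suc m) (A x)"
    using optrace_newton_tensor_mult[OF A_linear[OF x], of m] unfolding optrace_def sT .
  have 2: "(\<Sum>c\<in>Basis. c \<bullet> ?T c) = (real (DIM('a)) - real m) * nsym m (A x)"
    using optrace_newton_tensor[OF A_linear[OF x], of m] unfolding optrace_def sT .
  have s: "(\<Sum>c\<in>Basis. (y \<bullet> c) * (x \<bullet> ?T c)) = nsym m (A x) * (y \<bullet> x)" for y
  proof -
    have "x \<bullet> ?T c = nsym m (A x) * (x \<bullet> c)" for c using sT[of x c] Tx by simp
    then show ?thesis
      by (simp add: euclidean_inner[of y x] sum_distrib_left mult_ac)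
  qed
  have "(\<Sum>c\<in>Basis. ?a c * (x \<bullet> ?T c)) = (\<Sum>c\<in>Basis. (X x \<bullet> c) * (x \<bullet> ?T c)) / (x \<bullet> x)
      - 2 * h x / (x \<bullet> x)\<^sup>2 * (\<Sum>c\<in>Basis. (x \<bullet> c) * (x \<bullet> ?T c))"
    by (simp add: sum_distrib_left sum_divide_distrib left_diff_distrib sum_subtractf mult.assoc)
  also have "\<dots> = nsym m (A x) * h x / (x \<bullet> x) - 2 * h x / (x \<bullet> x)\<^sup>2 * (nsym m (A x) * (x \<bullet> x))"
    unfolding s h_eq[OF x] by simp
  also have "\<dots> = - (nsym m (A x) * h x / (x \<bullet> x))"
    using x by (simp add: power2_eq_square)
  finally have 3: "(\<Sum>c\<in>Basis. ?a c * (x \<bullet> ?T c)) = - (nsym m (A x) * h x / (x \<bullet> x))" .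
  have "(\<Sum>c\<in>Basis. w' c \<bullet> ?T c) = (\<Sum>c\<in>Basis. A x c \<bullet> ?T c)
     - ((\<Sum>c\<in>Basis. ?a c * (x \<bullet> ?T c)) + ?q * (\<Sum>c\<in>Basis. c \<bullet> ?T c))"
    unfolding w'_eq by (simp only: inner_diff_left inner_add_left inner_scaleR_left sum_subtractf sum.distrib sum_distrib_left)
  then show ?thesis unfolding 1 2 3 by (simp add: algebra_simps diff_divide_distrib add_divide_distrib)
qed

text \<open>Integrates the divergence of the Newton tensor applied to a radial multiple of \<open>g w\<close>; since
  \<open>w x\<close> is tangential, the derivatives of the radial weight drop out.\<close>

lemma minkowski_inequality:
  assumes j: "1 \<le> j" and g: "Ck_on 1 punctured g"
    and grad: "\<And>x. x \<noteq> 0 \<Longrightarrow> \<exists>a b. 0 \<le> a \<and> 0 \<le> b \<and>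
      (g has_derivative (\<lambda>v. - (a * (w x \<bullet> v) + b * (A x (w x) \<bullet> v)))) (at x)"
  shows "0 \<le> (\<integral>x. minkowski_integrand j g x \<partial>lborel)"
proof -
  obtain m where m: "j = Suc m" using j by (cases j) auto
  \<comment> \<open>The power of the norm turns \<open>nsym j\<close> into \<open>E j\<close>, and
    \<open>nsym (j - 1) * h x / (x \<bullet> x)\<close> into
    \<open>u x * E (j - 1) x\<close>.\<close>
  define \<rho> where "\<rho> x = cutoff (x \<bullet> x) * norm x ^ j" for x :: 'a
  define V where "V x = (\<rho> x * g x) *\<^sub>R newton_tensor m (A x) (w x)" for x
  let ?C = "{x::'a. 1 \<le> x \<bullet> x \<and> x \<bullet> x \<le> 4}"
  have rho0: "\<rho> x = 0" if "x \<notin> ?C" for x using that by (auto simp: \<rho>_def cutoff_eq_0)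
  have rho_pos: "0 \<le> \<rho> x" for x unfolding \<rho>_def by (simp add: cutoff_nonneg)
  have cut: "Ck_on 1 punctured (\<lambda>x::'a. cutoff (x \<bullet> x))"
    by (rule Ck_on_compose[OF open_punctured open_UNIV _ Ck_on_cutoff]) (auto intro!: Ck_on_inner Ck_on_id)
  have pow: "Ck_on 1 punctured (\<lambda>x::'a. norm x ^ j)"
    by (induction j) (auto intro!: Ck_on_mult Ck_on_norm Ck_on_const Ck_on_id)
  have rhoC: "Ck_on 1 punctured \<rho>"
    unfolding \<rho>_def[abs_def] by (intro Ck_on_mult cut pow open_punctured)
  have VC: "Ck_on 1 punctured V"
    unfolding V_def[abs_def]
    by (intro Ck_on_scaleR Ck_on_mult rhoC g Ck_on_newton_tensor open_punctured A_C1 w_C1) (auto simp: A_linear)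
  have V0: "V x = 0" if "x \<notin> ?C" for x using rho0[OF that] by (simp add: V_def)
  have VU: "Ck_on 1 UNIV V"
    by (rule Ck_on_extend_zero[OF open_punctured compact_imp_closed[OF compact_annulus] _ VC V0]) auto
  have le: "divergence V x \<le> minkowski_integrand j g x" for x
  proof (cases "x = 0")
    case True
    have "(V has_derivative (\<lambda>_. 0)) (at x)"
      by (rule has_derivative_transform_within_open[of "\<lambda>_. 0" _ _ _ "- ?C"])
        (use True V0 compact_imp_closed[OF compact_annulus] in auto)
    then have "divergence V x = 0" by (simp add: divergence_def frechet_derivative_eqI)
    then show ?thesis using True by (simp add: minkowski_integrand_def cutoff_eq_0)
  next
    case x: False
    let ?T = "newton_tensor m (A x)"
    have lT: "linear ?T" using linear_newton_tensor[OF A_linear[OF x]] .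
    have sT: "?T a \<bullet> b = a \<bullet> ?T b" for a b by (rule newton_tensor_symmetric[OF A_symmetric[OF x]])
    have Tx: "?T x = nsym m (A x) *\<^sub>R x" by (rule newton_tensor_kernel[OF A_linear[OF x] A_radial[OF x]])
    obtain a b where ab: "0 \<le> a" "0 \<le> b"
      and g': "(g has_derivative (\<lambda>v. - (a * (w x \<bullet> v) + b * (A x (w x) \<bullet> v)))) (at x)"
      using grad[OF x] by blast
    obtain w' where w': "(w has_derivative w') (at x)" using w_deriv[OF x] by blast
    \<comment> \<open>The weight as a function of \<open>x \<bullet> x\<close>: its gradient is a
      multiple of \<open>x\<close>, whatever the value of \<open>d\<close>.\<close>
    define \<sigma> where "\<sigma> s = cutoff s * (sqrt s) ^ j" for s
    have xx: "x \<bullet> x > 0" using x by simp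
    obtain d where d: "(\<sigma> has_real_derivative d) (at (x \<bullet> x))"
    proof -
      have "(cutoff has_derivative frechet_derivative cutoff (at (x \<bullet> x))) (at (x \<bullet> x))"
        using Ck_on_SucD(1)[of 0 UNIV cutoff] Ck_on_cutoff by simp
      then obtain e where "(cutoff has_real_derivative e) (at (x \<bullet> x))"
        using has_derivative_imp_has_field_derivative[of cutoff] differentiable_def real_differentiable_def by metis
      then have "((\<lambda>s. cutoff s * sqrt s ^ j) has_real_derivative
          e * sqrt (x \<bullet> x) ^ j + real j * (inverse (sqrt (x \<bullet> x)) / 2 * sqrt (x \<bullet> x) ^ (j - Suc 0)) * cutoff (x \<bullet> x)) (at (x \<bullet> x))"
        by (intro DERIV_mult DERIV_power DERIV_real_sqrt xx)
      then show ?thesis using that unfolding \<sigma>_def[abs_def] by blast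
    qed
    have "((\<lambda>x. \<sigma> (x \<bullet> x)) has_derivative (\<lambda>v. d * (x \<bullet> v + v \<bullet> x))) (at x)"
      using has_derivative_compose[OF has_derivative_inner[OF has_derivative_ident has_derivative_ident] d[unfolded has_field_derivative_def]]
      by simp
    then have rho': "(\<rho> has_derivative (\<lambda>v. 2 * d * (x \<bullet> v))) (at x)"
      unfolding \<sigma>_def \<rho>_def[abs_def] norm_eq_sqrt_inner by (simp add: inner_commute algebra_simps)
    define z' where "z' v = \<rho> x * - (a * (w x \<bullet> v) + b * (A x (w x) \<bullet> v)) + (2 * d * (x \<bullet> v)) * g x" for v
    have z: "((\<lambda>y. \<rho> y * g y) has_derivative z') (at x)"
      unfolding z'_def[abs_def] using has_derivative_mult[OF rho' g'] .
    have zw: "((\<lambda>y. (\<rho> y * g y) *\<^sub>R w y) has_derivative (\<lambda>v. (\<rho> x * g x) *\<^sub>R w' v + z' v *\<^sub>R w x)) (at x)"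
      using has_derivative_scaleR[OF z w'] .
    have VD: "(V has_derivative frechet_derivative V (at x)) (at x)"
      using Ck_on_SucD(1)[of 0 UNIV V x] VU by simp
    have V': "((\<lambda>y. newton_tensor m (A y) ((\<rho> y * g y) *\<^sub>R w y)) has_derivative frechet_derivative V (at x)) (at x)"
      by (rule has_derivative_transform_within_open[OF VD open_punctured])
        (use x in \<open>auto simp: V_def linear_scale[OF linear_newton_tensor[OF A_linear]]\<close>)
    have "divergence V x = (\<Sum>c\<in>Basis. ((\<rho> x * g x) *\<^sub>R w' c + z' c *\<^sub>R w x) \<bullet> ?T c)"
      unfolding divergence_def
      by (rule divergence_newton_tensor[OF open_punctured _ _ _ A_deriv D_linear D_symmetric D_codazzi zw V'])
        (use x in \<open>auto simp: A_linear A_symmetric\<close>)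
    also have "\<dots> = \<rho> x * g x * (\<Sum>c\<in>Basis. w' c \<bullet> ?T c) + (\<Sum>c\<in>Basis. z' c * (?T (w x) \<bullet> c))"
      by (simp add: inner_add_left sum.distrib sum_distrib_left sT mult_ac)
    also have "(\<Sum>c\<in>Basis. z' c * (?T (w x) \<bullet> c)) = z' (?T (w x))"
      using linear_Basis_expand[OF has_derivative_linear[OF z], of "?T (w x)"] by (simp add: mult.commute)
    \<comment> \<open>The radial derivative pairs to zero with \<open>?T (w x)\<close>; the gradient
      of \<open>g\<close> contributes minus a nonnegative combination of the two forms in
      \<open>newton_tensor_nonneg\<close>.\<close>
    also have "z' (?T (w x)) \<le> 0"
    proof -
      have "x \<bullet> ?T (w x) = 0"
        using sT[of x "w x"] Tx w_orthogonal[OF x] by (simp add: inner_commute)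
      moreover have "0 \<le> w x \<bullet> ?T (w x)" "0 \<le> A x (w x) \<bullet> ?T (w x)"
        using newton_tensor_nonneg[OF x w_orthogonal[OF x], of m] by (auto simp: inner_commute)
      ultimately have "0 \<le> a * (w x \<bullet> ?T (w x)) + b * (A x (w x) \<bullet> ?T (w x))" "x \<bullet> ?T (w x) = 0"
        using ab by simp_all
      then show ?thesis unfolding z'_def using rho_pos[of x] by (simp add: mult_nonneg_nonpos del: minus_add_distrib)
    qed
    finally have "divergence V x \<le> \<rho> x * g x * (\<Sum>c\<in>Basis. w' c \<bullet> ?T c)" by simp
    also have "\<dots> = minkowski_integrand j g x"
    proof -
      have n: "norm x \<noteq> 0" "x \<bullet> x = norm x * norm x" using x by (auto simp: power2_norm_eq_inner[symmetric] power2_eq_square)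
      show ?thesis
        unfolding tangential_trace[OF x w'] \<rho>_def minkowski_integrand_def m E_def u_def
        using n by (simp add: n(2) field_simps del: of_nat_Suc)
    qed
    finally show ?thesis .
  qed
  have "0 = (\<integral>x. divergence V x \<partial>lborel)"
    by (rule integral_divergence_compact_support(2)[OF VU compact_annulus V0, symmetric])
  also have "\<dots> \<le> (\<integral>x. minkowski_integrand j g x \<partial>lborel)"
    by (intro integral_mono integral_divergence_compact_support(1)[OF VU compact_annulus V0]
        minkowski_integrand_integrable[OF g] le)
  finally show ?thesis .
qed

text \<open>Constant weights of both signs satisfy the gradient condition with
  \<open>a = b = 0\<close>.\<close>

lemma minkowski_identity:
  assumes j: "1 \<le> j"
  shows "(\<integral>x. minkowski_integrand j (\<lambda>_. 1) x \<partial>lborel) = 0"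
proof -
  have "0 \<le> (\<integral>x. minkowski_integrand j (\<lambda>_. c) x \<partial>lborel)" for c
    by (rule minkowski_inequality[OF j Ck_on_const[OF open_punctured]]) (auto intro!: exI[of _ 0])
  from this[of 1] this[of "-1"]
  have "0 \<le> (\<integral>x. minkowski_integrand j (\<lambda>_. 1) x \<partial>lborel)"
    "0 \<le> (\<integral>x. - minkowski_integrand j (\<lambda>_. 1) x \<partial>lborel)"
    by (simp_all only: minkowski_integrand_def mult_minus1 mult_minus_right mult_1)
  then show ?thesis unfolding Bochner_Integration.integral_minus by simp
qed

end


section \<open>Umbilicity and spheres\<close>

lemma Ck_on_power:
  assumes "open S" "Ck_on k S f"
  shows "Ck_on k S (\<lambda>x. f x ^ m :: real)"
proof (induction m)
  case 0
  then show ?case using Ck_on_const[OF assms(1)] by simp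
next
  case (Suc m)
  then show ?case using Ck_on_mult[OF assms(1) assms(2) Suc] by simp
qed

context gauss_inverse
begin

lemma E_eq_esym:
  assumes z: "norm z = 1" and c: "c > 0"
    and B: "orthonormal B" "span B = {v. v \<bullet> z = 0}" and f: "\<And>b. b \<in> B \<Longrightarrow> A z b = f b *\<^sub>R b"
  shows "E m (c *\<^sub>R z) = esym m f B"
proof -
  have z0: "z \<noteq> 0" and cz: "c *\<^sub>R z \<noteq> 0" using z c by auto
  have "nsym m (A (c *\<^sub>R z)) = esym m (\<lambda>b. (1 / c) * f b) B"
    by (rule nsym_eq_esym[OF A_linear[OF cz] B z])
      (auto simp: A_scale[OF z0 c] A_radial[OF z0] f)
  also have "\<dots> = (1 / c) ^ m * esym m f B" by (rule esym_scale)
  finally show ?thesis using c z by (simp add: E_def power_divide)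
qed

text \<open>By the absorption identity
  \<open>j * (n choose j) = (n - j + 1) * (n choose (j - 1))\<close>, one division normalizes both
  terms at once.\<close>

lemma minkowski_integrand_eq:
  assumes n: "DIM('a) = n + 1" and j: "1 \<le> j" "j \<le> n"
  shows "minkowski_integrand j g x / (real j * real (n choose j))
    = cutoff (x \<bullet> x) * (g x * (E j x / real (n choose j) - u x * (E (j - 1) x / real (n choose (j - 1)))))"
proof -
  obtain i where i: "j = Suc i" using j by (cases j) auto
  have "Suc i * (n choose Suc i) = (n - i) * (n choose i)"
    using binomial_absorb_comp[of n i] j i by (metis Suc_times_binomial_eq binomial_absorption mult.commute Suc_diff_1 Suc_le_eq less_le_trans zero_less_Suc)
  then have "real (Suc i) * real (n choose Suc i) = real (n - i) * real (n choose i)"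
    by (metis of_nat_mult)
  then have e: "real j * real (n choose j) = (real (DIM('a)) - real j) * real (n choose (j - 1))"
    using i j n by (simp add: of_nat_diff algebra_simps)
  have pos: "real j * real (n choose j) > 0" "real (n choose j) > 0" "real (n choose (j - 1)) > 0"
    using j by auto
  have "real (DIM('a)) - real j \<noteq> 0" using j n by simp
  then have 1: "(real (DIM('a)) - real j) / (real j * real (n choose j)) = 1 / real (n choose (j - 1))"
    unfolding e by simp
  have 2: "real j / (real j * real (n choose j)) = 1 / real (n choose j)" using j by simp
  have "minkowski_integrand j g x / (real j * real (n choose j))
    = cutoff (x \<bullet> x) * (g x * (real j / (real j * real (n choose j)) * E j x
       - (real (DIM('a)) - real j) / (real j * real (n choose j)) * (u x * E (j - 1) x)))"
  proof -
    have "(c * (g' * (a * e - b * u' * e'))) / q = c * (g' * (a / q * e - b / q * (u' * e')))"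
      for a b c e e' g' q u' :: real by (simp add: divide_inverse algebra_simps)
    then show ?thesis unfolding minkowski_integrand_def .
  qed
  then show ?thesis unfolding 1 2 by simp
qed

lemma umbilic_of_quotient_equation:
  assumes n: "DIM('a) = n + 1" "2 \<le> n" and lk: "l < k" "k \<le> n"
    and F: "Ck_on 1 punctured F" "\<And>x. x \<noteq> 0 \<Longrightarrow> 0 < F x"
    and grad: "\<And>x. x \<noteq> 0 \<Longrightarrow> \<exists>a b. 0 \<le> a \<and> 0 \<le> b \<and>
      (F has_derivative (\<lambda>v. a * (w x \<bullet> v) + b * (A x (w x) \<bullet> v))) (at x)"
    and eq: "\<And>x. x \<noteq> 0 \<Longrightarrow> F x ^ (k - l) = (E k x / real (n choose k)) / (E l x / real (n choose l))"
    and z: "norm z = 1"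
  shows "\<exists>\<mu>>0. \<forall>v. v \<bullet> z = 0 \<longrightarrow> A z v = \<mu> *\<^sub>R v"
proof -
  \<comment> \<open>Unifies the two pointwise inequalities: in both, a mean difference of order
    \<open>j\<close>, weighted by the inverse of \<open>F ^ m\<close>, is bounded by the one of
    order \<open>i\<close>.\<close>
  define i where "i = (if l = 0 then 1 else l)"
  define j where "j = (if l = 0 then max k 2 else k)"
  define m where "m = (if l = 0 then j - 1 else k - l)"
  have ij: "1 \<le> i" "i < j" "j \<le> n" using n lk by (auto simp: i_def j_def)
  define p where "p q x = E q x / real (n choose q)" for q x
  define g where "g x = inverse (F x ^ m)" for x
  have pointwise: "g x * (p j x - u x * p (j - 1) x) \<le> p i x - u x * p (i - 1) x \<and>
     (g x * (p j x - u x * p (j - 1) x) = p i x - u x * p (i - 1) x \<longrightarrow> (\<forall>b\<in>B. \<forall>b'\<in>B. f b = f b'))"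
    if x: "x = c *\<^sub>R y" "c > 0" "norm y = 1" and B: "orthonormal B" "span B = {v. v \<bullet> y = 0}" "card B = DIM('a) - 1"
      "\<And>b. b \<in> B \<Longrightarrow> A y b = f b *\<^sub>R b" "\<forall>b\<in>B. 0 < f b" for x c y B f
  proof -
    have fin: "finite B" using orthonormal_finite[OF B(1)] .
    have card: "card B = n" using B n by simp
    have P: "p q x = Pmean q f B" for q
      unfolding p_def Pmean_def card x(1) by (subst E_eq_esym[OF x(3,2) B(1,2,4)]) auto
    have x0: "x \<noteq> 0" using x by auto
    note Fp = F(2)[OF x0] and up = u_pos[OF x0]
    have eqx: "F x ^ (k - l) = Pmean k f B / Pmean l f B"
      using eq[OF x0] unfolding P[symmetric] p_def .
    show ?thesis
    proof (cases "l = 0")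
      case True
      then have e: "F x ^ k = Pmean k f B" using eqx fin by simp
      have j': "j = max k 2" using True by (simp add: j_def)
      note h = pointwise_inequality_0[OF fin B(5) _ _ _ Fp e up j']
      have h1: "(Pmean j f B - u x * Pmean (j - 1) f B) / F x ^ (j - 1) \<le> Pmean 1 f B - u x"
        by (rule h(1)) (use lk n card in auto)
      have h2: "f b = f b'" if "(Pmean j f B - u x * Pmean (j - 1) f B) / F x ^ (j - 1) = Pmean 1 f B - u x" "b \<in> B" "b' \<in> B" for b b'
        by (rule h(2)[OF _ _ _ that]) (use lk n card in auto)
      have mj: "m = j - 1" using True by (simp add: m_def)
      have e1: "g x * (p j x - u x * p (j - 1) x) = (Pmean j f B - u x * Pmean (j - 1) f B) / F x ^ (j - 1)"
        unfolding P g_def mj by (simp only: divide_inverse mult.commute)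
      have e2: "p i x - u x * p (i - 1) x = Pmean 1 f B - u x"
        unfolding P i_def using True fin by simp
      show ?thesis unfolding e1 e2 using h1 h2 by blast
    next
      case False
      note h = pointwise_inequality[OF fin B(5) _ lk(1) _ Fp eqx up]
      have h1: "(Pmean k f B - u x * Pmean (k - 1) f B) / F x ^ (k - l) \<le> Pmean l f B - u x * Pmean (l - 1) f B"
        by (rule h(1)) (use lk False card in auto)
      have h2: "f b = f b'" if "(Pmean k f B - u x * Pmean (k - 1) f B) / F x ^ (k - l) = Pmean l f B - u x * Pmean (l - 1) f B" "b \<in> B" "b' \<in> B" for b b'
        by (rule h(2)[OF _ _ that]) (use lk False card in auto)
      have mj: "m = k - l" "j = k" using False by (auto simp: m_def j_def)
      have e1: "g x * (p j x - u x * p (j - 1) x) = (Pmean k f B - u x * Pmean (k - 1) f B) / F x ^ (k - l)"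
        unfolding P g_def mj by (simp only: divide_inverse mult.commute)
      have e2: "p i x - u x * p (i - 1) x = Pmean l f B - u x * Pmean (l - 1) f B"
        unfolding P i_def using False by simp
      show ?thesis unfolding e1 e2 using h1 h2 by blast
    qed
  qed
  have gC: "Ck_on 1 punctured g"
    unfolding g_def[abs_def] by (intro Ck_on_inverse Ck_on_power F open_punctured) (simp add: F(2))
  have one: "Ck_on 1 punctured (\<lambda>_. 1::real)" by (rule Ck_on_const[OF open_punctured])
  have g_ineq: "0 \<le> (\<integral>x. minkowski_integrand j g x \<partial>lborel)"
  proof (rule minkowski_inequality[OF _ gC])
    fix x :: 'a assume x: "x \<noteq> 0"
    obtain a b where ab: "0 \<le> a" "0 \<le> b"
      "(F has_derivative (\<lambda>v. a * (w x \<bullet> v) + b * (A x (w x) \<bullet> v))) (at x)"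
      using grad[OF x] by blast
    let ?c = "inverse (F x ^ m) * inverse (F x ^ m) * (real m * F x ^ (m - 1))"
    have Fx: "F x > 0" using F(2)[OF x] .
    have "(g has_derivative (\<lambda>v. - (?c * (a * (w x \<bullet> v) + b * (A x (w x) \<bullet> v))))) (at x)"
      unfolding g_def[abs_def]
      by (rule has_derivative_eq_rhs[OF Deriv.has_derivative_inverse[OF _ has_derivative_power[OF ab(3)]]])
        (use Fx in \<open>auto simp: fun_eq_iff algebra_simps\<close>)
    then have "(g has_derivative (\<lambda>v. - ((?c * a) * (w x \<bullet> v) + (?c * b) * (A x (w x) \<bullet> v)))) (at x)"
      by (simp only: distrib_left mult.assoc)
    moreover have "0 \<le> ?c * a" "0 \<le> ?c * b" using ab Fx by auto
    ultimately show "\<exists>a b. 0 \<le> a \<and> 0 \<le> b \<and>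
      (g has_derivative (\<lambda>v. - (a * (w x \<bullet> v) + b * (A x (w x) \<bullet> v)))) (at x)" by blast
  qed (use ij in auto)
  \<comment> \<open>The gap in the pointwise inequality times the cutoff: it is nonnegative, and the
    integral identity at \<open>i\<close> with the inequality at \<open>j\<close> makes its integral
    nonpositive.\<close>
  define G where "G x = minkowski_integrand i (\<lambda>_. 1) x / (real i * real (n choose i))
     - minkowski_integrand j g x / (real j * real (n choose j))" for x
  have G_eq: "G x = cutoff (x \<bullet> x) * ((p i x - u x * p (i - 1) x) - g x * (p j x - u x * p (j - 1) x))" for x
    unfolding G_def p_def
    using minkowski_integrand_eq[OF n(1), of i "\<lambda>_. 1" x] minkowski_integrand_eq[OF n(1), of j g x] ij
    by (simp add: right_diff_distrib)
  have contG: "continuous_on UNIV G"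
    unfolding G_def divide_inverse
    by (intro continuous_intros Ck_on_imp_continuous_on[OF minkowski_integrand_C1] gC one)
  have G_nonneg: "0 \<le> G x" for x
  proof (cases "x = 0")
    case True
    then show ?thesis by (simp add: G_eq cutoff_eq_0)
  next
    case False
    define y where "y = (1 / norm x) *\<^sub>R x"
    have y: "norm y = 1" "x = norm x *\<^sub>R y" "y \<noteq> 0" "norm x > 0" using False by (auto simp: y_def)
    obtain B f where B: "orthonormal B" "span B = {v. v \<bullet> y = 0}" "card B = DIM('a) - 1"
      "\<And>b. b \<in> B \<Longrightarrow> A y b = f b *\<^sub>R b" "\<forall>b\<in>B. 0 < f b"
      by (rule eigenbasis[OF y(3)], rule that)
    have "g x * (p j x - u x * p (j - 1) x) \<le> p i x - u x * p (i - 1) x"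
      using pointwise[OF y(2,4,1) B] by blast
    then show ?thesis unfolding G_eq by (intro mult_nonneg_nonneg cutoff_nonneg) simp
  qed
  have intG: "integrable lborel G"
    unfolding G_def[abs_def]
    by (intro Bochner_Integration.integrable_diff integrable_divide minkowski_integrand_integrable gC one)
  have "(\<integral>x. G x \<partial>lborel) \<le> 0"
  proof -
    have "(\<integral>x. G x \<partial>lborel) = (\<integral>x. minkowski_integrand i (\<lambda>_. 1) x \<partial>lborel) / (real i * real (n choose i))
       - (\<integral>x. minkowski_integrand j g x \<partial>lborel) / (real j * real (n choose j))"
      unfolding G_def
      by (subst Bochner_Integration.integral_diff)
        (auto intro!: integrable_divide minkowski_integrand_integrable gC one)
    also have "\<dots> \<le> 0" unfolding minkowski_identity[OF ij(1)] using g_ineq by simp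
    finally show ?thesis .
  qed
  \<comment> \<open>The radius 3/2 lies inside the annulus, where the cutoff is positive, so the gap
    itself vanishes in direction \<open>z\<close>.\<close>
  then have G0: "G ((3/2) *\<^sub>R z) = 0"
    by (rule continuous_nonneg_integral_0[OF contG G_nonneg intG])
  have zz: "z \<bullet> z = 1" "z \<noteq> 0" using z by (auto simp: norm_eq_1)
  obtain B f where B: "orthonormal B" "span B = {v. v \<bullet> z = 0}" "card B = DIM('a) - 1"
    "\<And>b. b \<in> B \<Longrightarrow> A z b = f b *\<^sub>R b" "\<forall>b\<in>B. 0 < f b"
    by (rule eigenbasis[OF zz(2)], rule that)
  have "cutoff (((3/2) *\<^sub>R z) \<bullet> ((3/2) *\<^sub>R z)) > 0"
    by (rule cutoff_pos) (simp_all add: zz)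
  then have "g ((3/2) *\<^sub>R z) * (p j ((3/2) *\<^sub>R z) - u ((3/2) *\<^sub>R z) * p (j - 1) ((3/2) *\<^sub>R z))
     = p i ((3/2) *\<^sub>R z) - u ((3/2) *\<^sub>R z) * p (i - 1) ((3/2) *\<^sub>R z)"
    using G0 unfolding G_eq by (simp only: mult_eq_0_iff) simp
  moreover have "0 < (3/2 :: real)" by simp
  ultimately have fc: "\<forall>b\<in>B. \<forall>b'\<in>B. f b = f b'"
    using pointwise[OF refl _ z B] by blast
  have "B \<noteq> {}" using B(3) n by auto
  then obtain b0 where b0: "b0 \<in> B" by blast
  have "A z v = f b0 *\<^sub>R v" if "v \<bullet> z = 0" for v
  proof -
    have ex: "(\<Sum>b\<in>B. (v \<bullet> b) *\<^sub>R b) = v"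
      using orthonormal_expand[OF B(1) orthonormal_finite[OF B(1)]] B(2) that by simp
    have "A z v = (\<Sum>b\<in>B. (v \<bullet> b) *\<^sub>R A z b)"
      by (subst (1) ex[symmetric]) (simp add: linear_sum[OF A_linear[OF zz(2)]] linear_scale[OF A_linear[OF zz(2)]])
    also have "\<dots> = (\<Sum>b\<in>B. f b0 *\<^sub>R ((v \<bullet> b) *\<^sub>R b))"
      using B(4) fc b0 by (intro sum.cong refl) (metis scaleR_left_commute)
    also have "\<dots> = f b0 *\<^sub>R v" using ex by (simp only: scaleR_sum_right[symmetric])
    finally show ?thesis .
  qed
  then show ?thesis using B(5) b0 by blast
qed

text \<open>By the Codazzi equation the principal radius is constant.\<close>

lemma sphere_of_umbilic:
  assumes dim: "3 \<le> DIM('a)"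
    and umb: "\<And>z. norm z = 1 \<Longrightarrow> \<exists>\<mu>>0. \<forall>v. v \<bullet> z = 0 \<longrightarrow> A z v = \<mu> *\<^sub>R v"
  shows "\<exists>c R. R > 0 \<and> (\<forall>z. norm z = 1 \<longrightarrow> X z = c + R *\<^sub>R z \<and> (\<forall>v. v \<bullet> z = 0 \<longrightarrow> A z v = R *\<^sub>R v))"
proof -
  \<comment> \<open>The principal radius, expressed by a trace so that it inherits
    differentiability; dividing by \<open>DIM('a) - 1\<close> accounts for the radial eigenvalue
    zero.\<close>
  define L where "L x = optrace (A x) / (real (DIM('a)) - 1)" for x
  have N: "real (DIM('a)) - 1 > 0" using dim by simp
  have A_eq: "A x v = L x *\<^sub>R (v - ((v \<bullet> x) / (x \<bullet> x)) *\<^sub>R x) \<and> 0 < L x" if x: "x \<noteq> 0" for x v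
  proof -
    let ?z = "(1 / norm x) *\<^sub>R x"
    have z: "norm ?z = 1" "x = norm x *\<^sub>R ?z" "norm x > 0" "?z \<noteq> 0" using x by auto
    obtain \<mu> where mu: "\<mu> > 0" "\<And>v. v \<bullet> ?z = 0 \<Longrightarrow> A ?z v = \<mu> *\<^sub>R v" using umb[OF z(1)] by blast
    define \<kappa> where "\<kappa> = \<mu> / norm x"
    have k: "A x v = \<kappa> *\<^sub>R (v - ((v \<bullet> x) / (x \<bullet> x)) *\<^sub>R x)" for v
    proof -
      let ?v = "v - ((v \<bullet> x) / (x \<bullet> x)) *\<^sub>R x"
      have "?v \<bullet> ?z = 0" using x by (simp add: inner_diff_left)
      then have "A ?z ?v = \<mu> *\<^sub>R ?v" by (rule mu(2))
      then have "A x ?v = \<kappa> *\<^sub>R ?v"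
        using A_scale[OF z(4,3), of ?v] z(2) by (simp add: \<kappa>_def)
      then show ?thesis by (simp add: linear_diff[OF A_linear[OF x]] linear_scale[OF A_linear[OF x]] A_radial[OF x])
    qed
    have "optrace (A x) = (\<Sum>b\<in>Basis. \<kappa> * (b \<bullet> b - ((b \<bullet> x) * (x \<bullet> b)) / (x \<bullet> x)))"
      unfolding optrace_def k by (simp add: inner_diff_left)
    also have "\<dots> = \<kappa> * ((\<Sum>b\<in>(Basis :: 'a set). b \<bullet> b) - (\<Sum>b\<in>Basis. (x \<bullet> b) * (x \<bullet> b)) / (x \<bullet> x))"
      by (simp add: sum_distrib_left sum_subtractf sum_divide_distrib right_diff_distrib)
        (simp add: inner_commute)
    also have "\<dots> = \<kappa> * (real (DIM('a)) - 1)"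
      unfolding euclidean_inner[of x x, symmetric] using x by simp
    finally have "\<kappa> = L x" unfolding L_def using N by simp
    moreover have "0 < \<kappa>" unfolding \<kappa>_def using mu(1) z(3) by simp
    ultimately show ?thesis using k by simp
  qed
  have L_C1: "Ck_on 1 punctured L"
    unfolding L_def[abs_def] optrace_def divide_inverse
    by (intro Ck_on_mult Ck_on_sum Ck_on_inner A_C1 Ck_on_const open_punctured)
  define L' where "L' x = frechet_derivative L (at x)" for x
  have L': "(L has_derivative L' x) (at x)" if "x \<noteq> 0" for x
    unfolding L'_def using Ck_on_SucD(1)[of 0 punctured L x] L_C1 that by simp
  have L'_tan: "L' x c = 0" if x: "x \<noteq> 0" and c: "c \<bullet> x = 0" for x c
  proof -
    have D_eq: "D x c v = L' x c *\<^sub>R v - (L x * ((v \<bullet> c) / (x \<bullet> x))) *\<^sub>R x" if v: "v \<bullet> x = 0" for c v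
    proof -
      have q: "((\<lambda>y. (v \<bullet> y) / (y \<bullet> y)) has_derivative (\<lambda>c. (v \<bullet> c) / (x \<bullet> x))) (at x)"
        by (rule has_derivative_eq_rhs[OF has_derivative_divide'[OF has_derivative_inner_right[OF has_derivative_ident] has_derivative_inner[OF has_derivative_ident has_derivative_ident]]])
          (use x v in \<open>auto simp: fun_eq_iff\<close>)
      have "((\<lambda>y. L y *\<^sub>R (v - ((v \<bullet> y) / (y \<bullet> y)) *\<^sub>R y)) has_derivative
        (\<lambda>c. L x *\<^sub>R (0 - (((v \<bullet> x) / (x \<bullet> x)) *\<^sub>R c + ((v \<bullet> c) / (x \<bullet> x)) *\<^sub>R x)) + L' x c *\<^sub>R (v - ((v \<bullet> x) / (x \<bullet> x)) *\<^sub>R x))) (at x)"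
        by (rule has_derivative_scaleR[OF L'[OF x] has_derivative_diff[OF has_derivative_const has_derivative_scaleR[OF q has_derivative_ident]]])
      then have "((\<lambda>y. A y v) has_derivative
        (\<lambda>c. L x *\<^sub>R (0 - (((v \<bullet> x) / (x \<bullet> x)) *\<^sub>R c + ((v \<bullet> c) / (x \<bullet> x)) *\<^sub>R x)) + L' x c *\<^sub>R (v - ((v \<bullet> x) / (x \<bullet> x)) *\<^sub>R x))) (at x)"
        by (rule has_derivative_transform_within_open[OF _ open_punctured]) (use x A_eq in auto)
      from fun_cong[OF has_derivative_unique[OF A_deriv[OF x] this], of c] show ?thesis
        using v by simp
    qed
    \<comment> \<open>In dimension at least three there is a direction \<open>v\<close> orthogonal
      to both \<open>x\<close> and \<open>c\<close>; the Codazzi equation for \<open>c\<close> and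
      \<open>v\<close> then equates multiples of two orthogonal vectors.\<close>
    have "dim {x, c} < DIM('a)"
    proof -
      have "dim {x, c} \<le> card {x, c}" by (rule dim_le_card') simp
      also have "\<dots> \<le> 2" by (simp add: card_insert_if)
      finally show ?thesis using dim by simp
    qed
    then obtain v where v: "v \<noteq> 0" "\<And>y. y \<in> span {x, c} \<Longrightarrow> orthogonal v y"
      using orthogonal_to_subspace_exists by blast
    have vo: "v \<bullet> x = 0" "v \<bullet> c = 0" using v(2)[of x] v(2)[of c] by (auto simp: orthogonal_def span_base)
    have "L' x c *\<^sub>R v = L' x v *\<^sub>R c"
      using D_codazzi[OF x, of c v] D_eq[OF vo(1), of c] D_eq[OF c, of v] vo by (simp add: inner_commute)
    then have "(L' x c *\<^sub>R v) \<bullet> v = (L' x v *\<^sub>R c) \<bullet> v" by simp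
    then show ?thesis using v vo by (simp add: inner_commute)
  qed
  \<comment> \<open>\<open>L\<close> has degree -1, so this product has degree zero: its radial
    derivative vanishes as well as the tangential ones.\<close>
  define M where "M x = L x * norm x" for x
  have M': "(M has_derivative (\<lambda>_. 0)) (at x)" if x: "x \<noteq> 0" for x
  proof -
    have "(M has_derivative (\<lambda>v. L x * (sgn x \<bullet> v) + L' x v * norm x)) (at x)"
      unfolding M_def[abs_def]
      by (rule has_derivative_eq_rhs[OF has_derivative_mult[OF L'[OF x] has_derivative_norm[OF x]]])
        (auto simp: inner_commute)
    then obtain M' where M': "(M has_derivative M') (at x)" and e: "\<And>v. M' v = L x * (sgn x \<bullet> v) + L' x v * norm x"
      by blast
    have lin: "linear M'" using has_derivative_linear[OF M'] .
    have "M' x = 0"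
    proof (rule homogeneous_derivative_zero[OF M'])
      fix c :: real assume c: "c > 0"
      have "optrace (A (c *\<^sub>R x)) = optrace (A x) / c"
        unfolding optrace_def A_scale[OF x c] by (simp add: sum_divide_distrib)
      then show "M (c *\<^sub>R x) = M x" using c by (simp add: M_def L_def)
    qed
    moreover have "M' v = 0" if "v \<bullet> x = 0" for v
      using that L'_tan[OF x that] by (simp add: e sgn_div_norm inner_commute)
    ultimately have "M' v = 0" for v
    proof -
      have "v = (v - ((v \<bullet> x) / (x \<bullet> x)) *\<^sub>R x) + ((v \<bullet> x) / (x \<bullet> x)) *\<^sub>R x" by simp
      then have "M' v = M' (v - ((v \<bullet> x) / (x \<bullet> x)) *\<^sub>R x) + ((v \<bullet> x) / (x \<bullet> x)) *\<^sub>R M' x"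
        by (metis linear_add[OF lin] linear_scale[OF lin])
      also have "M' (v - ((v \<bullet> x) / (x \<bullet> x)) *\<^sub>R x) = 0"
        using \<open>\<And>v. v \<bullet> x = 0 \<Longrightarrow> M' v = 0\<close> x by (simp add: inner_diff_left)
      finally show ?thesis using \<open>M' x = 0\<close> by simp
    qed
    then have "M' = (\<lambda>_. 0)" by auto
    then show ?thesis using M' by simp
  qed
  have conn: "connected (punctured :: 'a set)"
    by (rule connected_punctured_universe) (use dim in simp)
  obtain e :: 'a where e: "e \<in> Basis" using nonempty_Basis by blast
  then have e0: "e \<noteq> 0" by auto
  define R where "R = M e"
  have MR: "M x = R" if "x \<noteq> 0" for x
    unfolding R_def
    by (rule has_derivative_zero_unique_connected[OF open_punctured conn]) (use M' e0 that in auto)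
  have Rpos: "R > 0" unfolding R_def M_def using A_eq[OF e0] e0 by simp
  \<comment> \<open>The candidate for the centre as a function of the normal direction; its
    derivative vanishes on the connected punctured space.\<close>
  define Y where "Y x = X x - (R / norm x) *\<^sub>R x" for x
  have Y': "(Y has_derivative (\<lambda>_. 0)) (at x)" if x: "x \<noteq> 0" for x
  proof -
    have nx: "norm x \<noteq> 0" "x \<bullet> x = norm x * norm x" using x by (auto simp: power2_norm_eq_inner[symmetric] power2_eq_square)
    have "((\<lambda>y. R / norm y) has_derivative (\<lambda>v. (0 * norm x - R * (v \<bullet> sgn x)) / (norm x * norm x))) (at x)"
      by (rule has_derivative_divide'[OF has_derivative_const has_derivative_norm[OF x] nx(1)])
    from has_derivative_diff[OF X_deriv[OF x] has_derivative_scaleR[OF this has_derivative_ident]]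
    have "(Y has_derivative (\<lambda>v. A x v - ((R / norm x) *\<^sub>R v + ((0 * norm x - R * (v \<bullet> sgn x)) / (norm x * norm x)) *\<^sub>R x))) (at x)"
      unfolding Y_def[abs_def] .
    moreover have "A x v - ((R / norm x) *\<^sub>R v + ((0 * norm x - R * (v \<bullet> sgn x)) / (norm x * norm x)) *\<^sub>R x) = 0" for v
    proof -
      have "L x = R / norm x" using MR[OF x] nx by (simp add: M_def field_simps)
      then have "A x v = (R / norm x) *\<^sub>R v - (R / norm x * ((v \<bullet> x) / (x \<bullet> x))) *\<^sub>R x"
        using A_eq[OF x, of v] by (simp add: scaleR_diff_right)
      then show ?thesis unfolding nx(2) by (simp add: sgn_div_norm divide_inverse algebra_simps)
    qed
    ultimately show ?thesis by simp
  qed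
  have AR: "A z v = R *\<^sub>R v" if "norm z = 1" "v \<bullet> z = 0" for z v
  proof -
    have "z \<noteq> 0" using that by auto
    then show ?thesis using A_eq[of z v] MR[of z] that by (simp add: M_def)
  qed
  have "X z = Y e + R *\<^sub>R z" if "norm z = 1" for z
  proof -
    have "Y z = Y e"
      by (rule has_derivative_zero_unique_connected[OF open_punctured conn]) (use Y' e0 that in auto)
    then show ?thesis using that by (simp add: Y_def algebra_simps)
  qed
  then show ?thesis using Rpos AR by blast
qed

end


section \<open>Tangent directions and local inverses\<close>

text \<open>\<open>v\<close> is a limit of secant directions of \<open>S\<close> at \<open>p\<close>.\<close>

definition approx_tangent :: "'a::real_normed_vector set \<Rightarrow> 'a \<Rightarrow> 'a \<Rightarrow> bool" where
  "approx_tangent S p v \<longleftrightarrow> (\<forall>e>0. \<exists>t r. 0 < t \<and> t < e \<and> norm r \<le> e * t \<and> p + t *\<^sub>R v + r \<in> S)"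

lemma approx_tangent_mono: "approx_tangent S p v \<Longrightarrow> S \<subseteq> T \<Longrightarrow> approx_tangent T p v"
  unfolding approx_tangent_def by blast

text \<open>Both derivatives approximate the same increments along secants converging to direction
  \<open>v\<close>. This determines derivatives within the sphere or a hypersurface on tangent
  vectors.\<close>

lemma derivative_unique_approx_tangent:
  fixes f :: "'a::real_normed_vector \<Rightarrow> 'b::real_normed_vector"
  assumes v: "approx_tangent S p v"
    and D: "(f has_derivative D1) (at p within S)" "(f has_derivative D2) (at p within S)"
  shows "D1 v = D2 v"
proof -
  let ?L = "\<lambda>x. D1 x - D2 x"
  have bl: "bounded_linear ?L"
    using D by (intro bounded_linear_sub has_derivative_bounded_linear)
  then have lin: "linear ?L" by (simp add: bounded_linear.linear)
  obtain C where C: "C > 0" "\<And>x. norm (?L x) \<le> norm x * C"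
    using bounded_linear.pos_bounded[OF bl] by blast
  have "norm (?L v) \<le> e" if e: "e > 0" for e
  proof -
    \<comment> \<open>The two approximation errors contribute \<open>2 * (norm v + 1)\<close> and
      the secant remainder \<open>r\<close> contributes \<open>C\<close>, each times
      \<open>c * t\<close>; hence \<open>c\<close> is chosen with
      \<open>c * k \<le> e\<close>.\<close>
    define k where "k = C + 2 * (norm v + 1)"
    have k: "k > 0" using C by (simp add: k_def add_pos_nonneg)
    define c where "c = min 1 (e / k)"
    have c: "c > 0" "c \<le> 1" "c * k \<le> e" using e k by (auto simp: c_def min_def field_simps)
    obtain d1 where d1: "d1 > 0" "\<And>y. y \<in> S \<Longrightarrow> norm (y - p) < d1 \<Longrightarrow> norm (f y - f p - D1 (y - p)) \<le> c * norm (y - p)"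
      using D(1) c unfolding has_derivative_within_alt by blast
    obtain d2 where d2: "d2 > 0" "\<And>y. y \<in> S \<Longrightarrow> norm (y - p) < d2 \<Longrightarrow> norm (f y - f p - D2 (y - p)) \<le> c * norm (y - p)"
      using D(2) c unfolding has_derivative_within_alt by blast
    define b where "b = min c (min d1 d2 / (norm v + 1))"
    have nv: "norm v + 1 > 0" by (simp add: add_nonneg_pos)
    have b: "b > 0" using c d1 d2 nv by (simp add: b_def)
    obtain t r where t: "0 < t" "t < b" "norm r \<le> b * t" "p + t *\<^sub>R v + r \<in> S"
      using v b unfolding approx_tangent_def by blast
    let ?y = "p + t *\<^sub>R v + r"
    have rc: "norm r \<le> c * t" using t(1,3) by (smt (verit) b_def mult_right_mono)
    also have "\<dots> \<le> t" using c t by simp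
    finally have rt: "norm r \<le> t" .
    have ny: "norm (?y - p) \<le> t * (norm v + 1)"
      using norm_triangle_ineq[of "t *\<^sub>R v" r] rt t by (simp add: algebra_simps)
    also have "\<dots> < min d1 d2"
    proof -
      have "t < min d1 d2 / (norm v + 1)" using t(2) by (simp add: b_def)
      then show ?thesis using nv by (simp only: pos_less_divide_eq)
    qed
    finally have ny': "norm (?y - p) < d1" "norm (?y - p) < d2" by (simp_all only: min_less_iff_conj)
    note d1(2)[OF t(4) ny'(1)] d2(2)[OF t(4) ny'(2)]
    moreover have "?L (?y - p) = (f ?y - f p - D2 (?y - p)) - (f ?y - f p - D1 (?y - p))" by simp
    ultimately have "norm (?L (?y - p)) \<le> 2 * (c * norm (?y - p))"
      using norm_triangle_ineq4[of "f ?y - f p - D2 (?y - p)" "f ?y - f p - D1 (?y - p)"] by simp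
    also have "\<dots> \<le> 2 * (c * (t * (norm v + 1)))" using ny c by simp
    finally have 1: "norm (?L (?y - p)) \<le> 2 * (c * (t * (norm v + 1)))" .
    have "t *\<^sub>R ?L v = ?L (?y - p) - ?L r"
    proof -
      have "?L (?y - p) = ?L (t *\<^sub>R v) + ?L r" using linear_add[OF lin, of "t *\<^sub>R v" r] by simp
      then show ?thesis using linear_scale[OF lin, of t v] by simp
    qed
    then have "t * norm (?L v) \<le> norm (?L (?y - p)) + norm (?L r)"
      using norm_triangle_ineq4[of "?L (?y - p)" "?L r"] t(1) by (metis abs_of_pos norm_scaleR)
    also have "norm (?L r) \<le> c * t * C"
      by (rule order_trans[OF C(2)]) (use rc C in \<open>simp add: mult_right_mono\<close>)
    finally have "t * norm (?L v) \<le> t * (c * k)"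
      using 1 by (simp add: k_def algebra_simps)
    then show ?thesis using t(1) c(3) by simp
  qed
  then have "norm (?L v) \<le> 0" by (metis field_le_epsilon add_0)
  then show ?thesis by simp
qed

text \<open>Moving transversally by a small amount, the intermediate value theorem reaches the level set.\<close>

lemma approx_tangent_level_set:
  fixes F :: "'a::real_normed_vector \<Rightarrow> real"
  assumes U: "open U" "p \<in> U" and F: "continuous_on U F" "(F has_derivative F') (at p)" "F p = 0"
    and n: "F' n \<noteq> 0" and v: "F' v = 0"
  shows "approx_tangent {x\<in>U. F x = 0} p v"
  unfolding approx_tangent_def
proof (intro allI impI)
  fix e :: real assume e: "e > 0"
  define a where "a = e / (norm n + 1)"
  have nn: "norm n + 1 > 0" "norm v + 1 > 0" by (simp_all add: add_nonneg_pos)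
  have a: "a > 0" using e nn by (simp add: a_def)
  have an: "a * norm n \<le> e" using e nn unfolding a_def by (simp add: field_simps)
  \<comment> \<open>With this tolerance the first-order error is at most half of
    \<open>a * t * \<bar>F' n\<bar>\<close>, the change of \<open>F'\<close> under the largest
    transversal shift allowed.\<close>
  define c where "c = a * \<bar>F' n\<bar> / (2 * (norm v + e + 1))"
  have ve: "norm v + e + 1 > 0" using e by (simp add: add_nonneg_pos)
  have c: "c > 0" using a n ve by (simp add: c_def)
  obtain d where d: "d > 0" "\<And>y. norm (y - p) < d \<Longrightarrow> norm (F y - F p - F' (y - p)) \<le> c * norm (y - p)"
    using F(2) c unfolding has_derivative_at_alt by blast
  obtain r where r: "r > 0" "ball p r \<subseteq> U" using U openE by blast
  define t where "t = min (e / 2) (min d r / (2 * (norm v + e + 1)))"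
  have t: "t > 0" "t < e" using e d r ve by (auto simp: t_def min_less_iff_disj)
  have tm: "t * (norm v + e + 1) < min d r"
  proof -
    have "t * (norm v + e + 1) \<le> (min d r / (2 * (norm v + e + 1))) * (norm v + e + 1)"
      using ve by (intro mult_right_mono) (auto simp: t_def)
    also have "\<dots> = min d r / 2" using ve by (simp add: field_simps)
    also have "\<dots> < min d r" using d(1) r(1) by linarith
    finally show ?thesis .
  qed
  let ?y = "\<lambda>s. p + t *\<^sub>R v + s *\<^sub>R n"
  have lin: "linear F'" using has_derivative_linear[OF F(2)] .
  have bound: "norm (t *\<^sub>R v + s *\<^sub>R n) \<le> t * (norm v + e)" if "\<bar>s\<bar> \<le> a * t" for s
  proof -
    have "norm (s *\<^sub>R n) \<le> (a * t) * norm n" using that by (simp add: mult_right_mono)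
    also have "\<dots> \<le> t * e" using an t by (simp add: mult.commute mult.left_commute)
    finally show ?thesis
      using norm_triangle_ineq[of "t *\<^sub>R v" "s *\<^sub>R n"] t by (simp add: algebra_simps)
  qed
  have near: "norm (?y s - p) < min d r" if "\<bar>s\<bar> \<le> a * t" for s
  proof -
    have "norm (?y s - p) \<le> t * (norm v + e)" using bound[OF that] by (simp add: add.assoc)
    also have "\<dots> \<le> t * (norm v + e + 1)" using t by simp
    finally show ?thesis using tm by simp
  qed
  have inU: "?y s \<in> U" if "\<bar>s\<bar> \<le> a * t" for s
  proof -
    have "dist p (?y s) < r" using near[OF that] by (simp only: dist_norm norm_minus_commute[of p] min_less_iff_conj)
    then show ?thesis using r(2) by auto
  qed
  have est: "\<bar>F (?y s) - s * F' n\<bar> < a * t * \<bar>F' n\<bar>" if s: "\<bar>s\<bar> \<le> a * t" for s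
  proof -
    have "F' (?y s - p) = s * F' n"
      using v linear_add[OF lin, of "t *\<^sub>R v" "s *\<^sub>R n"] linear_scale[OF lin] by (simp add: add.assoc)
    then have "\<bar>F (?y s) - s * F' n\<bar> \<le> c * norm (?y s - p)"
      using d(2)[of "?y s"] near[OF s] F(3) by simp
    also have "\<dots> \<le> c * (t * (norm v + e + 1))"
      using bound[OF s] c t by (intro mult_left_mono) (auto simp: add.assoc algebra_simps intro: order_trans)
    also have "\<dots> = a * t * \<bar>F' n\<bar> / 2" unfolding c_def using ve by (simp add: field_simps)
    also have "\<dots> < a * t * \<bar>F' n\<bar>" using a t n by simp
    finally show ?thesis .
  qed
  \<comment> \<open>The factor \<open>sgn (F' n)\<close> orients the function: it is nonpositive at
    the left end and nonnegative at the right end for either sign of \<open>F' n\<close>.\<close>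
  have cont: "continuous_on {- (a * t)..a * t} (\<lambda>s. F (?y s) * sgn (F' n))"
    by (intro continuous_intros continuous_on_compose2[OF F(1)]) (use inU in \<open>auto simp: abs_le_iff\<close>)
  have at: "a * t > 0" using a t by simp
  have sg: "F' n * sgn (F' n) = \<bar>F' n\<bar>" by (simp add: abs_sgn)
  have "F (?y (a * t)) * sgn (F' n) \<ge> 0"
    using est[of "a * t"] at n by (cases "F' n > 0") (auto simp: sgn_if abs_if split: if_splits)
  moreover have "F (?y (- (a * t))) * sgn (F' n) \<le> 0"
    using est[of "- (a * t)"] at n by (cases "F' n > 0") (auto simp: sgn_if abs_if split: if_splits)
  ultimately obtain s where s: "- (a * t) \<le> s" "s \<le> a * t" "F (?y s) * sgn (F' n) = 0"
    using IVT'[of "\<lambda>s. F (?y s) * sgn (F' n)" "- (a * t)" 0 "a * t"] cont at by auto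
  then have "F (?y s) = 0" "\<bar>s\<bar> \<le> a * t" using n by (auto simp: sgn_if split: if_splits)
  moreover have "norm (s *\<^sub>R n) \<le> e * t"
  proof -
    have "norm (s *\<^sub>R n) \<le> (a * t) * norm n" using \<open>\<bar>s\<bar> \<le> a * t\<close> by (simp add: mult_right_mono)
    also have "\<dots> = a * norm n * t" by simp
    also have "\<dots> \<le> e * t" using an t by (intro mult_right_mono) auto
    finally show ?thesis .
  qed
  ultimately show "\<exists>t r. 0 < t \<and> t < e \<and> norm r \<le> e * t \<and> p + t *\<^sub>R v + r \<in> {x \<in> U. F x = 0}"
    using t inU by blast
qed

lemma approx_tangent_sphere:
  fixes z :: "'a::euclidean_space"
  assumes "norm z = 1" "v \<bullet> z = 0"
  shows "approx_tangent (sphere 0 1) z v"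
proof -
  have "approx_tangent {x\<in>UNIV. x \<bullet> x - 1 = 0} z v"
  proof (rule approx_tangent_level_set)
    show "((\<lambda>x. x \<bullet> x - 1) has_derivative (\<lambda>v. z \<bullet> v + v \<bullet> z)) (at z)"
      by (auto intro!: derivative_eq_intros)
    show "continuous_on UNIV (\<lambda>x::'a. x \<bullet> x - 1)" by (intro continuous_intros)
    show "z \<bullet> z + z \<bullet> z \<noteq> 0" using assms by (simp add: norm_eq_1)
  qed (use assms in \<open>auto simp: inner_commute norm_eq_1\<close>)
  then show ?thesis by (rule approx_tangent_mono) (auto simp: norm_eq_1)
qed

text \<open>The inverse function theorem gives \<open>g\<close> with derivative inverse to that of
  \<open>f\<close> at \<open>g y\<close>. If \<open>g\<close> is of class \<open>k\<close>, so is
  this operator by \<open>Ck_on_inverse_operator\<close>, and \<open>g\<close> gains one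
  order.\<close>

lemma smooth_inverse_function:
  fixes f :: "'a::euclidean_space \<Rightarrow> 'a"
  assumes U: "open U" "x0 \<in> U" and f: "\<And>k. Ck_on k U f"
    and inj: "\<And>v. frechet_derivative f (at x0) v = 0 \<Longrightarrow> v = 0"
  obtains U' V g where "open U'" "U' \<subseteq> U" "x0 \<in> U'" "open V" "f x0 \<in> V" "homeomorphism U' V f g"
    "\<And>k. Ck_on k V g"
proof -
  let ?D = "\<lambda>x. frechet_derivative f (at x)"
  have der: "(f has_derivative ?D x) (at x)" if "x \<in> U" for x
    using Ck_on_SucD(1)[OF f that] .
  have DC: "Ck_on k U (\<lambda>x. ?D x v)" for k v using Ck_on_SucD(2)[OF f] .
  define f' where "f' x = Blinfun (?D x)" for x
  have app: "blinfun_apply (f' x) = ?D x" if "x \<in> U" for x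
    unfolding f'_def by (rule bounded_linear_Blinfun_apply[OF has_derivative_bounded_linear[OF der[OF that]]])
  have derf: "(f has_derivative blinfun_apply (f' x)) (at x)" if "x \<in> U" for x
    using der app that by simp
  have contf: "continuous_on U f'"
  proof (rule continuous_on_blinfun_componentwise)
    fix i :: 'a
    show "continuous_on U (\<lambda>x. blinfun_apply (f' x) i)"
      using Ck_on_imp_continuous_on[OF DC[of 0 i]] app by (simp cong: continuous_on_cong)
  qed
  have lin0: "linear (?D x0)" using has_derivative_linear[OF der[OF U(2)]] .
  have "inj (?D x0)" using inj linear_injective_0[OF lin0] by blast
  then obtain g' where g': "linear g'" "g' \<circ> ?D x0 = id"
    using linear_injective_left_inverse[OF lin0] by blast
  have "Blinfun g' o\<^sub>L f' x0 = id_blinfun"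
  proof (rule blinfun_eqI)
    fix v
    have "bounded_linear g'" using g' linear_conv_bounded_linear by blast
    then show "blinfun_apply (Blinfun g' o\<^sub>L f' x0) v = blinfun_apply id_blinfun v"
      using g'(2) app[OF U(2)] by (simp add: bounded_linear_Blinfun_apply fun_eq_iff)
  qed
  then obtain U' V g G where g: "open U'" "U' \<subseteq> U" "x0 \<in> U'" "open V" "f x0 \<in> V" "homeomorphism U' V f g"
    "\<And>y. y \<in> V \<Longrightarrow> (g has_derivative (G y)) (at y)"
    "\<And>y. y \<in> V \<Longrightarrow> G y = inv (blinfun_apply (f' (g y)))"
    "\<And>y. y \<in> V \<Longrightarrow> bij (blinfun_apply (f' (g y)))"
    using inverse_function_theorem[OF U(1) derf contf U(2)] by metis
  have gU: "g y \<in> U" if "y \<in> V" for y using that g(2,6) homeomorphism_image2 by blast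
  have "Ck_on k V g" for k
  proof (induction k)
    case 0
    show ?case using g(6) by (simp add: Ck_on.simps homeomorphism_def)
  next
    case (Suc k)
    have M: "Ck_on k V (\<lambda>y. ?D (g y) v)" for v
      by (rule Ck_on_compose[OF g(4) U(1) gU DC Suc])
    have bij: "bij (?D (g y))" "G y = inv (?D (g y))" if "y \<in> V" for y
      using g(8,9)[OF that] app[OF gU[OF that]] by auto
    have "Ck_on k V (\<lambda>y. G y v)" for v
    proof (rule Ck_on_inverse_operator[OF g(4), where M = "\<lambda>y. ?D (g y)"])
      show "linear (G y)" if "y \<in> V" for y using has_derivative_linear[OF g(7)[OF that]] .
      show "linear (?D (g y))" if "y \<in> V" for y using has_derivative_linear[OF der[OF gU[OF that]]] .
      show "G y (?D (g y) v) = v" if "y \<in> V" for y v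
        using bij[OF that] by (simp add: bij_is_inj)
      show "?D (g y) (G y v) = v" if "y \<in> V" for y v
        using bij[OF that] by (simp add: bij_is_surj surj_f_inv_f)
      show "Ck_on k V (\<lambda>y. ?D (g y) v)" for v by (rule M)
    qed
    then show ?case by (intro Ck_on_SucI[OF g(4) g(7)])
  qed
  then show ?thesis using that g by blast
qed


section \<open>The inverse Gauss map\<close>

locale smooth_convex_body =
  fixes M K :: "'a::euclidean_space set"
  assumes ssc: "smooth_strictly_convex M K"
begin

lemma compact_K: "compact K" and convex_K: "convex K" and zero_interior: "0 \<in> interior K"
  and M_eq: "M = frontier K" and smooth_M: "smooth_hypersurface M"
  and curvature: "\<And>p. p \<in> M \<Longrightarrow> 0 < Gauss_curvature M K p"
  using ssc unfolding smooth_strictly_convex_def bounds_convex_body_def by auto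

lemma M_subset: "M \<subseteq> K"
  using M_eq compact_imp_closed[OF compact_K] frontier_subset_closed by blast

text \<open>\<open>z\<close> is a direction of arbitrary length, so that contact points are defined
  on the punctured space and not only on the sphere.\<close>

definition supports :: "'a \<Rightarrow> 'a \<Rightarrow> bool" where
  "supports z p \<longleftrightarrow> p \<in> K \<and> (\<forall>x\<in>K. x \<bullet> z \<le> p \<bullet> z)"

lemma supports_scale: "c > 0 \<Longrightarrow> supports (c *\<^sub>R z) p \<longleftrightarrow> supports z p"
  by (simp add: supports_def)

lemma supports_frontier:
  assumes z: "z \<noteq> 0" and p: "supports z p"
  shows "p \<in> M"
proof -
  have "p \<notin> interior K"
  proof
    assume "p \<in> interior K"
    then obtain e where e: "e > 0" "cball p e \<subseteq> K" using mem_interior_cball by blast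
    define q where "q = p + (e / norm z) *\<^sub>R z"
    have "q \<in> cball p e" unfolding q_def using e z by (simp add: dist_norm)
    then have "q \<bullet> z \<le> p \<bullet> z" using e p by (auto simp: supports_def)
    moreover have "q \<bullet> z = p \<bullet> z + (e / norm z) * (z \<bullet> z)" by (simp add: q_def inner_add_left)
    moreover have "(e / norm z) * (z \<bullet> z) > 0" using e z by simp
    ultimately show False by simp
  qed
  then show ?thesis
    using p compact_imp_closed[OF compact_K] by (simp add: M_eq frontier_def supports_def)
qed

lemma supports_pos:
  assumes z: "z \<noteq> 0" and p: "supports z p"
  shows "0 < p \<bullet> z"
proof -
  obtain e where e: "e > 0" "cball 0 e \<subseteq> K" using zero_interior mem_interior_cball by blast
  define q where "q = (e / norm z) *\<^sub>R z"
  have "q \<in> cball 0 e" unfolding q_def using e z by simp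
  then have "q \<bullet> z \<le> p \<bullet> z" using e p by (auto simp: supports_def)
  moreover have "q \<bullet> z > 0" using e z by (simp add: q_def)
  ultimately show ?thesis by simp
qed

lemma exists_support_normal:
  assumes p: "p \<in> M"
  shows "\<exists>z. norm z = 1 \<and> supports z p"
proof -
  have "interior K \<noteq> {}" using zero_interior by blast
  then have "rel_interior K = interior K" by (rule rel_interior_nonempty_interior)
  then have "p \<notin> rel_interior K" using p by (simp add: M_eq frontier_def)
  moreover have "p \<in> K" using p M_subset by blast
  ultimately have "p \<notin> rel_interior K" "p \<in> K" by auto
  obtain a where a: "a \<noteq> 0" "\<And>y. y \<in> K \<Longrightarrow> a \<bullet> p \<le> a \<bullet> y"
    by (rule supporting_hyperplane_rel_boundary[OF convex_K \<open>p \<in> K\<close> \<open>p \<notin> rel_interior K\<close>], rule that)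
  have "supports (- a) p" using a \<open>p \<in> K\<close> by (auto simp: supports_def inner_commute)
  then have "supports ((1 / norm a) *\<^sub>R (- a)) p" using a(1) by (subst supports_scale) auto
  moreover have "norm ((1 / norm a) *\<^sub>R (- a)) = 1" using a(1) by simp
  ultimately show ?thesis by blast
qed

text \<open>Secants from \<open>p\<close> end in \<open>K\<close> and so cannot rise above the
  supporting hyperplane.\<close>

lemma supports_approx_tangent:
  assumes z: "supports z p" and v: "approx_tangent M p v"
  shows "v \<bullet> z \<le> 0"
proof (rule field_le_epsilon)
  fix e :: real assume e: "e > 0"
  define d where "d = e / (norm z + 1)"
  have nz: "norm z + 1 > 0" by (simp add: add_nonneg_pos)
  have d: "d > 0" using e nz by (simp add: d_def)
  obtain t r where t: "0 < t" "norm r \<le> d * t" "p + t *\<^sub>R v + r \<in> M"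
    using v d unfolding approx_tangent_def by blast
  have "(p + t *\<^sub>R v + r) \<bullet> z \<le> p \<bullet> z" using z t M_subset by (auto simp: supports_def)
  then have "t * (v \<bullet> z) \<le> - (r \<bullet> z)" by (simp add: inner_add_left)
  also have "\<dots> \<le> norm r * norm z" using norm_cauchy_schwarz[of "- r" z] by simp
  also have "\<dots> \<le> (d * t) * (norm z + 1)" using t d by (intro mult_mono) auto
  also have "\<dots> = t * e" using nz by (simp add: d_def)
  finally show "v \<bullet> z \<le> 0 + e" using t by simp
qed

definition chart :: "'a set \<Rightarrow> ('a \<Rightarrow> real) \<Rightarrow> ('a \<Rightarrow> 'a) \<Rightarrow> bool" where
  "chart U F g \<longleftrightarrow> open U \<and> (\<forall>k. Ck_on k U F) \<and> (\<forall>k. Ck_on k U g) \<and>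
     (\<forall>x\<in>U. (F has_derivative (\<lambda>v. g x \<bullet> v)) (at x)) \<and> (\<forall>x\<in>U. g x \<noteq> 0) \<and> M \<inter> U = {x\<in>U. F x = 0}"

lemma chart_approx_tangent:
  assumes ch: "chart U F g" and p: "p \<in> M \<inter> U" and v: "g p \<bullet> v = 0"
  shows "approx_tangent M p v"
proof -
  have "approx_tangent {x\<in>U. F x = 0} p v"
  proof (rule approx_tangent_level_set)
    show "open U" "p \<in> U" using ch p by (auto simp: chart_def)
    show "continuous_on U F" using ch Ck_on_imp_continuous_on by (auto simp: chart_def)
    show "(F has_derivative (\<lambda>v. g p \<bullet> v)) (at p)" "F p = 0" "g p \<bullet> g p \<noteq> 0" using ch p by (auto simp: chart_def)
  qed (use v in simp)
  moreover have "{x\<in>U. F x = 0} \<subseteq> M" using ch by (auto simp: chart_def)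
  ultimately show ?thesis by (rule approx_tangent_mono)
qed

text \<open>The component of \<open>z\<close> orthogonal to the gradient is tangent to
  \<open>M\<close>; its inner product with \<open>z\<close> is its squared length and is nonpositive
  by the previous bound on tangents.\<close>

lemma chart_normal_parallel:
  assumes ch: "chart U F g" and p: "p \<in> M \<inter> U" and z: "supports z p"
  shows "z = ((z \<bullet> g p) / (g p \<bullet> g p)) *\<^sub>R g p"
proof -
  define v where "v = z - ((z \<bullet> g p) / (g p \<bullet> g p)) *\<^sub>R g p"
  have g0: "g p \<noteq> 0" using ch p by (auto simp: chart_def)
  then have v: "v \<bullet> g p = 0" by (simp add: v_def inner_diff_left)
  have "v \<bullet> z \<le> 0"
    by (rule supports_approx_tangent[OF z chart_approx_tangent[OF ch p]]) (use v in \<open>simp add: inner_commute\<close>)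
  moreover have "v \<bullet> z = v \<bullet> v" using v by (simp add: v_def inner_diff_right)
  ultimately have "v \<bullet> v = 0" using inner_ge_zero[of v] by linarith
  then show ?thesis by (simp add: v_def)
qed

text \<open>A supporting normal has positive inner product with \<open>p\<close>, since the origin
  is interior. Hence the gradient is not orthogonal to \<open>p\<close>, and a sign change and a
  smaller neighbourhood make it point outward.\<close>

lemma exists_chart:
  assumes p: "p \<in> M"
  obtains U F g where "chart U F g" "p \<in> U" "\<And>x. x \<in> U \<Longrightarrow> 0 < g x \<bullet> x"
proof -
  from bspec[OF smooth_M[unfolded smooth_hypersurface_def] p]
  obtain U0 and F0 :: "'a \<Rightarrow> real" where "open U0 \<and> p \<in> U0 \<and> smooth_on U0 F0 \<and>
    (\<forall>x\<in>U0. frechet_derivative F0 (at x) \<noteq> (\<lambda>v. 0)) \<and> M \<inter> U0 = {x\<in>U0. F0 x = 0}"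
    by (elim exE)
  then have U0: "open U0" "p \<in> U0" "smooth_on U0 F0"
    "\<forall>x\<in>U0. frechet_derivative F0 (at x) \<noteq> (\<lambda>v. 0)" "M \<inter> U0 = {x\<in>U0. F0 x = 0}"
    by simp_all
  have C: "Ck_on k U0 F0" for k using U0(3) by (simp add: smooth_on_def)
  define g0 where "g0 x = (\<Sum>b\<in>Basis. frechet_derivative F0 (at x) b *\<^sub>R b)" for x
  have der: "(F0 has_derivative frechet_derivative F0 (at x)) (at x)" if "x \<in> U0" for x
    using Ck_on_SucD(1)[OF C that] .
  have g0: "frechet_derivative F0 (at x) = (\<lambda>v. g0 x \<bullet> v)" if "x \<in> U0" for x
  proof
    fix v
    have "frechet_derivative F0 (at x) v = (\<Sum>b\<in>Basis. (v \<bullet> b) *\<^sub>R frechet_derivative F0 (at x) b)"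
      by (rule linear_Basis_expand[OF has_derivative_linear[OF der[OF that]]])
    then show "frechet_derivative F0 (at x) v = g0 x \<bullet> v"
      unfolding g0_def inner_sum_left inner_scaleR_left real_scaleR_def by (simp add: inner_commute[of v] mult.commute)
  qed
  have g0C: "Ck_on k U0 g0" for k
  proof -
    have "Ck_on k U0 (\<lambda>x. frechet_derivative F0 (at x) b)" for b
      by (rule Ck_on_SucD(2)[OF C])
    then show ?thesis
      unfolding g0_def[abs_def] using U0(1) by (intro Ck_on_sum Ck_on_scaleR Ck_on_const)
  qed
  have ch0: "chart U0 F0 g0"
    unfolding chart_def
  proof (intro conjI allI ballI)
    show "(F0 has_derivative (\<lambda>v. g0 x \<bullet> v)) (at x)" if "x \<in> U0" for x
      using der[OF that] g0[OF that] by simp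
    show "g0 x \<noteq> 0" if "x \<in> U0" for x
    proof
      assume "g0 x = 0"
      then have "frechet_derivative F0 (at x) = (\<lambda>v. 0)" using g0[OF that] by simp
      then show False using U0(4) that by blast
    qed
  qed (use U0 C g0C in auto)
  obtain z where z: "norm z = 1" "supports z p" using exists_support_normal[OF p] by blast
  have z_eq: "z = ((z \<bullet> g0 p) / (g0 p \<bullet> g0 p)) *\<^sub>R g0 p"
    by (rule chart_normal_parallel[OF ch0 _ z(2)]) (use p U0 in auto)
  have "0 < p \<bullet> z" by (rule supports_pos[OF _ z(2)]) (use z in auto)
  then have gp: "g0 p \<bullet> p \<noteq> 0"
    using z_eq by (metis inner_commute inner_scaleR_left less_irrefl mult_zero_right)
  define \<sigma> where "\<sigma> = sgn (g0 p \<bullet> p)"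
  have s: "\<sigma> \<noteq> 0" "\<sigma> * (g0 p \<bullet> p) > 0" using gp by (auto simp: \<sigma>_def sgn_if)
  define U where "U = {x\<in>U0. 0 < \<sigma> * (g0 x \<bullet> x)}"
  have oU: "open U"
  proof -
    have "continuous_on U0 (\<lambda>x. \<sigma> * (g0 x \<bullet> x))"
      using Ck_on_imp_continuous_on[OF g0C] by (intro continuous_intros)
    then have "open (U0 \<inter> (\<lambda>x. \<sigma> * (g0 x \<bullet> x)) -` {0<..})"
      using U0(1) by (intro continuous_open_preimage) auto
    moreover have "U = U0 \<inter> (\<lambda>x. \<sigma> * (g0 x \<bullet> x)) -` {0<..}" by (auto simp: U_def)
    ultimately show ?thesis by simp
  qed
  have sub: "U \<subseteq> U0" by (auto simp: U_def)
  have "chart U (\<lambda>x. \<sigma> * F0 x) (\<lambda>x. \<sigma> *\<^sub>R g0 x)"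
    unfolding chart_def
  proof (intro conjI allI ballI)
    show "Ck_on k U (\<lambda>x. \<sigma> * F0 x)" for k
      by (intro Ck_on_mult Ck_on_const oU Ck_on_subset[OF C sub])
    show "Ck_on k U (\<lambda>x. \<sigma> *\<^sub>R g0 x)" for k
      by (intro Ck_on_scaleR Ck_on_const oU Ck_on_subset[OF g0C sub])
    show "((\<lambda>x. \<sigma> * F0 x) has_derivative (\<lambda>v. \<sigma> *\<^sub>R g0 x \<bullet> v)) (at x)" if "x \<in> U" for x
      using has_derivative_mult_right[OF der, of x \<sigma>] g0[of x] that sub by auto
    show "\<sigma> *\<^sub>R g0 x \<noteq> 0" if "x \<in> U" for x using that by (auto simp: U_def)
    show "M \<inter> U = {x \<in> U. \<sigma> * F0 x = 0}" using U0(5) s by (auto simp: U_def)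
  qed (rule oU)
  moreover have "p \<in> U" using U0 s by (simp add: U_def)
  moreover have "0 < (\<sigma> *\<^sub>R g0 x) \<bullet> x" if "x \<in> U" for x using that by (simp add: U_def)
  ultimately show ?thesis using that by blast
qed

lemma chart_supports_unique:
  assumes ch: "chart U F g" and pos: "0 < g p \<bullet> p" and p: "p \<in> M \<inter> U" and z: "norm z = 1" "supports z p"
  shows "z = (1 / norm (g p)) *\<^sub>R g p"
proof -
  define c where "c = (z \<bullet> g p) / (g p \<bullet> g p)"
  have zc: "z = c *\<^sub>R g p" unfolding c_def by (rule chart_normal_parallel[OF ch p z(2)])
  have "0 < p \<bullet> z" by (rule supports_pos[OF _ z(2)]) (use z in auto)
  then have "0 < c * (g p \<bullet> p)" by (simp add: zc inner_commute)
  then have "c > 0" using pos by (simp add: zero_less_mult_iff)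
  moreover have "\<bar>c\<bar> * norm (g p) = 1" using z(1) by (simp add: zc)
  ultimately have c1: "c * norm (g p) = 1" by simp
  then have "norm (g p) \<noteq> 0" by auto
  with c1 have "c = 1 / norm (g p)" by (simp add: nonzero_eq_divide_eq)
  then show ?thesis using zc by simp
qed

lemma normal_unique:
  assumes "p \<in> M" "norm z = 1" "supports z p" "norm z' = 1" "supports z' p"
  shows "z = z'"
proof -
  obtain U F g where ch: "chart U F g" "p \<in> U" "\<And>x. x \<in> U \<Longrightarrow> 0 < g x \<bullet> x"
    by (rule exists_chart[OF assms(1)], rule that)
  have p: "p \<in> M \<inter> U" using assms ch by blast
  show ?thesis
    using chart_supports_unique[OF ch(1) ch(3)[OF ch(2)] p assms(2,3)]
      chart_supports_unique[OF ch(1) ch(3)[OF ch(2)] p assms(4,5)] by simp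
qed

abbreviation \<nu> :: "'a \<Rightarrow> 'a" where "\<nu> \<equiv> outer_normal K"

lemma outer_normal_eq:
  assumes "p \<in> M" "norm z = 1" "supports z p"
  shows "\<nu> p = z"
  unfolding outer_normal_def
proof (rule the_equality)
  show "norm z = 1 \<and> (\<forall>x\<in>K. x \<bullet> z \<le> p \<bullet> z)" using assms by (simp add: supports_def)
  fix y assume "norm y = 1 \<and> (\<forall>x\<in>K. x \<bullet> y \<le> p \<bullet> y)"
  then have "norm y = 1" "supports y p" using assms(1) M_subset by (auto simp: supports_def)
  then show "y = z" using normal_unique[OF assms(1)] assms by blast
qed

lemma outer_normal:
  assumes "p \<in> M"
  shows "norm (\<nu> p) = 1" "supports (\<nu> p) p"
proof -
  obtain z where z: "norm z = 1" "supports z p" using exists_support_normal[OF assms] by blast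
  then have "\<nu> p = z" by (rule outer_normal_eq[OF assms])
  then show "norm (\<nu> p) = 1" "supports (\<nu> p) p" using z by simp_all
qed

text \<open>Extends the outer normal off \<open>M\<close>, so that it has a derivative in all
  directions.\<close>

definition unit_field :: "('a \<Rightarrow> 'a) \<Rightarrow> 'a \<Rightarrow> 'a" where
  "unit_field g x = inverse (norm (g x)) *\<^sub>R g x"

lemma chart_outer_normal:
  assumes ch: "chart U F g" and pos: "\<And>x. x \<in> U \<Longrightarrow> 0 < g x \<bullet> x" and p: "p \<in> M \<inter> U"
  shows "\<nu> p = unit_field g p"
proof -
  have pM: "p \<in> M" "p \<in> U" using p by auto
  show ?thesis
    using chart_supports_unique[OF ch pos[OF pM(2)] p outer_normal[OF pM(1)]]
    by (simp add: unit_field_def divide_inverse)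
qed

lemma unit_field_smooth:
  assumes "chart U F g"
  shows "Ck_on k U (unit_field g)"
  unfolding unit_field_def[abs_def]
  by (intro Ck_on_scaleR Ck_on_inverse Ck_on_norm) (use assms in \<open>auto simp: chart_def\<close>)

lemma unit_field_norm:
  assumes "chart U F g" "x \<in> U"
  shows "norm (unit_field g x) = 1"
  using assms by (auto simp: unit_field_def chart_def)

text \<open>On tangent vectors the derivative is a multiple of the Hessian of \<open>F\<close>,
  hence symmetric and diagonalizable. Positive Gauss curvature says only that the product of the
  eigenvalues is positive, which excludes a kernel; signs are settled by convexity in
  \<open>X_derivative_nonneg\<close>.\<close>

lemma shape_operator:
  assumes ch: "chart U F g" and pos: "\<And>x. x \<in> U \<Longrightarrow> 0 < g x \<bullet> x" and p: "p \<in> M \<inter> U"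
  defines "N' \<equiv> frechet_derivative (unit_field g) (at p)"
  shows "(unit_field g has_derivative N') (at p)" "\<And>v. N' v \<bullet> \<nu> p = 0"
    "\<And>v. v \<bullet> \<nu> p = 0 \<Longrightarrow> N' v = 0 \<Longrightarrow> v = 0"
proof -
  let ?N = "unit_field g"
  have U: "open U" "p \<in> U" using ch p by (auto simp: chart_def)
  have nu: "\<nu> p = ?N p" by (rule chart_outer_normal[OF ch pos p])
  show N': "(?N has_derivative N') (at p)"
    unfolding N'_def by (rule Ck_on_SucD(1)[OF unit_field_smooth[OF ch] U(2)])
  have lin: "linear N'" using has_derivative_linear[OF N'] .
  show orth: "N' v \<bullet> \<nu> p = 0" for v
  proof -
    have "((\<lambda>x. ?N x \<bullet> ?N x) has_derivative (\<lambda>v. ?N p \<bullet> N' v + N' v \<bullet> ?N p)) (at p)"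
      by (intro has_derivative_inner N')
    moreover have "((\<lambda>x. ?N x \<bullet> ?N x) has_derivative (\<lambda>v. 0)) (at p)"
      by (rule has_derivative_transform_within_open[OF has_derivative_const[of 1] U])
        (use unit_field_norm[OF ch] in \<open>simp add: norm_eq_1\<close>)
    ultimately have "(\<lambda>v. ?N p \<bullet> N' v + N' v \<bullet> ?N p) = (\<lambda>v. 0)" by (rule has_derivative_unique)
    from fun_cong[OF this, of v] show ?thesis by (simp add: nu inner_commute)
  qed
  define g' where "g' = frechet_derivative g (at p)"
  have gC: "Ck_on k U g" for k using ch by (simp add: chart_def)
  have g': "(g has_derivative g') (at p)"
    unfolding g'_def by (rule Ck_on_SucD(1)[OF gC U(2)])
  have tan: "v \<bullet> g p = 0 \<longleftrightarrow> v \<bullet> \<nu> p = 0" for v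
    using ch p by (auto simp: nu unit_field_def chart_def)
  have N'g': "N' v \<bullet> w = inverse (norm (g p)) * (g' v \<bullet> w)" if w: "w \<bullet> \<nu> p = 0" for v w
  proof -
    have "Ck_on (Suc 0) U (\<lambda>x. inverse (norm (g x)))"
      by (intro Ck_on_inverse Ck_on_norm gC U) (use ch in \<open>auto simp: chart_def\<close>)
    from Ck_on_SucD(1)[OF this U(2)] obtain q' where "((\<lambda>x. inverse (norm (g x))) has_derivative q') (at p)" by blast
    from has_derivative_scaleR[OF this g']
    have "(?N has_derivative (\<lambda>v. inverse (norm (g p)) *\<^sub>R g' v + q' v *\<^sub>R g p)) (at p)"
      unfolding unit_field_def[abs_def] .
    then have "N' v = inverse (norm (g p)) *\<^sub>R g' v + q' v *\<^sub>R g p"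
      using has_derivative_unique[OF N'] by metis
    moreover have "g p \<bullet> w = 0" using w tan[of w] by (simp add: inner_commute)
    ultimately show ?thesis by (simp add: inner_add_left)
  qed
  have g'sym: "g' v \<bullet> w = g' w \<bullet> v" for v w
  proof -
    have e: "frechet_derivative (\<lambda>y. frechet_derivative F (at y) v) (at p) w = g' w \<bullet> v" for v w
    proof (rule frechet_derivative_eqI)
      show "((\<lambda>y. frechet_derivative F (at y) v) has_derivative (\<lambda>w. g' w \<bullet> v)) (at p)"
        by (rule has_derivative_transform_within_open[OF has_derivative_inner_left[OF g'] U])
          (use ch in \<open>auto simp: chart_def frechet_derivative_eqI\<close>)
    qed
    have "Ck_on 2 U F" using ch by (simp add: chart_def)
    from second_derivative_symmetric_real[OF U this, of v w] show ?thesis unfolding e by simp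
  qed
  let ?V = "tangent (\<nu> p)"
  have V: "?V = {v. v \<bullet> \<nu> p = 0}" by (simp add: tangent_def)
  have subV: "subspace ?V" unfolding V by (rule subspace_hyperplane2)
  have symV: "N' v \<bullet> w = v \<bullet> N' w" if "v \<in> ?V" "w \<in> ?V" for v w
    using N'g'[of w v] N'g'[of v w] g'sym[of v w] that by (simp add: V inner_commute[of v])
  have "\<exists>B f. orthonormal B \<and> B \<subseteq> ?V \<and> span B = ?V \<and> card B = dim ?V \<and> (\<forall>b\<in>B. N' b = f b *\<^sub>R b)"
    by (rule spectral_theorem[OF lin subV]) (use orth symV in \<open>auto simp: V\<close>)
  then obtain B f where B: "orthonormal B" "span B = ?V" "\<And>b. b \<in> B \<Longrightarrow> N' b = f b *\<^sub>R b" by blast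
  have fin: "finite B" using orthonormal_finite[OF B(1)] .
  \<comment> \<open>The normal and its extension coincide on \<open>M\<close> near \<open>p\<close>,
    so the derivative inside \<open>Gauss_curvature\<close> equals \<open>N'\<close> on tangent
    vectors.\<close>
  have Nu': "(\<nu> has_derivative N') (at p within M)"
  proof -
    obtain r where r: "r > 0" "ball p r \<subseteq> U" using U openE by blast
    show ?thesis
    proof (rule has_derivative_transform_within[OF has_derivative_at_withinI[OF N'] r(1)])
      show "p \<in> M" using p by simp
      show "?N x = \<nu> x" if "x \<in> M" "dist x p < r" for x
        using chart_outer_normal[OF ch pos, of x] that r by (auto simp: dist_commute)
    qed
  qed
  then have fd: "(\<nu> has_derivative frechet_derivative \<nu> (at p within M)) (at p within M)"
    using frechet_derivative_works differentiable_def by blast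
  have agree: "frechet_derivative \<nu> (at p within M) v = N' v" if "v \<in> ?V" for v
    by (rule derivative_unique_approx_tangent[OF chart_approx_tangent[OF ch p] fd Nu'])
      (use that tan in \<open>simp add: V inner_commute\<close>)
  have "eigenvalues ?V (frechet_derivative \<nu> (at p within M)) = image_mset f (mset_set B)"
    by (rule eigenvalues_orthonormal[OF lin agree B])
  then have "0 < (\<Prod>b\<in>B. f b)"
    using curvature[of p] p by (simp add: Gauss_curvature_def prod_unfold_prod_mset)
  then have f0: "f b \<noteq> 0" if "b \<in> B" for b using fin that by (metis less_irrefl prod_zero_iff)
  show "v = 0" if v: "v \<bullet> \<nu> p = 0" "N' v = 0" for v
  proof -
    have ex: "(\<Sum>b\<in>B. (v \<bullet> b) *\<^sub>R b) = v" using orthonormal_expand[OF B(1) fin] B(2) v(1) V by simp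
    have "v \<bullet> b = 0" if b: "b \<in> B" for b
    proof -
      have "b \<in> ?V" using B(2) b span_base by blast
      then have "N' v \<bullet> b = f b * (v \<bullet> b)" using symV[of v b] v(1) B(3)[OF b] by (simp add: V)
      then show ?thesis using v(2) f0[OF b] by simp
    qed
    then show ?thesis using ex by simp
  qed
qed

text \<open>Two contact points would span a segment in \<open>M\<close> with constant normal; the
  shape operator would annihilate its direction, against injectivity.\<close>

lemma supports_unique:
  assumes z: "z \<noteq> 0" and p: "supports z p" and q: "supports z q"
  shows "p = q"
proof -
  define z1 where "z1 = (1 / norm z) *\<^sub>R z"
  have z1: "norm z1 = 1" "supports z1 p" "supports z1 q" "z1 \<noteq> 0"
    using z p q by (auto simp: z1_def supports_scale)
  define v where "v = q - p"
  define S where "S = (\<lambda>t. p + t *\<^sub>R v) ` {0..1::real}"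
  have pq: "p \<bullet> z1 = q \<bullet> z1" using z1(2,3) by (auto simp: supports_def intro: antisym)
  then have vz: "v \<bullet> z1 = 0" by (simp add: v_def inner_diff_left)
  have S: "x \<in> M \<and> \<nu> x = z1" if x: "x \<in> S" for x
  proof -
    obtain t where t: "0 \<le> t" "t \<le> 1" "x = p + t *\<^sub>R v" using x by (auto simp: S_def)
    have "x = (1 - t) *\<^sub>R p + t *\<^sub>R q" by (simp add: t v_def algebra_simps)
    then have "x \<in> K" using convex_K t z1(2,3) by (auto simp: convex_alt supports_def)
    moreover have "x \<bullet> z1 = p \<bullet> z1" using t vz by (simp add: inner_add_left)
    ultimately have "supports z1 x" using z1(2) by (simp add: supports_def)
    then show ?thesis using supports_frontier[OF z1(4)] outer_normal_eq z1(1) by blast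
  qed
  have pM: "p \<in> M" using supports_frontier[OF z p] .
  obtain U F g where ch: "chart U F g" "p \<in> U" "\<And>x. x \<in> U \<Longrightarrow> 0 < g x \<bullet> x"
    by (rule exists_chart[OF pM], rule that)
  have pU: "p \<in> M \<inter> U" using pM ch by blast
  note so = shape_operator[OF ch(1,3) pU]
  let ?N' = "frechet_derivative (unit_field g) (at p)"
  have pS: "p \<in> S" unfolding S_def by (rule image_eqI[of _ _ 0]) auto
  have "open U" using ch by (simp add: chart_def)
  then obtain r where r: "r > 0" "ball p r \<subseteq> U" using ch(2) openE by blast
  have "(unit_field g has_derivative (\<lambda>_. 0)) (at p within S)"
  proof (rule has_derivative_transform_within[OF has_derivative_const[of z1] r(1) pS])
    fix x assume x: "x \<in> S" "dist x p < r"
    then have "x \<in> M \<inter> U" using S r by (auto simp: dist_commute)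
    then show "z1 = unit_field g x" using chart_outer_normal[OF ch(1,3)] S x by metis
  qed
  moreover have "(unit_field g has_derivative ?N') (at p within S)"
    using so(1) by (rule has_derivative_at_withinI)
  moreover have "approx_tangent S p v"
    unfolding approx_tangent_def
  proof (intro allI impI)
    fix e :: real assume e: "e > 0"
    define t where "t = min 1 (e / 2)"
    have "0 < t" "t < e" "t \<le> 1" using e by (auto simp: t_def)
    then have "p + t *\<^sub>R v + 0 \<in> S" by (auto simp: S_def)
    then show "\<exists>t r. 0 < t \<and> t < e \<and> norm r \<le> e * t \<and> p + t *\<^sub>R v + r \<in> S"
      using \<open>0 < t\<close> \<open>t < e\<close> e by (intro exI[of _ t] exI[of _ 0]) auto
  qed
  ultimately have "?N' v = 0" using derivative_unique_approx_tangent by metis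
  then have "v = 0" using so(3)[of v] vz S[OF pS] by simp
  then show ?thesis by (simp add: v_def)
qed

section \<open>The contact point map, its smoothness and its derivative\<close>

definition X :: "'a \<Rightarrow> 'a" where "X y = (THE p. supports y p)"

lemma X_eq:
  assumes "y \<noteq> 0" "supports y p"
  shows "X y = p"
  unfolding X_def using assms(2) by (rule the_equality) (rule supports_unique[OF assms(1) _ assms(2)])

lemma X_supports:
  assumes "y \<noteq> 0"
  shows "supports y (X y)"
proof -
  have "K \<noteq> {}" using zero_interior interior_subset by blast
  moreover have "continuous_on K (\<lambda>x. x \<bullet> y)" by (intro continuous_intros)
  ultimately obtain p where "p \<in> K" "\<forall>x\<in>K. x \<bullet> y \<le> p \<bullet> y"
    using continuous_attains_sup[OF compact_K] by metis
  then have "supports y p" by (simp add: supports_def)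
  then show ?thesis using X_eq[OF assms] by simp
qed

lemma X_in_M: "y \<noteq> 0 \<Longrightarrow> X y \<in> M"
  using supports_frontier X_supports by blast

lemma X_scale: "c > 0 \<Longrightarrow> X (c *\<^sub>R y) = X y"
proof -
  assume "c > 0"
  then have "supports (c *\<^sub>R y) = supports y" using supports_scale by blast
  then show ?thesis by (simp add: X_def)
qed

lemma X_outer_normal: "p \<in> M \<Longrightarrow> X (\<nu> p) = p"
  using outer_normal[of p] by (intro X_eq) auto

lemma outer_normal_X:
  assumes "y \<noteq> 0"
  shows "\<nu> (X y) = (1 / norm y) *\<^sub>R y"
proof (rule outer_normal_eq[OF X_in_M[OF assms]])
  show "norm ((1 / norm y) *\<^sub>R y) = 1" using assms by simp
  show "supports ((1 / norm y) *\<^sub>R y) (X y)"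
    using X_supports[OF assms] assms by (subst supports_scale) auto
qed

lemma support_fun_eq: "y \<noteq> 0 \<Longrightarrow> support_fun K y = X y \<bullet> y"
  unfolding support_fun_def using X_supports[of y]
  by (intro cSup_eq_maximum) (auto simp: supports_def)

text \<open>Near a point of \<open>M\<close> the Gauss map extends to the local diffeomorphism \<open>(1 + F) N\<close>, which
  has unit length exactly on \<open>M\<close>; its inverse provides \<open>X\<close>.\<close>

lemma X_smooth_at:
  assumes y0: "y0 \<noteq> 0"
  shows "\<exists>W. open W \<and> y0 \<in> W \<and> Ck_on k W X"
proof -
  define p where "p = X y0"
  have pM: "p \<in> M" unfolding p_def using X_in_M[OF y0] .
  obtain U0 F g where ch0: "chart U0 F g" "p \<in> U0" "\<And>x. x \<in> U0 \<Longrightarrow> 0 < g x \<bullet> x"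
    by (rule exists_chart[OF pM], rule that)
  have C0: "open U0" "\<And>k. Ck_on k U0 F" "\<And>x. x \<in> U0 \<Longrightarrow> (F has_derivative (\<lambda>v. g x \<bullet> v)) (at x)"
    "M \<inter> U0 = {x\<in>U0. F x = 0}"
    using ch0(1) by (auto simp: chart_def)
  \<comment> \<open>On this set \<open>1 + F x\<close> is positive and equals the length of the map
    below, so unit length forces \<open>F x = 0\<close>.\<close>
  define U where "U = {x\<in>U0. - 1 < F x}"
  have oU: "open U"
  proof -
    have "open (U0 \<inter> F -` {- 1<..})"
      using C0(1) Ck_on_imp_continuous_on[OF C0(2)] by (intro continuous_open_preimage) auto
    moreover have "U = U0 \<inter> F -` {- 1<..}" by (auto simp: U_def)
    ultimately show ?thesis by simp
  qed
  have Fp: "F p = 0" using pM ch0(2) C0(4) by blast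
  have pU: "p \<in> U" "p \<in> M \<inter> U0" using Fp ch0(2) pM by (auto simp: U_def)
  let ?N = "unit_field g"
  let ?\<Psi> = "\<lambda>x. (1 + F x) *\<^sub>R ?N x"
  have sub: "U \<subseteq> U0" by (auto simp: U_def)
  have PsiC: "Ck_on k U ?\<Psi>" for k
    by (intro Ck_on_scaleR Ck_on_add Ck_on_const oU Ck_on_subset[OF C0(2) sub] Ck_on_subset[OF unit_field_smooth[OF ch0(1)] sub])
  note so = shape_operator[OF ch0(1,3) pU(2)]
  have nu: "\<nu> p = ?N p" by (rule chart_outer_normal[OF ch0(1,3) pU(2)])
  have inj: "v = 0" if v: "frechet_derivative ?\<Psi> (at p) v = 0" for v
  proof -
    \<comment> \<open>At \<open>p\<close> the derivative of the normal field is tangential and the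
      part from \<open>F\<close> is normal, so both vanish when their sum does.\<close>
    have "(?\<Psi> has_derivative (\<lambda>v. (1 + F p) *\<^sub>R frechet_derivative ?N (at p) v + (0 + g p \<bullet> v) *\<^sub>R ?N p)) (at p)"
      by (intro has_derivative_scaleR has_derivative_add has_derivative_const C0(3) ch0(2) so(1))
    then have e: "frechet_derivative ?N (at p) v + (g p \<bullet> v) *\<^sub>R ?N p = 0"
      using v frechet_derivative_eqI Fp by fastforce
    then have "(frechet_derivative ?N (at p) v + (g p \<bullet> v) *\<^sub>R ?N p) \<bullet> ?N p = 0" by simp
    then have "g p \<bullet> v = 0"
      using so(2)[of v] unit_field_norm[OF ch0(1,2)] by (simp add: inner_add_left nu norm_eq_1)
    then have "frechet_derivative ?N (at p) v = 0" "v \<bullet> \<nu> p = 0"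
      using e by (auto simp: nu unit_field_def inner_commute)
    then show ?thesis using so(3) by blast
  qed
  obtain U' V G where G: "open U'" "U' \<subseteq> U" "p \<in> U'" "open V" "?\<Psi> p \<in> V" "homeomorphism U' V ?\<Psi> G" "\<And>k. Ck_on k V G"
    using smooth_inverse_function[OF oU pU(1) PsiC inj] by metis
  let ?n = "\<lambda>y::'a. inverse (norm y) *\<^sub>R y"
  define W where "W = punctured \<inter> ?n -` V"
  have nC: "Ck_on k punctured ?n" for k
    by (intro Ck_on_scaleR Ck_on_inverse Ck_on_norm Ck_on_id open_punctured) auto
  have oW: "open W"
    unfolding W_def using G(4) Ck_on_imp_continuous_on[OF nC] by (intro continuous_open_preimage) auto
  have "?\<Psi> p = ?n y0"
    using outer_normal_X[OF y0] nu Fp by (simp add: p_def divide_inverse)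
  then have yW: "y0 \<in> W" using G(5) y0 by (simp add: W_def)
  have XG: "X y = G (?n y)" if y: "y \<in> W" for y
  proof -
    have y': "y \<noteq> 0" "?n y \<in> V" using y by (auto simp: W_def)
    define x where "x = G (?n y)"
    have x: "x \<in> U'" "?\<Psi> x = ?n y"
      using homeomorphism_image2[OF G(6)] homeomorphism_apply2[OF G(6)] y'(2) by (auto simp: x_def)
    have xU: "x \<in> U0" "- 1 < F x" using x G(2) by (auto simp: U_def)
    have "norm (?\<Psi> x) = 1" using x(2) y'(1) by simp
    then have "F x = 0" using unit_field_norm[OF ch0(1) xU(1)] xU(2) by simp
    then have xM: "x \<in> M \<inter> U0" using C0(4) xU by blast
    have "\<nu> x = ?n y" using chart_outer_normal[OF ch0(1,3) xM] x(2) \<open>F x = 0\<close> by simp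
    then have "supports (?n y) x" using outer_normal(2)[of x] xM by simp
    then have "supports y x" using y'(1) by (simp add: supports_scale)
    then show ?thesis using X_eq[OF y'(1)] by (simp add: x_def)
  qed
  have "Ck_on k W (\<lambda>y. G (?n y))"
    by (rule Ck_on_compose[OF oW G(4) _ G(7)]) (auto simp: W_def intro!: Ck_on_subset[OF nC])
  then have "Ck_on k W X" using Ck_on_cong[OF oW XG] by simp
  then show ?thesis using oW yW by blast
qed

lemma X_smooth: "Ck_on k punctured X"
  by (rule Ck_on_local) (use X_smooth_at in blast)

text \<open>Each contact point competes in the supremum of the other direction. This traps the
  first-order remainder between 0 and \<open>(X x - X y) \<bullet> (x - y)\<close>, which continuity
  of \<open>X\<close> makes small against \<open>norm (x - y)\<close>.\<close>

lemma support_fun_deriv: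
  assumes y: "y \<noteq> 0"
  shows "(support_fun K has_derivative (\<lambda>v. X y \<bullet> v)) (at y)"
  unfolding has_derivative_at_alt
proof (intro conjI allI impI)
  show "bounded_linear ((\<bullet>) (X y))" by (rule bounded_linear_inner_right)
  fix e :: real assume e: "e > 0"
  have "isCont X y"
    using Ck_on_imp_continuous_on[OF X_smooth] y by (simp add: continuous_on_eq_continuous_at open_punctured)
  then obtain d where d: "d > 0" "\<And>x. dist x y < d \<Longrightarrow> dist (X x) (X y) < e"
    using e unfolding continuous_at_eps_delta by (auto simp: dist_norm)
  show "\<exists>d>0. \<forall>x. norm (x - y) < d \<longrightarrow> norm (support_fun K x - support_fun K y - X y \<bullet> (x - y)) \<le> e * norm (x - y)"
  proof (intro exI[of _ "min d (norm y)"] conjI allI impI)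
    show "0 < min d (norm y)" using d y by simp
    fix x assume x: "norm (x - y) < min d (norm y)"
    then have x0: "x \<noteq> 0" by auto
    have "X y \<bullet> x \<le> X x \<bullet> x" "X x \<bullet> y \<le> X y \<bullet> y"
      using X_supports[OF x0] X_supports[OF y] by (auto simp: supports_def)
    then have "0 \<le> support_fun K x - support_fun K y - X y \<bullet> (x - y)"
      "support_fun K x - support_fun K y - X y \<bullet> (x - y) \<le> (X x - X y) \<bullet> (x - y)"
      unfolding support_fun_eq[OF x0] support_fun_eq[OF y] by (auto simp: inner_diff_left inner_diff_right)
    moreover have "(X x - X y) \<bullet> (x - y) \<le> e * norm (x - y)"
    proof -
      have "(X x - X y) \<bullet> (x - y) \<le> norm (X x - X y) * norm (x - y)" by (rule norm_cauchy_schwarz)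
      also have "\<dots> \<le> e * norm (x - y)"
        using d(2)[of x] x by (intro mult_right_mono) (auto simp: dist_norm)
      finally show ?thesis .
    qed
    ultimately show "norm (support_fun K x - support_fun K y - X y \<bullet> (x - y)) \<le> e * norm (x - y)" by simp
  qed
qed

lemma X_has_derivative: "y \<noteq> 0 \<Longrightarrow> (X has_derivative frechet_derivative X (at y)) (at y)"
  by (rule Ck_on_SucD(1)[OF X_smooth]) simp

text \<open>Adding the support inequalities at \<open>y\<close> and \<open>y + t *\<^sub>R v\<close>
  shows that \<open>X\<close> is monotone in direction \<open>v\<close>.\<close>

lemma X_derivative_nonneg:
  assumes y: "y \<noteq> 0"
  shows "0 \<le> frechet_derivative X (at y) v \<bullet> v"
proof (rule ccontr)
  assume neg: "\<not> ?thesis"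
  have "((\<lambda>s. X (y + s *\<^sub>R v) \<bullet> v) has_real_derivative frechet_derivative X (at y) v \<bullet> v) (at 0)"
    by (rule has_real_derivative_along_line[of "\<lambda>y. X y \<bullet> v"])
      (auto intro!: has_derivative_inner_left X_has_derivative y)
  from DERIV_neg_dec_right[OF this] neg
  obtain d where d: "d > 0" "\<And>t. 0 < t \<Longrightarrow> t < d \<Longrightarrow> X (y + (0 + t) *\<^sub>R v) \<bullet> v < X (y + 0 *\<^sub>R v) \<bullet> v"
    by (simp only: not_le) blast
  \<comment> \<open>The second bound keeps \<open>y + t *\<^sub>R v\<close> away from the origin,
    where there is no unique contact point.\<close>
  define t where "t = min (d / 2) (norm y / (2 * (norm v + 1)))"
  have nv: "norm v + 1 > 0" by (simp add: add_nonneg_pos)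
  have t: "0 < t" "t < d" using d y nv by (auto simp: t_def min_less_iff_disj)
  have "norm (t *\<^sub>R v) \<le> t * (norm v + 1)" using t by simp
  also have "\<dots> \<le> norm y / (2 * (norm v + 1)) * (norm v + 1)" using nv by (intro mult_right_mono) (auto simp: t_def)
  also have "\<dots> = norm y / 2" using nv by (simp add: field_simps)
  also have "\<dots> < norm y" using y by simp
  finally have y1: "y + t *\<^sub>R v \<noteq> 0" by (metis add_eq_0_iff less_irrefl norm_minus_cancel)
  have "X (y + t *\<^sub>R v) \<bullet> y \<le> X y \<bullet> y" "X y \<bullet> (y + t *\<^sub>R v) \<le> X (y + t *\<^sub>R v) \<bullet> (y + t *\<^sub>R v)"
    using X_supports[OF y] X_supports[OF y1] by (auto simp: supports_def)
  then have "t * (X y \<bullet> v) \<le> t * (X (y + t *\<^sub>R v) \<bullet> v)" by (simp add: inner_add_right)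
  then show False using t d(2)[OF t] by simp
qed

text \<open>Along \<open>X\<close> the unit normal field is \<open>x / norm x\<close>. If the
  derivative of \<open>X\<close> annihilates \<open>v\<close>, so does that of
  \<open>x / norm x\<close>, which is \<open>v / norm y\<close> for \<open>v\<close> orthogonal to
  \<open>y\<close>.\<close>

lemma X_derivative_inj:
  assumes y: "y \<noteq> 0" and v: "v \<bullet> y = 0" "frechet_derivative X (at y) v = 0"
  shows "v = 0"
proof -
  obtain U F g where ch: "chart U F g" "X y \<in> U" "\<And>x. x \<in> U \<Longrightarrow> 0 < g x \<bullet> x"
    by (rule exists_chart[OF X_in_M[OF y]], rule that)
  have oU: "open U" using ch by (simp add: chart_def)
  have "(unit_field g has_derivative frechet_derivative (unit_field g) (at (X y))) (at (X y))"
    by (rule Ck_on_SucD(1)[OF unit_field_smooth[OF ch(1)] ch(2)])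
  from has_derivative_compose[OF X_has_derivative[OF y] this]
  have 1: "((\<lambda>x. unit_field g (X x)) has_derivative
      (\<lambda>v. frechet_derivative (unit_field g) (at (X y)) (frechet_derivative X (at y) v))) (at y)" .
  have oW: "open (punctured \<inter> X -` U)"
    using Ck_on_imp_continuous_on[OF X_smooth] oU by (intro continuous_open_preimage) auto
  have "((\<lambda>x. (1 / norm x) *\<^sub>R x) has_derivative
      (\<lambda>v. frechet_derivative (unit_field g) (at (X y)) (frechet_derivative X (at y) v))) (at y)"
  proof (rule has_derivative_transform_within_open[OF 1 oW])
    show "y \<in> punctured \<inter> X -` U" using y ch by simp
    fix x assume "x \<in> punctured \<inter> X -` U"
    then have x: "x \<noteq> 0" "X x \<in> M \<inter> U" using X_in_M by auto
    then show "unit_field g (X x) = (1 / norm x) *\<^sub>R x"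
      using chart_outer_normal[OF ch(1,3) x(2)] outer_normal_X[OF x(1)] by simp
  qed
  moreover have "((\<lambda>x. (1 / norm x) *\<^sub>R x) has_derivative
      (\<lambda>v. (1 / norm y) *\<^sub>R v + ((0 * norm y - 1 * (v \<bullet> sgn y)) / (norm y * norm y)) *\<^sub>R y)) (at y)"
    by (rule has_derivative_scaleR[OF has_derivative_divide'[OF has_derivative_const has_derivative_norm[OF y]] has_derivative_ident])
      (use y in simp)
  ultimately have "frechet_derivative (unit_field g) (at (X y)) (frechet_derivative X (at y) v)
     = (1 / norm y) *\<^sub>R v + ((0 * norm y - 1 * (v \<bullet> sgn y)) / (norm y * norm y)) *\<^sub>R y"
    using has_derivative_unique fun_cong[of _ _ v] by blast
  moreover have "linear (frechet_derivative (unit_field g) (at (X y)))"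
    using has_derivative_linear[OF Ck_on_SucD(1)[OF unit_field_smooth[OF ch(1)] ch(2)]] .
  ultimately have "(1 / norm y) *\<^sub>R v = 0" using v by (simp add: linear_0 sgn_div_norm)
  then show ?thesis using y by simp
qed

sublocale gauss_inverse X "support_fun K"
proof
  show "0 < support_fun K x" if "x \<noteq> 0" for x
    using supports_pos[OF that X_supports[OF that]] support_fun_eq[OF that] by simp
qed (auto intro: X_smooth support_fun_eq support_fun_deriv X_scale X_derivative_nonneg X_derivative_inj)

end


section \<open>The main theorem\<close>

text \<open>\<open>sphere_diff\<close> picks some derivative within the sphere; all of them agree on
  tangent vectors, so any known one computes it there.\<close>

lemma frechet_derivative_within_sphere:
  fixes f :: "'a::euclidean_space \<Rightarrow> 'b::real_normed_vector"
  assumes "(f has_derivative f') (at z within sphere 0 1)" "norm z = 1" "v \<bullet> z = 0"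
  shows "sphere_diff f z v = f' v"
proof -
  have "(f has_derivative frechet_derivative f (at z within sphere 0 1)) (at z within sphere 0 1)"
    using assms(1) frechet_derivative_works differentiable_def by blast
  then show ?thesis
    unfolding sphere_diff_def
    using derivative_unique_approx_tangent[OF approx_tangent_sphere[OF assms(2,3)] _ assms(1)] by blast
qed

section \<open>Identification with the spherical quantities of the statement\<close>

context smooth_convex_body
begin

lemma sphere_grad_support_fun:
  assumes z: "norm z = 1"
  shows "sphere_grad (support_fun K) z = X z - support_fun K z *\<^sub>R z"
  unfolding sphere_grad_def
proof (rule the_equality)
  have z0: "z \<noteq> 0" and zz: "z \<bullet> z = 1" using z by (auto simp: norm_eq_1)
  have d: "sphere_diff (support_fun K) z v = X z \<bullet> v" if "v \<in> tangent z" for v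
    by (rule frechet_derivative_within_sphere[OF has_derivative_at_withinI[OF support_fun_deriv[OF z0]] z])
      (use that in \<open>simp add: tangent_def\<close>)
  let ?g = "X z - support_fun K z *\<^sub>R z"
  have gt: "?g \<in> tangent z" by (simp add: tangent_def inner_diff_left support_fun_eq[OF z0] zz)
  have gv: "?g \<bullet> v = X z \<bullet> v" if "v \<in> tangent z" for v
    using that by (simp add: tangent_def inner_diff_left inner_commute[of z])
  show "?g \<in> tangent z \<and> (\<forall>v\<in>tangent z. ?g \<bullet> v = sphere_diff (support_fun K) z v)"
    using gt gv d by simp
  fix g assume g: "g \<in> tangent z \<and> (\<forall>v\<in>tangent z. g \<bullet> v = sphere_diff (support_fun K) z v)"
  have t: "g - ?g \<in> tangent z" using g gt by (simp add: tangent_def inner_diff_left)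
  have "g \<bullet> (g - ?g) = ?g \<bullet> (g - ?g)" using g gv[OF t] d[OF t] t by simp
  then have "(g - ?g) \<bullet> (g - ?g) = 0" by (simp add: inner_diff_left)
  then show "g = ?g" by simp
qed

lemma X_map_support_fun: "norm z = 1 \<Longrightarrow> X_map (support_fun K) z = X z"
  by (simp add: X_map_def sphere_grad_support_fun)

text \<open>On the sphere the gradient field is \<open>X x - h x *\<^sub>R x\<close>; projecting its
  derivative removes the radial term, and the summand \<open>u z *\<^sub>R v\<close> of
  \<open>W_op\<close> cancels the remaining multiple of \<open>v\<close>.\<close>

lemma W_op_support_fun:
  assumes z: "norm z = 1" and v: "v \<bullet> z = 0"
  shows "W_op (support_fun K) z v = A z v"
proof -
  have z0: "z \<noteq> 0" and zz: "z \<bullet> z = 1" using z by (auto simp: norm_eq_1)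
  have "((\<lambda>x. X x - support_fun K x *\<^sub>R x) has_derivative
      (\<lambda>v. A z v - (support_fun K z *\<^sub>R v + (X z \<bullet> v) *\<^sub>R z))) (at z within sphere 0 1)"
    by (rule has_derivative_at_withinI[OF has_derivative_diff[OF X_deriv[OF z0]
        has_derivative_scaleR[OF support_fun_deriv[OF z0] has_derivative_ident]]])
  then have "(sphere_grad (support_fun K) has_derivative
      (\<lambda>v. A z v - (support_fun K z *\<^sub>R v + (X z \<bullet> v) *\<^sub>R z))) (at z within sphere 0 1)"
    by (rule has_derivative_transform_within[of _ _ _ _ 1]) (use z in \<open>auto simp: sphere_grad_support_fun\<close>)
  from frechet_derivative_within_sphere[OF this z v]
  have "sphere_diff (sphere_grad (support_fun K)) z v = A z v - (support_fun K z *\<^sub>R v + (X z \<bullet> v) *\<^sub>R z)" .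
  then show ?thesis
    unfolding W_op_def sphere_cov_def Let_def
    using v zz A_orthogonal[OF z0, of v] by (simp add: inner_diff_left inner_add_left)
qed

lemma P_sym_support_fun:
  assumes n: "DIM('a) = n + 1" and z: "norm z = 1"
  shows "P_sym j (support_fun K) z = E j z / real (n choose j)"
proof -
  have z0: "z \<noteq> 0" using z by auto
  obtain B f where B: "orthonormal B" "span B = {v. v \<bullet> z = 0}" "card B = DIM('a) - 1"
    "\<And>b. b \<in> B \<Longrightarrow> A z b = f b *\<^sub>R b" "\<forall>b\<in>B. 0 < f b"
    by (rule eigenbasis[OF z0], rule that)
  have t: "span B = tangent z" using B(2) by (simp add: tangent_def)
  have "eigenvalues (tangent z) (W_op (support_fun K) z) = image_mset f (mset_set B)"
    by (rule eigenvalues_orthonormal[OF A_linear[OF z0] _ B(1) t B(4)])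
      (use W_op_support_fun[OF z] in \<open>auto simp: tangent_def\<close>)
  then have "elem_sym j (sorted_list_of_multiset (eigenvalues (tangent z) (W_op (support_fun K) z))) = esym j f B"
    by (intro elem_sym_mset_eq orthonormal_finite[OF B(1)]) simp
  also have "\<dots> = E j z" using E_eq_esym[OF z _ B(1,2,4), of 1 j] by simp
  finally have "elem_sym j (sorted_list_of_multiset (eigenvalues (tangent z) (W_op (support_fun K) z))) = E j z" .
  moreover have "dim (tangent z) = n"
    using dim_span_eq_card_independent[OF orthonormal_independent[OF B(1)]] t B(3) n by simp
  ultimately show ?thesis by (simp add: P_sym_def)
qed

lemma E_homogeneous:
  assumes z: "norm z = 1" and c: "c > 0"
  shows "E j (c *\<^sub>R z) = E j z"
proof -
  have z0: "z \<noteq> 0" using z by auto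
  obtain B f where B: "orthonormal B" "span B = {v. v \<bullet> z = 0}" "card B = DIM('a) - 1"
    "\<And>b. b \<in> B \<Longrightarrow> A z b = f b *\<^sub>R b" "\<forall>b\<in>B. 0 < f b"
    by (rule eigenbasis[OF z0], rule that)
  show ?thesis using E_eq_esym[OF z c B(1,2,4)] E_eq_esym[OF z _ B(1,2,4), of 1 j] by simp
qed

lemma E_pos:
  assumes z: "norm z = 1" and j: "j \<le> DIM('a) - 1"
  shows "0 < E j z"
proof -
  have z0: "z \<noteq> 0" using z by auto
  obtain B f where B: "orthonormal B" "span B = {v. v \<bullet> z = 0}" "card B = DIM('a) - 1"
    "\<And>b. b \<in> B \<Longrightarrow> A z b = f b *\<^sub>R b" "\<forall>b\<in>B. 0 < f b"
    by (rule eigenbasis[OF z0], rule that)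
  show ?thesis
    using E_eq_esym[OF z _ B(1,2,4), of 1 j] esym_pos[OF orthonormal_finite[OF B(1)] B(5)] j B(3) by simp
qed

lemma E_umbilic:
  assumes z: "norm z = 1" and A: "\<And>v. v \<bullet> z = 0 \<Longrightarrow> A z v = R *\<^sub>R v"
  shows "E j z = R ^ j * real ((DIM('a) - 1) choose j)"
proof -
  have z0: "z \<noteq> 0" using z by auto
  obtain B f where B: "orthonormal B" "span B = {v. v \<bullet> z = 0}" "card B = DIM('a) - 1"
    "\<And>b. b \<in> B \<Longrightarrow> A z b = f b *\<^sub>R b" "\<forall>b\<in>B. 0 < f b"
    by (rule eigenbasis[OF z0], rule that)
  have fin: "finite B" using orthonormal_finite[OF B(1)] .
  have b: "A z b = R *\<^sub>R b" if "b \<in> B" for b using A B(2) that span_base by blast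
  have "E j z = esym j (\<lambda>b. R) B" using E_eq_esym[OF z _ B(1,2) b, of 1 j] by simp
  also have "\<dots> = (\<Sum>J | J \<subseteq> B \<and> card J = j. R ^ j)"
    unfolding esym_def by (intro sum.cong refl) auto
  also have "\<dots> = R ^ j * real (card B choose j)"
    using n_subsets[OF fin, of j] by simp
  finally show ?thesis using B(3) by simp
qed

end

theorem corollary1p2:
  fixes M K :: "'a::euclidean_space set"
    and n k l :: nat
    and \<alpha> :: real
    and \<phi> :: "real \<Rightarrow> real"
  assumes dim: "DIM('a) = n + 1"
    and n: "2 \<le> n"
    and kl: "l < k" "k \<le> n"
    and \<alpha>: "0 \<le> \<alpha>" "\<alpha> < 1"
    and \<phi>_pos: "\<And>t. t > 0 \<Longrightarrow> \<phi> t > 0"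
    and \<phi>_C1: "\<phi> C1_differentiable_on {0<..}"
    and \<phi>_incr: "\<And>t. t > 0 \<Longrightarrow> deriv \<phi> t \<ge> 0"
    and M: "smooth_strictly_convex M K"
    and eq: "\<And>z. z \<in> sphere 0 1 \<Longrightarrow>
      (P_sym k (support_fun K) z / P_sym l (support_fun K) z) powr (1 / real (k - l))
        = support_fun K z powr \<alpha> * \<phi> (radial_fun (support_fun K) z)"
  shows "(\<exists>c R. R > 0 \<and> M = sphere c R) \<and>
    ((\<forall>t>0. deriv \<phi> t > 0) \<longrightarrow> (\<exists>R>0. M = sphere 0 R))"
proof -
  interpret smooth_convex_body M K by unfold_locales (rule M)
  \<comment> \<open>\<open>u\<close> and \<open>X\<close> have degree zero, so this extends the
    right side of the equation from the sphere with degree zero.\<close>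
  define F where "F x = u x powr \<alpha> * \<phi> (norm (X x))" for x
  have r_pos: "0 < norm (X x)" if "x \<noteq> 0" for x using X_nonzero[OF that] by simp
  obtain D where D: "\<And>t. t > 0 \<Longrightarrow> (\<phi> has_vector_derivative D t) (at t)" "continuous_on {0<..} D"
    using \<phi>_C1 unfolding C1_differentiable_on_def by auto
  have D': "(\<phi> has_real_derivative D t) (at t)" if "t > 0" for t
    using D(1)[OF that] by (simp add: has_real_derivative_iff_has_vector_derivative)
  have D_deriv: "deriv \<phi> t = D t" if "t > 0" for t using D'[OF that] by (rule DERIV_imp_deriv)
  have phiC: "Ck_on 1 {0<..} \<phi>"
    unfolding One_nat_def
  proof (rule Ck_on_SucI)
    show "(\<phi> has_derivative (\<lambda>h. D t * h)) (at t)" if "t \<in> {0<..}" for t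
      using D'[of t] that by (simp add: has_field_derivative_def)
    show "Ck_on 0 {0<..} (\<lambda>t. D t * v)" for v
      using D(2) by (auto simp: Ck_on.simps intro!: continuous_intros)
  qed auto
  have FC: "Ck_on 1 punctured F"
    unfolding F_def[abs_def]
  proof (rule Ck_on_mult[OF open_punctured])
    show "Ck_on 1 punctured (\<lambda>x. u x powr \<alpha>)"
      by (rule Ck_on_compose[OF open_punctured open_greaterThan _ Ck_on_powr u_C1]) (use u_pos in auto)
    show "Ck_on 1 punctured (\<lambda>x. \<phi> (norm (X x)))"
      by (rule Ck_on_compose[OF open_punctured open_greaterThan _ phiC r_C1]) (use r_pos in auto)
  qed
  have Fpos: "0 < F x" if "x \<noteq> 0" for x
    unfolding F_def using u_pos[OF that] \<phi>_pos[OF r_pos[OF that]] by simp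
  have Fgrad: "\<exists>a b. 0 \<le> a \<and> 0 \<le> b \<and> (F has_derivative (\<lambda>v. a * (w x \<bullet> v) + b * (A x (w x) \<bullet> v))) (at x)"
    if x: "x \<noteq> 0" for x
  proof -
    let ?r = "norm (X x)"
    define a where "a = \<alpha> * u x powr (\<alpha> - 1) / norm x * \<phi> ?r"
    define b where "b = u x powr \<alpha> * D ?r / ?r"
    have ab: "0 \<le> a" "0 \<le> b"
      using \<alpha> \<phi>_pos[OF r_pos[OF x]] \<phi>_incr[OF r_pos[OF x]] D_deriv[OF r_pos[OF x]] by (auto simp: a_def b_def)
    have "((\<lambda>s. s powr \<alpha>) has_real_derivative \<alpha> * u x powr (\<alpha> - 1)) (at (u x))"
      by (rule has_real_derivative_powr[OF u_pos[OF x]])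
    from has_derivative_compose[OF u_deriv[OF x] this[unfolded has_field_derivative_def]]
    have 1: "((\<lambda>x. u x powr \<alpha>) has_derivative (\<lambda>v. \<alpha> * u x powr (\<alpha> - 1) * (w x \<bullet> v / norm x))) (at x)" .
    from has_derivative_compose[OF r_deriv[OF x] D'[OF r_pos[OF x], unfolded has_field_derivative_def]]
    have 2: "((\<lambda>x. \<phi> (norm (X x))) has_derivative (\<lambda>v. D ?r * (A x (w x) \<bullet> v / ?r))) (at x)" .
    have "(F has_derivative (\<lambda>v. a * (w x \<bullet> v) + b * (A x (w x) \<bullet> v))) (at x)"
      unfolding F_def[abs_def]
      by (rule has_derivative_eq_rhs[OF has_derivative_mult[OF 1 2]])
        (simp add: fun_eq_iff a_def b_def mult_ac)
    then show ?thesis using ab by blast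
  qed
  have F_unit: "F z ^ (k - l) = (E k z / real (n choose k)) / (E l z / real (n choose l))" if z: "norm z = 1" for z
  proof -
    have z0: "z \<noteq> 0" using z by auto
    let ?q = "(E k z / real (n choose k)) / (E l z / real (n choose l))"
    have q: "0 < ?q" using E_pos[OF z] kl dim by simp
    have "F z = ?q powr (1 / real (k - l))"
      using eq[of z] z P_sym_support_fun[OF dim z]
      by (simp add: F_def u_def radial_fun_def X_map_support_fun)
    moreover have "0 < ?q powr (1 / real (k - l))"
      by (rule powr_gt_zero[THEN iffD2]) (use q in linarith)
    ultimately have "F z ^ (k - l) = (?q powr (1 / real (k - l))) powr real (k - l)"
      by (simp only: powr_realpow)
    also have "\<dots> = ?q"
    proof -
      have "(s powr (1 / real m)) powr real m = s" if "0 < s" "0 < m" for s :: real and m :: nat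
        using that by (simp add: powr_powr)
      then show ?thesis using q kl by (meson zero_less_diff)
    qed
    finally show ?thesis .
  qed
  have F_eq: "F x ^ (k - l) = (E k x / real (n choose k)) / (E l x / real (n choose l))" if x: "x \<noteq> 0" for x
  proof -
    let ?z = "(1 / norm x) *\<^sub>R x"
    have z: "norm ?z = 1" "x = norm x *\<^sub>R ?z" "norm x > 0" using x by auto
    have "E j x = E j ?z" for j using E_homogeneous[OF z(1,3), of j] z(2) by simp
    moreover have "F x = F ?z"
      unfolding F_def using u_scale[of x "1 / norm x"] X_scale[of "1 / norm x" x] x by simp
    ultimately show ?thesis using F_unit[OF z(1)] by simp
  qed
  have umb: "\<exists>\<mu>>0. \<forall>v. v \<bullet> z = 0 \<longrightarrow> A z v = \<mu> *\<^sub>R v" if "norm z = 1" for z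
    by (rule umbilic_of_quotient_equation[OF dim n kl FC Fpos Fgrad F_eq that])
  obtain c R where R: "R > 0" "\<And>z. norm z = 1 \<Longrightarrow> X z = c + R *\<^sub>R z"
    "\<And>z v. norm z = 1 \<Longrightarrow> v \<bullet> z = 0 \<Longrightarrow> A z v = R *\<^sub>R v"
    using sphere_of_umbilic[OF _ umb] dim n by auto
  have M_sphere: "M = sphere c R"
  proof
    show "M \<subseteq> sphere c R"
    proof
      fix p assume p: "p \<in> M"
      have "p = c + R *\<^sub>R outer_normal K p"
        using R(2)[OF outer_normal(1)[OF p]] X_outer_normal[OF p] by simp
      then have "p - c = R *\<^sub>R outer_normal K p" by (simp add: algebra_simps)
      then have "norm (p - c) = R" using R(1) outer_normal(1)[OF p] by simp
      then show "p \<in> sphere c R" by (simp add: dist_norm norm_minus_commute)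
    qed
    show "sphere c R \<subseteq> M"
    proof
      fix p assume "p \<in> sphere c R"
      then have p: "norm (p - c) = R" by (simp add: dist_norm norm_minus_commute)
      define z where "z = (1 / R) *\<^sub>R (p - c)"
      have z: "norm z = 1" using p R(1) by (simp add: z_def)
      have "X z = p" using R(2)[OF z] R(1) by (simp add: z_def)
      moreover have "z \<noteq> 0" using z by auto
      ultimately show "p \<in> M" using X_in_M[of z] by simp
    qed
  qed
  \<comment> \<open>All principal radii equal \<open>R\<close>, so \<open>F\<close> is constant on
    unit vectors. At the poles \<open>e\<close> and \<open>- e\<close> both \<open>u\<close> and the
    norm of \<open>X\<close> are \<open>R + norm c\<close> and \<open>R - norm c\<close>, and strict
    monotonicity of \<phi> separates the two values of \<open>F\<close>.\<close>
  moreover have "c = 0" if inc: "\<forall>t>0. deriv \<phi> t > 0"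
  proof (rule ccontr)
    assume c: "c \<noteq> 0"
    define e where "e = (1 / norm c) *\<^sub>R c"
    have e: "norm e = 1" "norm (- e) = 1" "e \<noteq> 0" and ce: "c = norm c *\<^sub>R e" using c by (auto simp: e_def)
    have ee: "e \<bullet> e = 1" using e by (simp add: norm_eq_1)
    have F_const: "F z = R" if z: "norm z = 1" for z
    proof -
      have Rk: "E j z / real (n choose j) = R ^ j" if "j \<le> n" for j
        using E_umbilic[OF z R(3)[OF z], of j] dim that by simp
      have "F z ^ (k - l) = R ^ k / R ^ l"
        using F_unit[OF z] Rk[of k] Rk[of l] kl by simp
      also have "\<dots> = R ^ (k - l)" using R(1) kl by (simp add: power_diff)
      finally have "F z ^ (k - l) = R ^ (k - l)" .
      moreover have "z \<noteq> 0" using z by auto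
      ultimately show ?thesis
        using Fpos[of z] R(1) kl by (intro power_eq_imp_eq_base[of "F z" "k - l" R]) auto
    qed
    have Xe: "X e = (R + norm c) *\<^sub>R e" "X (- e) = (norm c - R) *\<^sub>R e"
      using R(2)[OF e(1)] R(2)[OF e(2)] ce by (simp_all add: algebra_simps)
    have ue: "u e = R + norm c" "u (- e) = R - norm c"
      using support_fun_eq[of e] support_fun_eq[of "- e"] e Xe ee by (simp_all add: u_def)
    \<comment> \<open>Positivity of the support function in direction \<open>- e\<close> puts the
      origin inside the sphere, which fixes the sign in the norm of \<open>X (- e)\<close>.\<close>
    have less: "norm c < R" using u_pos[of "- e"] ue e by simp
    have re: "norm (X e) = R + norm c" "norm (X (- e)) = R - norm c"
      using Xe e R(1) less by simp_all
    have "\<phi> (R - norm c) < \<phi> (R + norm c)"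
    proof (rule DERIV_pos_imp_increasing[of "R - norm c" "R + norm c" \<phi>])
      show "R - norm c < R + norm c" using c by simp
      show "\<exists>y. (\<phi> has_real_derivative y) (at x) \<and> 0 < y" if "R - norm c \<le> x" "x \<le> R + norm c" for x
      proof -
        have "0 < x" using that less by linarith
        then show ?thesis using D'[of x] D_deriv[of x] inc by (metis)
      qed
    qed
    moreover have "(R - norm c) powr \<alpha> \<le> (R + norm c) powr \<alpha>"
      using \<alpha> less by (intro powr_mono2) auto
    moreover have "0 < (R - norm c) powr \<alpha>" "0 < \<phi> (R - norm c)"
      using less \<phi>_pos[of "R - norm c"] by simp_all
    ultimately have "F (- e) < F e"
      unfolding F_def ue re by (intro mult_le_less_imp_less) simp_all
    then show False using F_const[OF e(1)] F_const[OF e(2)] by simp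
  qed
  ultimately show ?thesis using R(1) by blast
qed


end
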